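(* Let $A$ be a noetherian ring and let $B$ be a smooth $A$-algebra. Then $B$ is flat as an $A$-module.
   Context: All rings are commutative with unit. An $A$-algebra $B$ is essentially of finite type if it is (isomorphic as an $A$-algebra to) a localization $S^{-1}B_0$ of a finitely generated $A$-algebra $B_0$ at a multiplicative subset $S \subset B_0$; equivalently, $B$ is a quotient of a localization of a polynomial ring $A[X_1,\dots,X_n]$ at some multiplicative subset. An $A$-algebra $B$ is formally smooth (for the discrete topology) if for every $A$-algebra $C$, every nilpotent ideal $N$ of $C$ (i.e. $N^k=0$ for some $k\geq 1$), and every $A$-algebra homomorphism $u: B\to C/N$, there exists an $A$-algebra homomorphism $v: B\to C$ such that $p\circ v=u$, where $p: C\to C/N$ is the canonical projection. An $A$-algebra $B$ is smooth if it is essentially of finite type over $A$ and formally smooth over $A$ (for the discrete topology). *)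

theory Defs
  imports
    "HOL-Algebra.Ideal_Product"
    "HOL-Algebra.Generated_Rings"
    "HOL-Algebra.Ring_Divisibility"
    "HOL-Algebra.Free_Abelian_Groups"
begin

section \<open>Algebras over a ring\<close>

text \<open>Commutative \<open>A\<close>-algebras are the ones of locale \<^locale>\<open>algebra\<close>: \<open>algebra A B\<close> says
  that \<open>A\<close> and \<open>B\<close> are commutative unital rings and that \<open>B\<close> is an \<open>A\<close>-module with
  \<open>(a \<odot> x) \<otimes> y = a \<odot> (x \<otimes> y)\<close>.\<close>

definition alg_hom ::
    "('a, 'k) ring_scheme \<Rightarrow> ('a, 'b, 'l) module_scheme \<Rightarrow> ('a, 'c, 'm) module_scheme \<Rightarrow> ('b \<Rightarrow> 'c) set"
  where "alg_hom A B C =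
    {h \<in> ring_hom B C. \<forall>a\<in>carrier A. \<forall>x\<in>carrier B. h (a \<odot>\<^bsub>B\<^esub> x) = a \<odot>\<^bsub>C\<^esub> h x}"

definition alg_iso ::
    "('a, 'k) ring_scheme \<Rightarrow> ('a, 'b, 'l) module_scheme \<Rightarrow> ('a, 'c, 'm) module_scheme \<Rightarrow> ('b \<Rightarrow> 'c) set"
  where "alg_iso A B C = {h \<in> alg_hom A B C. bij_betw h (carrier B) (carrier C)}"

definition quotient_algebra :: "('a, 'c, 'm) module_scheme \<Rightarrow> 'c set \<Rightarrow> ('a, 'c set) module"
  where "quotient_algebra C N =
    ring.extend (C Quot N) (module.fields (\<lambda>a K. \<Union>x\<in>K. N +>\<^bsub>C\<^esub> (a \<odot>\<^bsub>C\<^esub> x)))"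

primrec ideal_pow :: "('a, 'k) ring_scheme \<Rightarrow> 'a set \<Rightarrow> nat \<Rightarrow> 'a set" where
  "ideal_pow R I 0 = carrier R"
| "ideal_pow R I (Suc n) = ideal_prod R I (ideal_pow R I n)"


section \<open>Algebras essentially of finite type\<close>

definition finitely_generated_algebra ::
    "('a, 'k) ring_scheme \<Rightarrow> ('a, 'b, 'l) module_scheme \<Rightarrow> bool"
  where "finitely_generated_algebra A B \<longleftrightarrow> algebra A B \<and>
    (\<exists>G. finite G \<and> G \<subseteq> carrier B \<and>
         generate_ring B ((\<lambda>a. a \<odot>\<^bsub>B\<^esub> \<one>\<^bsub>B\<^esub>) ` carrier A \<union> G) = carrier B)"

text \<open>The class of the fraction \<open>r / s\<close> in \<open>S\<inverse>R\<close>, where \<open>S\<close> may contain zero divisors.\<close>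

definition fraction :: "('b, 'k) ring_scheme \<Rightarrow> 'b set \<Rightarrow> 'b \<Rightarrow> 'b \<Rightarrow> ('b \<times> 'b) set"
  where "fraction R S r s =
    {(r', s') \<in> carrier R \<times> S. \<exists>t\<in>S. t \<otimes>\<^bsub>R\<^esub> (r \<otimes>\<^bsub>R\<^esub> s') = t \<otimes>\<^bsub>R\<^esub> (r' \<otimes>\<^bsub>R\<^esub> s)}"

definition localization :: "('a, 'b, 'l) module_scheme \<Rightarrow> 'b set \<Rightarrow> ('a, ('b \<times> 'b) set) module"
  where "localization B S = module.make
      \<comment> \<open>carrier, \<open>\<otimes>\<close>, \<open>\<one>\<close>, \<open>\<zero>\<close>, \<open>\<oplus>\<close>, \<open>\<odot>\<close>\<close>
      {fraction B S r s | r s. r \<in> carrier B \<and> s \<in> S}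
      (\<lambda>K L. \<Union>(r, s)\<in>K. \<Union>(r', s')\<in>L. fraction B S (r \<otimes>\<^bsub>B\<^esub> r') (s \<otimes>\<^bsub>B\<^esub> s'))
      (fraction B S \<one>\<^bsub>B\<^esub> \<one>\<^bsub>B\<^esub>)
      (fraction B S \<zero>\<^bsub>B\<^esub> \<one>\<^bsub>B\<^esub>)
      (\<lambda>K L. \<Union>(r, s)\<in>K. \<Union>(r', s')\<in>L.
         fraction B S (r \<otimes>\<^bsub>B\<^esub> s' \<oplus>\<^bsub>B\<^esub> r' \<otimes>\<^bsub>B\<^esub> s) (s \<otimes>\<^bsub>B\<^esub> s'))
      (\<lambda>a K. \<Union>(r, s)\<in>K. fraction B S (a \<odot>\<^bsub>B\<^esub> r) s)"

text \<open>The type argument is the type of the elements of the finitely generated algebra \<open>B\<^sub>0\<close>.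
  A theorem that assumes this predicate for a free type variable \<open>'c\<close> therefore covers every
  possible \<open>B\<^sub>0\<close>.\<close>

definition essentially_of_finite_type ::
    "'c itself \<Rightarrow> ('a, 'k) ring_scheme \<Rightarrow> ('a, 'b, 'l) module_scheme \<Rightarrow> bool"
  where "essentially_of_finite_type (_ :: 'c itself) A B \<longleftrightarrow> algebra A B \<and>
    (\<exists>(B\<^sub>0 :: ('a, 'c) module) S h.
       finitely_generated_algebra A B\<^sub>0 \<and> submonoid S B\<^sub>0 \<and> h \<in> alg_iso A (localization B\<^sub>0 S) B)"


section \<open>Formally smooth algebras\<close>

text \<open>The lifting property against all test algebras whose elements have type \<open>'c\<close>.\<close>

definition formally_smooth_wrt ::
    "'c itself \<Rightarrow> ('a, 'k) ring_scheme \<Rightarrow> ('a, 'b, 'l) module_scheme \<Rightarrow> bool"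
  where "formally_smooth_wrt (_ :: 'c itself) A B \<longleftrightarrow> algebra A B \<and>
    (\<forall>(C :: ('a, 'c) module) N u.
       algebra A C \<and> ideal N C \<and> (\<exists>k\<ge>1. ideal_pow C N k = {\<zero>\<^bsub>C\<^esub>}) \<and>
       u \<in> alg_hom A B (quotient_algebra C N) \<longrightarrow>
       (\<exists>v\<in>alg_hom A B C. \<forall>b\<in>carrier B. N +>\<^bsub>C\<^esub> v b = u b))"

text \<open>HOL cannot quantify over all types inside a formula. The type \<open>('a + 'b) list list\<close> (formal
  sums of products of elements of \<open>A\<close> and of \<open>B\<close>) is large enough for the property to imply
  the lifting property against test algebras of every type; see
  \<open>formally_smooth_imp_wrt\<close> below.\<close>

definition formally_smooth :: "('a, 'k) ring_scheme \<Rightarrow> ('a, 'b, 'l) module_scheme \<Rightarrow> bool"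
  where "formally_smooth (A :: ('a, 'k) ring_scheme) (B :: ('a, 'b, 'l) module_scheme) \<longleftrightarrow>
    formally_smooth_wrt TYPE(('a + 'b) list list) A B"

definition smooth_algebra ::
    "'c itself \<Rightarrow> ('a, 'k) ring_scheme \<Rightarrow> ('a, 'b, 'l) module_scheme \<Rightarrow> bool"
  where "smooth_algebra (T :: 'c itself) A B \<longleftrightarrow>
    essentially_of_finite_type T A B \<and> formally_smooth A B"


section \<open>Tensor products and flatness\<close>

definition linear_maps ::
    "('a, 'k) ring_scheme \<Rightarrow> ('a, 'm, 'p) module_scheme \<Rightarrow> ('a, 'n, 'q) module_scheme \<Rightarrow> ('m \<Rightarrow> 'n) set"
  where "linear_maps A M N =
    {f \<in> carrier M \<rightarrow> carrier N.
       (\<forall>x\<in>carrier M. \<forall>y\<in>carrier M. f (x \<oplus>\<^bsub>M\<^esub> y) = f x \<oplus>\<^bsub>N\<^esub> f y) \<and>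
       (\<forall>a\<in>carrier A. \<forall>x\<in>carrier M. f (a \<odot>\<^bsub>M\<^esub> x) = a \<odot>\<^bsub>N\<^esub> f x)}"

text \<open>The abelian group underlying \<open>M \<otimes>\<^sub>A E\<close>: the free abelian group on \<open>M \<times> E\<close> modulo the
  bilinearity relations. Its \<open>A\<close>-module structure plays no role for the injectivity of
  \<open>f \<otimes> id\<close>.\<close>

definition tensor_relations ::
    "('a, 'k) ring_scheme \<Rightarrow> ('a, 'm, 'p) module_scheme \<Rightarrow> ('a, 'e, 'q) module_scheme
      \<Rightarrow> ('m \<times> 'e \<Rightarrow>\<^sub>0 int) set"
  where "tensor_relations A M E =
    {frag_of (x \<oplus>\<^bsub>M\<^esub> x', y) - frag_of (x, y) - frag_of (x', y) | x x' y.
       x \<in> carrier M \<and> x' \<in> carrier M \<and> y \<in> carrier E} \<union>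
    {frag_of (x, y \<oplus>\<^bsub>E\<^esub> y') - frag_of (x, y) - frag_of (x, y') | x y y'.
       x \<in> carrier M \<and> y \<in> carrier E \<and> y' \<in> carrier E} \<union>
    {frag_of (a \<odot>\<^bsub>M\<^esub> x, y) - frag_of (x, a \<odot>\<^bsub>E\<^esub> y) | a x y.
       a \<in> carrier A \<and> x \<in> carrier M \<and> y \<in> carrier E}"

definition tensor_kernel ::
    "('a, 'k) ring_scheme \<Rightarrow> ('a, 'm, 'p) module_scheme \<Rightarrow> ('a, 'e, 'q) module_scheme
      \<Rightarrow> ('m \<times> 'e \<Rightarrow>\<^sub>0 int) set"
  where "tensor_kernel A M E =
    generate (free_Abelian_group (carrier M \<times> carrier E)) (tensor_relations A M E)"

definition tensor_product ::
    "('a, 'k) ring_scheme \<Rightarrow> ('a, 'm, 'p) module_scheme \<Rightarrow> ('a, 'e, 'q) module_scheme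
      \<Rightarrow> ('m \<times> 'e \<Rightarrow>\<^sub>0 int) set monoid"
  where "tensor_product A M E =
    free_Abelian_group (carrier M \<times> carrier E) Mod tensor_kernel A M E"

text \<open>\<open>tensor_map A N E f\<close> is the map \<open>f \<otimes> id : M \<otimes>\<^sub>A E \<rightarrow> N \<otimes>\<^sub>A E\<close> induced by \<open>f : M \<rightarrow> N\<close>;
  the cosets in the union are all equal.\<close>

definition tensor_map ::
    "('a, 'k) ring_scheme \<Rightarrow> ('a, 'n, 'p) module_scheme \<Rightarrow> ('a, 'e, 'q) module_scheme
      \<Rightarrow> ('m \<Rightarrow> 'n) \<Rightarrow> ('m \<times> 'e \<Rightarrow>\<^sub>0 int) set \<Rightarrow> ('n \<times> 'e \<Rightarrow>\<^sub>0 int) set"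
  where "tensor_map A N E f K =
    (\<Union>c\<in>K. tensor_kernel A N E #>\<^bsub>free_Abelian_group (carrier N \<times> carrier E)\<^esub>
              frag_extend (\<lambda>(x, y). frag_of (f x, y)) c)"

text \<open>The type arguments are the types of the elements of the modules \<open>M\<close> and \<open>N\<close>; a theorem
  concluding flatness for free type variables covers all modules.\<close>

definition flat_module ::
    "'m itself \<Rightarrow> 'n itself \<Rightarrow> ('a, 'k) ring_scheme \<Rightarrow> ('a, 'e, 'l) module_scheme \<Rightarrow> bool"
  where "flat_module (_ :: 'm itself) (_ :: 'n itself) A E \<longleftrightarrow> module A E \<and>
    (\<forall>(M :: ('a, 'm) module) (N :: ('a, 'n) module) f.
       module A M \<and> module A N \<and> f \<in> linear_maps A M N \<and> inj_on f (carrier M) \<longrightarrow>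
       inj_on (tensor_map A N E f) (carrier (tensor_product A M E)))"


section \<open>Quotient algebras and localizations are algebras\<close>

lemma alg_homD:
  assumes "h \<in> alg_hom A B C"
  shows "x \<in> carrier B \<Longrightarrow> h x \<in> carrier C"
    and "x \<in> carrier B \<Longrightarrow> y \<in> carrier B \<Longrightarrow> h (x \<otimes>\<^bsub>B\<^esub> y) = h x \<otimes>\<^bsub>C\<^esub> h y"
    and "x \<in> carrier B \<Longrightarrow> y \<in> carrier B \<Longrightarrow> h (x \<oplus>\<^bsub>B\<^esub> y) = h x \<oplus>\<^bsub>C\<^esub> h y"
    and "h \<one>\<^bsub>B\<^esub> = \<one>\<^bsub>C\<^esub>"
    and "a \<in> carrier A \<Longrightarrow> x \<in> carrier B \<Longrightarrow> h (a \<odot>\<^bsub>B\<^esub> x) = a \<odot>\<^bsub>C\<^esub> h x"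
  using assms by (auto simp: alg_hom_def ring_hom_def)

lemma alg_homI:
  assumes "\<And>x. x \<in> carrier B \<Longrightarrow> h x \<in> carrier C"
    and "\<And>x y. x \<in> carrier B \<Longrightarrow> y \<in> carrier B \<Longrightarrow> h (x \<otimes>\<^bsub>B\<^esub> y) = h x \<otimes>\<^bsub>C\<^esub> h y"
    and "\<And>x y. x \<in> carrier B \<Longrightarrow> y \<in> carrier B \<Longrightarrow> h (x \<oplus>\<^bsub>B\<^esub> y) = h x \<oplus>\<^bsub>C\<^esub> h y"
    and "h \<one>\<^bsub>B\<^esub> = \<one>\<^bsub>C\<^esub>"
    and "\<And>a x. a \<in> carrier A \<Longrightarrow> x \<in> carrier B \<Longrightarrow> h (a \<odot>\<^bsub>B\<^esub> x) = a \<odot>\<^bsub>C\<^esub> h x"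
  shows "h \<in> alg_hom A B C"
  using assms by (auto simp: alg_hom_def ring_hom_def)

lemma quotient_algebra_sel:
  "carrier (quotient_algebra C N) = a_rcosets\<^bsub>C\<^esub> N"
  "K \<otimes>\<^bsub>quotient_algebra C N\<^esub> L = rcoset_mult C N K L"
  "K \<oplus>\<^bsub>quotient_algebra C N\<^esub> L = K <+>\<^bsub>C\<^esub> L"
  "\<one>\<^bsub>quotient_algebra C N\<^esub> = N +>\<^bsub>C\<^esub> \<one>\<^bsub>C\<^esub>"
  "\<zero>\<^bsub>quotient_algebra C N\<^esub> = N"
  "a \<odot>\<^bsub>quotient_algebra C N\<^esub> K = (\<Union>x\<in>K. N +>\<^bsub>C\<^esub> (a \<odot>\<^bsub>C\<^esub> x))"
  by (simp_all add: quotient_algebra_def FactRing_def ring.extend_def module.fields_def)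

lemma coset_eq_iff:
  assumes "algebra A C" "ideal N C" "x \<in> carrier C" "y \<in> carrier C"
  shows "N +>\<^bsub>C\<^esub> x = N +>\<^bsub>C\<^esub> y \<longleftrightarrow> x \<ominus>\<^bsub>C\<^esub> y \<in> N"
  using ring.quotient_eq_iff_same_a_r_cos[of C N x y] assms
  by (simp add: algebra.M_cring cring.axioms(1))

lemma algebra_smult_eq:
  assumes "algebra A C" "a \<in> carrier A" "x \<in> carrier C"
  shows "a \<odot>\<^bsub>C\<^esub> x = (a \<odot>\<^bsub>C\<^esub> \<one>\<^bsub>C\<^esub>) \<otimes>\<^bsub>C\<^esub> x"
proof -
  interpret algebra A C by fact
  show ?thesis using assms by (simp add: smult_assoc2)
qed

lemma smult_coset:
  assumes "algebra A C" "ideal N C" "a \<in> carrier A" "x \<in> carrier C"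
  shows "a \<odot>\<^bsub>quotient_algebra C N\<^esub> (N +>\<^bsub>C\<^esub> x) = N +>\<^bsub>C\<^esub> (a \<odot>\<^bsub>C\<^esub> x)"
proof -
  interpret C: algebra A C by fact
  interpret N: ideal N C by fact
  have "N +>\<^bsub>C\<^esub> (a \<odot>\<^bsub>C\<^esub> y) = N +>\<^bsub>C\<^esub> (a \<odot>\<^bsub>C\<^esub> x)" if y: "y \<in> N +>\<^bsub>C\<^esub> x" for y
  proof -
    obtain n where n: "n \<in> N" "y = n \<oplus>\<^bsub>C\<^esub> x"
      using y by (auto simp: a_r_coset_def r_coset_def)
    have nC: "n \<in> carrier C" using n by auto
    have "(a \<odot>\<^bsub>C\<^esub> y) \<ominus>\<^bsub>C\<^esub> (a \<odot>\<^bsub>C\<^esub> x) = a \<odot>\<^bsub>C\<^esub> n"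
      using n nC assms(3,4) by (simp add: C.smult_r_distr C.M.minus_eq C.M.add.m_assoc C.M.r_neg)
    also have "\<dots> \<in> N"
      using algebra_smult_eq[OF assms(1,3) nC] n(1) assms(3) by (simp add: N.I_l_closed)
    finally show ?thesis
      using coset_eq_iff[OF assms(1,2)] n nC assms(3,4) by auto
  qed
  moreover have "x \<in> N +>\<^bsub>C\<^esub> x" using assms by (simp add: N.a_rcos_self)
  ultimately show ?thesis unfolding quotient_algebra_sel by (intro UN_constant_eq ballI)
qed

lemma quotient_coset_ops:
  assumes "algebra A C" "ideal N C" "x \<in> carrier C" "y \<in> carrier C"
  shows "(N +>\<^bsub>C\<^esub> x) \<oplus>\<^bsub>quotient_algebra C N\<^esub> (N +>\<^bsub>C\<^esub> y) = N +>\<^bsub>C\<^esub> (x \<oplus>\<^bsub>C\<^esub> y)"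
    and "(N +>\<^bsub>C\<^esub> x) \<otimes>\<^bsub>quotient_algebra C N\<^esub> (N +>\<^bsub>C\<^esub> y) = N +>\<^bsub>C\<^esub> (x \<otimes>\<^bsub>C\<^esub> y)"
proof -
  interpret C: algebra A C by fact
  interpret N: ideal N C by fact
  show "(N +>\<^bsub>C\<^esub> x) \<oplus>\<^bsub>quotient_algebra C N\<^esub> (N +>\<^bsub>C\<^esub> y) = N +>\<^bsub>C\<^esub> (x \<oplus>\<^bsub>C\<^esub> y)"
    "(N +>\<^bsub>C\<^esub> x) \<otimes>\<^bsub>quotient_algebra C N\<^esub> (N +>\<^bsub>C\<^esub> y) = N +>\<^bsub>C\<^esub> (x \<otimes>\<^bsub>C\<^esub> y)"
    using assms by (simp_all add: quotient_algebra_sel N.a_rcos_sum N.rcoset_mult_add)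
qed

lemma quotient_coset_closed:
  "x \<in> carrier C \<Longrightarrow> N +>\<^bsub>C\<^esub> x \<in> carrier (quotient_algebra C N)"
  by (auto simp: quotient_algebra_sel A_RCOSETS_def')

lemma quotient_carrierE:
  assumes "K \<in> carrier (quotient_algebra C N)"
  obtains x where "x \<in> carrier C" "K = N +>\<^bsub>C\<^esub> x"
  using assms by (auto simp: quotient_algebra_sel A_RCOSETS_def')

lemma algebra_quotient:
  assumes "algebra A C" "ideal N C"
  shows "algebra A (quotient_algebra C N)"
proof -
  interpret C: algebra A C by fact
  interpret N: ideal N C by fact
  let ?Q = "quotient_algebra C N"
  note ops = quotient_coset_ops[OF assms] quotient_coset_closed smult_coset[OF assms]
  have one: "\<one>\<^bsub>?Q\<^esub> = N +>\<^bsub>C\<^esub> \<one>\<^bsub>C\<^esub>" by (simp add: quotient_algebra_sel)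
  have zero: "\<zero>\<^bsub>?Q\<^esub> = N +>\<^bsub>C\<^esub> \<zero>\<^bsub>C\<^esub>"
    using C.M.a_coset_add_zero N.a_subset by (simp add: quotient_algebra_sel)
  have ab: "abelian_group ?Q"
  proof (rule abelian_groupI)
    fix x assume "x \<in> carrier ?Q"
    then obtain c where c: "c \<in> carrier C" "x = N +>\<^bsub>C\<^esub> c" by (rule quotient_carrierE)
    then show "\<exists>y\<in>carrier ?Q. y \<oplus>\<^bsub>?Q\<^esub> x = \<zero>\<^bsub>?Q\<^esub>"
      by (intro bexI[of _ "N +>\<^bsub>C\<^esub> (\<ominus>\<^bsub>C\<^esub> c)"]) (auto simp: ops zero C.M.l_neg)
  qed (auto elim!: quotient_carrierE simp: ops zero C.M.a_ac)
  have cm: "comm_monoid ?Q"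
    by (rule comm_monoidI) (auto elim!: quotient_carrierE simp: ops one C.m_ac)
  have cr: "cring ?Q"
    by (rule cringI[OF ab cm]) (auto elim!: quotient_carrierE simp: ops C.l_distr)
  show ?thesis
    by (rule algebraI[OF C.R_cring cr])
      (auto elim!: quotient_carrierE simp: ops C.smult_l_distr C.smult_r_distr C.smult_assoc1 C.smult_assoc2)
qed

lemma fraction_self:
  assumes "cring R" "submonoid S R" "r \<in> carrier R" "s \<in> S"
  shows "(r, s) \<in> fraction R S r s"
  using assms submonoid.one_closed[OF assms(2)] by (auto simp: fraction_def)

lemma fraction_eq_iff:
  assumes "cring R" "submonoid S R" "r \<in> carrier R" "s \<in> S" "r' \<in> carrier R" "s' \<in> S"
  shows "fraction R S r s = fraction R S r' s' \<longleftrightarrow>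
    (\<exists>t\<in>S. t \<otimes>\<^bsub>R\<^esub> (r \<otimes>\<^bsub>R\<^esub> s') = t \<otimes>\<^bsub>R\<^esub> (r' \<otimes>\<^bsub>R\<^esub> s))"
proof -
  interpret cring R by fact
  interpret S: submonoid S R by fact
  have trans: "\<exists>t\<in>S. t \<otimes>\<^bsub>R\<^esub> (x \<otimes>\<^bsub>R\<^esub> c) = t \<otimes>\<^bsub>R\<^esub> (z \<otimes>\<^bsub>R\<^esub> a)"
    if x: "x \<in> carrier R" "y \<in> carrier R" "z \<in> carrier R" and a: "a \<in> S" "b \<in> S" "c \<in> S"
      and t: "t1 \<in> S" "t1 \<otimes>\<^bsub>R\<^esub> (x \<otimes>\<^bsub>R\<^esub> b) = t1 \<otimes>\<^bsub>R\<^esub> (y \<otimes>\<^bsub>R\<^esub> a)"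
        "t2 \<in> S" "t2 \<otimes>\<^bsub>R\<^esub> (y \<otimes>\<^bsub>R\<^esub> c) = t2 \<otimes>\<^bsub>R\<^esub> (z \<otimes>\<^bsub>R\<^esub> b)"
    for x y z a b c t1 t2
  proof (rule bexI[of _ "(t1 \<otimes>\<^bsub>R\<^esub> t2) \<otimes>\<^bsub>R\<^esub> b"])
    have c: "a \<in> carrier R" "b \<in> carrier R" "c \<in> carrier R" "t1 \<in> carrier R" "t2 \<in> carrier R"
      using a t S.subset by auto
    have "(t1 \<otimes>\<^bsub>R\<^esub> t2) \<otimes>\<^bsub>R\<^esub> b \<otimes>\<^bsub>R\<^esub> (x \<otimes>\<^bsub>R\<^esub> c) = (t1 \<otimes>\<^bsub>R\<^esub> (x \<otimes>\<^bsub>R\<^esub> b)) \<otimes>\<^bsub>R\<^esub> (t2 \<otimes>\<^bsub>R\<^esub> c)"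
      using x c by (simp add: m_ac)
    also have "\<dots> = (t2 \<otimes>\<^bsub>R\<^esub> (y \<otimes>\<^bsub>R\<^esub> c)) \<otimes>\<^bsub>R\<^esub> (t1 \<otimes>\<^bsub>R\<^esub> a)"
      unfolding t(2) using x c by (simp add: m_ac)
    also have "\<dots> = (t1 \<otimes>\<^bsub>R\<^esub> t2) \<otimes>\<^bsub>R\<^esub> b \<otimes>\<^bsub>R\<^esub> (z \<otimes>\<^bsub>R\<^esub> a)"
      unfolding t(4) using x c by (simp add: m_ac)
    finally show "(t1 \<otimes>\<^bsub>R\<^esub> t2) \<otimes>\<^bsub>R\<^esub> b \<otimes>\<^bsub>R\<^esub> (x \<otimes>\<^bsub>R\<^esub> c) = (t1 \<otimes>\<^bsub>R\<^esub> t2) \<otimes>\<^bsub>R\<^esub> b \<otimes>\<^bsub>R\<^esub> (z \<otimes>\<^bsub>R\<^esub> a)" .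
  qed (use a t in auto)
  show ?thesis
  proof
    assume "fraction R S r s = fraction R S r' s'"
    then have "(r', s') \<in> fraction R S r s" using fraction_self[OF assms(1,2,5,6)] by simp
    then show "\<exists>t\<in>S. t \<otimes>\<^bsub>R\<^esub> (r \<otimes>\<^bsub>R\<^esub> s') = t \<otimes>\<^bsub>R\<^esub> (r' \<otimes>\<^bsub>R\<^esub> s)" by (simp add: fraction_def)
  next
    assume "\<exists>t\<in>S. t \<otimes>\<^bsub>R\<^esub> (r \<otimes>\<^bsub>R\<^esub> s') = t \<otimes>\<^bsub>R\<^esub> (r' \<otimes>\<^bsub>R\<^esub> s)"
    then obtain t where t: "t \<in> S" "t \<otimes>\<^bsub>R\<^esub> (r \<otimes>\<^bsub>R\<^esub> s') = t \<otimes>\<^bsub>R\<^esub> (r' \<otimes>\<^bsub>R\<^esub> s)" by auto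
    show "fraction R S r s = fraction R S r' s'"
      unfolding fraction_def
      using trans[OF assms(3,5) _ assms(4,6) _ t]
        trans[OF assms(5,3) _ assms(6,4) _ t(1) t(2)[symmetric]]
      by blast
  qed
qed

lemma fraction_carrier:
  "r \<in> carrier B \<Longrightarrow> s \<in> S \<Longrightarrow> fraction B S r s \<in> carrier (localization B S)"
  by (auto simp: localization_def module.defs)

lemma localization_ops:
  assumes alg: "algebra A B" and S: "submonoid S B"
    and rs: "r \<in> carrier B" "s \<in> S"
  shows "\<And>r' s'. r' \<in> carrier B \<Longrightarrow> s' \<in> S \<Longrightarrow>
      fraction B S r s \<otimes>\<^bsub>localization B S\<^esub> fraction B S r' s' = fraction B S (r \<otimes>\<^bsub>B\<^esub> r') (s \<otimes>\<^bsub>B\<^esub> s')"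
    and "\<And>r' s'. r' \<in> carrier B \<Longrightarrow> s' \<in> S \<Longrightarrow>
      fraction B S r s \<oplus>\<^bsub>localization B S\<^esub> fraction B S r' s' =
      fraction B S (r \<otimes>\<^bsub>B\<^esub> s' \<oplus>\<^bsub>B\<^esub> r' \<otimes>\<^bsub>B\<^esub> s) (s \<otimes>\<^bsub>B\<^esub> s')"
    and "\<And>a. a \<in> carrier A \<Longrightarrow> a \<odot>\<^bsub>localization B S\<^esub> fraction B S r s = fraction B S (a \<odot>\<^bsub>B\<^esub> r) s"
proof -
  interpret B: algebra A B by fact
  interpret S: submonoid S B by fact
  note iff = fraction_eq_iff[OF B.M_cring S]
  note self = fraction_self[OF B.M_cring S]
  have SB: "t \<in> carrier B" if "t \<in> S" for t using that S.subset by auto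
  fix r' s' assume rs': "r' \<in> carrier B" "s' \<in> S"
  have *: "fraction B S (x \<otimes>\<^bsub>B\<^esub> x') (y \<otimes>\<^bsub>B\<^esub> y') = fraction B S (r \<otimes>\<^bsub>B\<^esub> r') (s \<otimes>\<^bsub>B\<^esub> s') \<and>
     fraction B S (x \<otimes>\<^bsub>B\<^esub> y' \<oplus>\<^bsub>B\<^esub> x' \<otimes>\<^bsub>B\<^esub> y) (y \<otimes>\<^bsub>B\<^esub> y') =
      fraction B S (r \<otimes>\<^bsub>B\<^esub> s' \<oplus>\<^bsub>B\<^esub> r' \<otimes>\<^bsub>B\<^esub> s) (s \<otimes>\<^bsub>B\<^esub> s')"
    if mem: "(x, y) \<in> fraction B S r s" "(x', y') \<in> fraction B S r' s'" for x y x' y'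
  proof -
    obtain t t' where x: "x \<in> carrier B" "x' \<in> carrier B" and y: "y \<in> S" "y' \<in> S"
      and t: "t \<in> S" "t \<otimes>\<^bsub>B\<^esub> (r \<otimes>\<^bsub>B\<^esub> y) = t \<otimes>\<^bsub>B\<^esub> (x \<otimes>\<^bsub>B\<^esub> s)"
      and t': "t' \<in> S" "t' \<otimes>\<^bsub>B\<^esub> (r' \<otimes>\<^bsub>B\<^esub> y') = t' \<otimes>\<^bsub>B\<^esub> (x' \<otimes>\<^bsub>B\<^esub> s')"
      using mem by (auto simp: fraction_def)
    note c = x rs(1) rs'(1) SB[OF rs(2)] SB[OF rs'(2)] SB[OF y(1)] SB[OF y(2)] SB[OF t(1)] SB[OF t'(1)]
    let ?t = "t \<otimes>\<^bsub>B\<^esub> t'"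
    have "?t \<otimes>\<^bsub>B\<^esub> ((x \<otimes>\<^bsub>B\<^esub> x') \<otimes>\<^bsub>B\<^esub> (s \<otimes>\<^bsub>B\<^esub> s')) = (t \<otimes>\<^bsub>B\<^esub> (x \<otimes>\<^bsub>B\<^esub> s)) \<otimes>\<^bsub>B\<^esub> (t' \<otimes>\<^bsub>B\<^esub> (x' \<otimes>\<^bsub>B\<^esub> s'))"
      using c by (simp add: B.m_ac)
    also have "\<dots> = ?t \<otimes>\<^bsub>B\<^esub> ((r \<otimes>\<^bsub>B\<^esub> r') \<otimes>\<^bsub>B\<^esub> (y \<otimes>\<^bsub>B\<^esub> y'))"
      unfolding t(2)[symmetric] t'(2)[symmetric] using c by (simp add: B.m_ac)
    finally have 1: "?t \<otimes>\<^bsub>B\<^esub> ((x \<otimes>\<^bsub>B\<^esub> x') \<otimes>\<^bsub>B\<^esub> (s \<otimes>\<^bsub>B\<^esub> s')) = \<dots>" .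
    have "?t \<otimes>\<^bsub>B\<^esub> ((x \<otimes>\<^bsub>B\<^esub> y' \<oplus>\<^bsub>B\<^esub> x' \<otimes>\<^bsub>B\<^esub> y) \<otimes>\<^bsub>B\<^esub> (s \<otimes>\<^bsub>B\<^esub> s')) =
       (t \<otimes>\<^bsub>B\<^esub> (x \<otimes>\<^bsub>B\<^esub> s)) \<otimes>\<^bsub>B\<^esub> (t' \<otimes>\<^bsub>B\<^esub> (y' \<otimes>\<^bsub>B\<^esub> s')) \<oplus>\<^bsub>B\<^esub> (t' \<otimes>\<^bsub>B\<^esub> (x' \<otimes>\<^bsub>B\<^esub> s')) \<otimes>\<^bsub>B\<^esub> (t \<otimes>\<^bsub>B\<^esub> (y \<otimes>\<^bsub>B\<^esub> s))"
      using c by (simp add: B.m_ac B.l_distr B.r_distr)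
    also have "\<dots> = ?t \<otimes>\<^bsub>B\<^esub> ((r \<otimes>\<^bsub>B\<^esub> s' \<oplus>\<^bsub>B\<^esub> r' \<otimes>\<^bsub>B\<^esub> s) \<otimes>\<^bsub>B\<^esub> (y \<otimes>\<^bsub>B\<^esub> y'))"
      unfolding t(2)[symmetric] t'(2)[symmetric] using c by (simp add: B.m_ac B.l_distr B.r_distr)
    finally have 2: "?t \<otimes>\<^bsub>B\<^esub> ((x \<otimes>\<^bsub>B\<^esub> y' \<oplus>\<^bsub>B\<^esub> x' \<otimes>\<^bsub>B\<^esub> y) \<otimes>\<^bsub>B\<^esub> (s \<otimes>\<^bsub>B\<^esub> s')) = \<dots>" .
    have cl: "?t \<in> S" "y \<otimes>\<^bsub>B\<^esub> y' \<in> S" "s \<otimes>\<^bsub>B\<^esub> s' \<in> S"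
      "x \<otimes>\<^bsub>B\<^esub> x' \<in> carrier B" "r \<otimes>\<^bsub>B\<^esub> r' \<in> carrier B"
      "x \<otimes>\<^bsub>B\<^esub> y' \<oplus>\<^bsub>B\<^esub> x' \<otimes>\<^bsub>B\<^esub> y \<in> carrier B" "r \<otimes>\<^bsub>B\<^esub> s' \<oplus>\<^bsub>B\<^esub> r' \<otimes>\<^bsub>B\<^esub> s \<in> carrier B"
      using c y t(1) t'(1) rs(2) rs'(2) by simp_all
    show ?thesis
      by (rule conjI; rule iff[THEN iffD2, OF _ _ _ _ bexI[of _ ?t]]) (rule cl 1 2)+
  qed
  show "fraction B S r s \<otimes>\<^bsub>localization B S\<^esub> fraction B S r' s' = fraction B S (r \<otimes>\<^bsub>B\<^esub> r') (s \<otimes>\<^bsub>B\<^esub> s')"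
    unfolding localization_def module.defs monoid.simps ring.simps
    by (rule UN_constant_eq[OF self[OF rs]], clarify, rule UN_constant_eq[OF self[OF rs']], clarify)
      (simp only: *)
  show "fraction B S r s \<oplus>\<^bsub>localization B S\<^esub> fraction B S r' s' =
      fraction B S (r \<otimes>\<^bsub>B\<^esub> s' \<oplus>\<^bsub>B\<^esub> r' \<otimes>\<^bsub>B\<^esub> s) (s \<otimes>\<^bsub>B\<^esub> s')"
    unfolding localization_def module.defs monoid.simps ring.simps
    by (rule UN_constant_eq[OF self[OF rs]], clarify, rule UN_constant_eq[OF self[OF rs']], clarify)
      (simp only: *)
next
  interpret B: algebra A B by fact
  interpret S: submonoid S B by fact
  note iff = fraction_eq_iff[OF B.M_cring S]
  note self = fraction_self[OF B.M_cring S]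
  have SB: "t \<in> carrier B" if "t \<in> S" for t using that S.subset by auto
  fix a assume a: "a \<in> carrier A"
  have *: "fraction B S (a \<odot>\<^bsub>B\<^esub> x) y = fraction B S (a \<odot>\<^bsub>B\<^esub> r) s" if mem: "(x, y) \<in> fraction B S r s" for x y
  proof -
    obtain t where x: "x \<in> carrier B" and y: "y \<in> S"
      and t: "t \<in> S" "t \<otimes>\<^bsub>B\<^esub> (r \<otimes>\<^bsub>B\<^esub> y) = t \<otimes>\<^bsub>B\<^esub> (x \<otimes>\<^bsub>B\<^esub> s)"
      using mem by (auto simp: fraction_def)
    have m: "p \<otimes>\<^bsub>B\<^esub> (a \<odot>\<^bsub>B\<^esub> q) = a \<odot>\<^bsub>B\<^esub> (p \<otimes>\<^bsub>B\<^esub> q)" if "p \<in> carrier B" "q \<in> carrier B" for p q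
      using that a by (metis B.m_comm B.smult_assoc2 B.smult_closed)
    show ?thesis
      using t x y rs a by (auto simp: iff SB B.smult_assoc2 m intro!: bexI[of _ t])
  qed
  show "a \<odot>\<^bsub>localization B S\<^esub> fraction B S r s = fraction B S (a \<odot>\<^bsub>B\<^esub> r) s"
    unfolding localization_def module.defs module.simps
    by (rule UN_constant_eq[OF self[OF rs]], clarify) (simp only: *)
qed

lemma localization_carrierE:
  assumes "K \<in> carrier (localization B S)"
  obtains r s where "r \<in> carrier B" "s \<in> S" "K = fraction B S r s"
  using assms by (auto simp: localization_def module.defs)

lemma algebra_localization:
  assumes alg: "algebra A B" and S: "submonoid S B"
  shows "algebra A (localization B S)"
proof -
  interpret B: algebra A B by fact
  interpret S: submonoid S B by fact
  let ?L = "localization B S"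
  note iff = fraction_eq_iff[OF B.M_cring S]
  have SB: "t \<in> carrier B" if "t \<in> S" for t using that S.subset by auto
  note ops = localization_ops[OF alg S] fraction_carrier SB
  have one: "\<one>\<^bsub>?L\<^esub> = fraction B S \<one>\<^bsub>B\<^esub> \<one>\<^bsub>B\<^esub>" and zero: "\<zero>\<^bsub>?L\<^esub> = fraction B S \<zero>\<^bsub>B\<^esub> \<one>\<^bsub>B\<^esub>"
    by (simp_all add: localization_def module.defs)
  have m: "p \<otimes>\<^bsub>B\<^esub> (a \<odot>\<^bsub>B\<^esub> q) = a \<odot>\<^bsub>B\<^esub> (p \<otimes>\<^bsub>B\<^esub> q)"
    if "p \<in> carrier B" "q \<in> carrier B" "a \<in> carrier A" for p q a
    using that by (metis B.m_comm B.smult_assoc2 B.smult_closed)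
  have ab: "abelian_group ?L"
  proof (rule abelian_groupI)
    fix x assume "x \<in> carrier ?L"
    then obtain r s where c: "r \<in> carrier B" "s \<in> S" "x = fraction B S r s" by (rule localization_carrierE)
    then show "\<exists>y\<in>carrier ?L. y \<oplus>\<^bsub>?L\<^esub> x = \<zero>\<^bsub>?L\<^esub>"
      by (intro bexI[of _ "fraction B S (\<ominus>\<^bsub>B\<^esub> r) s"])
        (auto simp: ops zero B.M.l_neg iff B.l_minus intro!: bexI[of _ "\<one>\<^bsub>B\<^esub>"])
  qed (auto elim!: localization_carrierE
      simp: ops zero iff B.M.a_ac B.m_ac B.l_distr B.r_distr intro!: bexI[of _ "\<one>\<^bsub>B\<^esub>"])
  have distr: "(x \<oplus>\<^bsub>?L\<^esub> y) \<otimes>\<^bsub>?L\<^esub> z = x \<otimes>\<^bsub>?L\<^esub> z \<oplus>\<^bsub>?L\<^esub> y \<otimes>\<^bsub>?L\<^esub> z"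
    if "x \<in> carrier ?L" "y \<in> carrier ?L" "z \<in> carrier ?L" for x y z
  proof -
    obtain r s where 1: "r \<in> carrier B" "s \<in> S" "x = fraction B S r s"
      using \<open>x \<in> carrier ?L\<close> by (rule localization_carrierE)
    obtain r' s' where 2: "r' \<in> carrier B" "s' \<in> S" "y = fraction B S r' s'"
      using \<open>y \<in> carrier ?L\<close> by (rule localization_carrierE)
    obtain r'' s'' where 3: "r'' \<in> carrier B" "s'' \<in> S" "z = fraction B S r'' s''"
      using \<open>z \<in> carrier ?L\<close> by (rule localization_carrierE)
    show ?thesis
      using 1 2 3 by (simp add: ops iff) (rule bexI[of _ "\<one>\<^bsub>B\<^esub>"],
        simp_all add: SB B.M.a_ac B.m_ac B.l_distr B.r_distr)
  qed
  have cr: "cring ?L"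
    by (rule cringI[OF ab], rule comm_monoidI)
      (auto elim!: localization_carrierE simp: ops one B.m_ac distr fraction_carrier)
  have smult_l: "(a \<oplus>\<^bsub>A\<^esub> b) \<odot>\<^bsub>?L\<^esub> x = a \<odot>\<^bsub>?L\<^esub> x \<oplus>\<^bsub>?L\<^esub> b \<odot>\<^bsub>?L\<^esub> x"
    if ab: "a \<in> carrier A" "b \<in> carrier A" and "x \<in> carrier ?L" for a b x
  proof -
    obtain r s where 1: "r \<in> carrier B" "s \<in> S" "x = fraction B S r s"
      using \<open>x \<in> carrier ?L\<close> by (rule localization_carrierE)
    show ?thesis
      using 1 ab by (simp add: ops iff) (rule bexI[of _ "\<one>\<^bsub>B\<^esub>"],
        simp_all add: SB B.smult_l_distr B.smult_assoc2 B.m_assoc B.l_distr)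
  qed
  show ?thesis
    by (rule algebraI[OF B.R_cring cr])
      (auto elim!: localization_carrierE
        simp: ops smult_l fraction_carrier iff m B.smult_r_distr B.smult_assoc1 B.smult_assoc2
          B.M.a_ac B.m_ac B.l_distr B.r_distr intro!: bexI[of _ "\<one>\<^bsub>B\<^esub>"])
qed


section \<open>Formal smoothness does not depend on the type of the test algebras\<close>

text \<open>The algebra structure on \<open>T\<close> obtained from a subalgebra \<open>e ` T\<close> of \<open>C\<close>, for \<open>e\<close> injective on \<open>T\<close>.\<close>

definition transport :: "('a, 'c, 'l) module_scheme \<Rightarrow> 'u set \<Rightarrow> ('u \<Rightarrow> 'c) \<Rightarrow> ('a, 'u) module"
  where "transport C T e = module.make T
      (\<lambda>x y. inv_into T e (e x \<otimes>\<^bsub>C\<^esub> e y))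
      (inv_into T e \<one>\<^bsub>C\<^esub>)
      (inv_into T e \<zero>\<^bsub>C\<^esub>)
      (\<lambda>x y. inv_into T e (e x \<oplus>\<^bsub>C\<^esub> e y))
      (\<lambda>a x. inv_into T e (a \<odot>\<^bsub>C\<^esub> e x))"

lemma transport_sel:
  assumes "subring (e ` T) C" "\<forall>a\<in>carrier A. \<forall>x\<in>T. a \<odot>\<^bsub>C\<^esub> e x \<in> e ` T"
  shows "carrier (transport C T e) = T"
    and "\<one>\<^bsub>transport C T e\<^esub> \<in> T" "e \<one>\<^bsub>transport C T e\<^esub> = \<one>\<^bsub>C\<^esub>"
    and "\<zero>\<^bsub>transport C T e\<^esub> \<in> T" "e \<zero>\<^bsub>transport C T e\<^esub> = \<zero>\<^bsub>C\<^esub>"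
    and "x \<in> T \<Longrightarrow> y \<in> T \<Longrightarrow> x \<otimes>\<^bsub>transport C T e\<^esub> y \<in> T"
    and "x \<in> T \<Longrightarrow> y \<in> T \<Longrightarrow> e (x \<otimes>\<^bsub>transport C T e\<^esub> y) = e x \<otimes>\<^bsub>C\<^esub> e y"
    and "x \<in> T \<Longrightarrow> y \<in> T \<Longrightarrow> x \<oplus>\<^bsub>transport C T e\<^esub> y \<in> T"
    and "x \<in> T \<Longrightarrow> y \<in> T \<Longrightarrow> e (x \<oplus>\<^bsub>transport C T e\<^esub> y) = e x \<oplus>\<^bsub>C\<^esub> e y"
    and "a \<in> carrier A \<Longrightarrow> x \<in> T \<Longrightarrow> a \<odot>\<^bsub>transport C T e\<^esub> x \<in> T"
    and "a \<in> carrier A \<Longrightarrow> x \<in> T \<Longrightarrow> e (a \<odot>\<^bsub>transport C T e\<^esub> x) = a \<odot>\<^bsub>C\<^esub> e x"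
  using assms subringE[OF assms(1)]
  by (simp_all add: transport_def module.defs f_inv_into_f inv_into_into)

lemma algebra_transport:
  assumes "algebra A C" and inj: "inj_on e T" and sub: "subring (e ` T) C"
    and sm: "\<forall>a\<in>carrier A. \<forall>x\<in>T. a \<odot>\<^bsub>C\<^esub> e x \<in> e ` T"
  shows "algebra A (transport C T e)"
proof -
  interpret C: algebra A C by fact
  let ?D = "transport C T e"
  note sel = transport_sel[where A = A, OF sub sm]
  have eC: "e x \<in> carrier C" if "x \<in> T" for x
    using that subringE(1)[OF sub] by auto
  note eq = inj_onD[OF inj]
  have ab: "abelian_group ?D"
  proof (rule abelian_groupI)
    fix x assume x: "x \<in> carrier ?D"
    then have "\<ominus>\<^bsub>C\<^esub> e x \<in> e ` T" using subringE(5)[OF sub] by (simp add: sel)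
    then obtain y where y: "y \<in> T" "e y = \<ominus>\<^bsub>C\<^esub> e x" by auto
    show "\<exists>y\<in>carrier ?D. y \<oplus>\<^bsub>?D\<^esub> x = \<zero>\<^bsub>?D\<^esub>"
      by (rule bexI[of _ y]) (use x y in \<open>auto intro!: eq simp: sel eC C.M.l_neg\<close>)
  qed (auto intro!: eq simp: sel eC C.M.a_ac)
  have cm: "comm_monoid ?D"
    by (rule comm_monoidI) (auto intro!: eq simp: sel eC C.m_ac)
  have cr: "cring ?D"
    by (rule cringI[OF ab cm]) (auto intro!: eq simp: sel eC C.l_distr)
  show ?thesis
    by (rule algebraI[OF C.R_cring cr])
      (auto intro!: eq simp: sel eC C.smult_l_distr C.smult_r_distr C.smult_assoc1 C.smult_assoc2)
qed

lemma transport_hom_ops: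
  assumes "algebra A C" and inj: "inj_on e T" and sub: "subring (e ` T) C"
    and sm: "\<forall>a\<in>carrier A. \<forall>x\<in>T. a \<odot>\<^bsub>C\<^esub> e x \<in> e ` T"
    and x: "x \<in> T" and y: "y \<in> T"
  shows "e (x \<ominus>\<^bsub>transport C T e\<^esub> y) = e x \<ominus>\<^bsub>C\<^esub> e y"
proof -
  interpret C: algebra A C by fact
  interpret D: algebra A "transport C T e" by (rule algebra_transport[OF assms(1-4)])
  note sel = transport_sel[where A = A, OF sub sm]
  have eC: "e x \<in> carrier C" if "x \<in> T" for x
    using that subringE(1)[OF sub] by auto
  have m: "\<ominus>\<^bsub>transport C T e\<^esub> y \<in> T" using D.M.a_inv_closed[of y] y by (simp add: sel)
  have "e (\<ominus>\<^bsub>transport C T e\<^esub> y) \<oplus>\<^bsub>C\<^esub> e y = \<zero>\<^bsub>C\<^esub>"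
    using sel(9)[OF m y] D.M.l_neg[of y] y by (simp add: sel)
  then have "e (\<ominus>\<^bsub>transport C T e\<^esub> y) = \<ominus>\<^bsub>C\<^esub> e y"
    using C.M.minus_equality[of "e (\<ominus>\<^bsub>transport C T e\<^esub> y)" "e y"] eC m y by simp
  then show ?thesis using sel(9)[OF x m] by (simp add: a_minus_def)
qed

lemma lift_via_transport:
  fixes C :: "('a, 'c) module" and T :: "'u set"
  assumes fs: "formally_smooth_wrt TYPE('u) A B"
    and alg: "algebra A C" and id: "ideal N C"
    and k: "k \<ge> 1" "ideal_pow C N k = {\<zero>\<^bsub>C\<^esub>}"
    and u: "u \<in> alg_hom A B (quotient_algebra C N)"
    and inj: "inj_on e T" and sub: "subring (e ` T) C"
    and sm: "\<forall>a\<in>carrier A. \<forall>x\<in>T. a \<odot>\<^bsub>C\<^esub> e x \<in> e ` T"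
    and g: "\<And>b. b \<in> carrier B \<Longrightarrow> g b \<in> T \<and> u b = N +>\<^bsub>C\<^esub> e (g b)"
  shows "\<exists>v\<in>alg_hom A B C. \<forall>b\<in>carrier B. N +>\<^bsub>C\<^esub> v b = u b"
proof -
  interpret C: algebra A C by fact
  interpret N: ideal N C by fact
  interpret B: algebra A B using fs by (simp add: formally_smooth_wrt_def)
  define D where "D = transport C T e"
  define N' where "N' = {x \<in> T. e x \<in> N}"
  have algD: "algebra A D"
    unfolding D_def by (rule algebra_transport[OF alg inj sub sm])
  interpret D: algebra A D by fact
  note sel = transport_sel[where A = A, OF sub sm, folded D_def]
  have minus: "e (x \<ominus>\<^bsub>D\<^esub> y) = e x \<ominus>\<^bsub>C\<^esub> e y" if "x \<in> T" "y \<in> T" for x y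
    unfolding D_def by (rule transport_hom_ops[OF alg inj sub sm that])
  have eC: "e x \<in> carrier C" if "x \<in> T" for x
    using that subringE(1)[OF sub] by auto
  have id': "ideal N' D"
  proof (rule idealI)
    show "ring D" by (rule cring.axioms(1)[OF D.M_cring])
    show "subgroup N' (add_monoid D)"
    proof (rule group.subgroupI[OF D.M.a_group])
      show "N' \<subseteq> carrier (add_monoid D)" by (auto simp: N'_def sel)
      show "N' \<noteq> {}" using sel by (auto simp: N'_def)
      fix x y assume x: "x \<in> N'" and y: "y \<in> N'"
      show "x \<otimes>\<^bsub>add_monoid D\<^esub> y \<in> N'" using x y by (auto simp: N'_def sel)
      have xT: "x \<in> T" and xN: "e x \<in> N" using x by (auto simp: N'_def)
      have iT: "\<ominus>\<^bsub>D\<^esub> x \<in> T" using D.M.a_inv_closed[of x] xT by (simp only: sel(1))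
      have "e (\<ominus>\<^bsub>D\<^esub> x) = e (\<zero>\<^bsub>D\<^esub> \<ominus>\<^bsub>D\<^esub> x)"
        using D.M.l_zero[of "\<ominus>\<^bsub>D\<^esub> x"] iT by (simp only: sel(1) a_minus_def)
      also have "\<dots> = \<zero>\<^bsub>C\<^esub> \<ominus>\<^bsub>C\<^esub> e x" by (simp only: minus[OF sel(4) xT] sel(5))
      also have "\<dots> = \<ominus>\<^bsub>C\<^esub> e x" using eC[OF xT] by (simp add: a_minus_def)
      also have "\<dots> \<in> N" using xN by (rule N.a_inv_closed)
      finally have "\<ominus>\<^bsub>D\<^esub> x \<in> N'" using iT by (simp add: N'_def)
      then show "inv\<^bsub>add_monoid D\<^esub> x \<in> N'" by (simp add: a_inv_def)
    qed
  qed (auto simp: N'_def sel eC N.I_l_closed N.I_r_closed)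
  have pow: "e ` ideal_pow D N' n \<subseteq> ideal_pow C N n" for n
  proof (induction n)
    case 0
    then show ?case using eC by (auto simp: sel)
  next
    case (Suc n)
    have carr: "ideal_pow D N' n \<subseteq> T" for n
    proof -
      have "ideal (ideal_pow D N' n) D"
        by (induction n) (simp_all add: D.oneideal D.ideal_prod_is_ideal id')
      then have "ideal_pow D N' n \<subseteq> carrier D" by (auto dest: ideal.Icarr)
      then show ?thesis by (simp only: sel(1))
    qed
    have "x \<in> T \<and> e x \<in> ideal_pow C N (Suc n)" if "x \<in> ideal_pow D N' (Suc n)" for x
      using that unfolding ideal_pow.simps
    proof (induction rule: ideal_prod.induct)
      case (prod i j)
      then have "i \<in> T" "j \<in> T" "e i \<in> N" "e j \<in> ideal_pow C N n"
        using carr Suc by (auto simp: N'_def)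
      then show ?case by (simp add: sel ideal_prod.prod)
    qed (simp add: sel ideal_prod.sum)
    then show ?case by blast
  qed
  have pow0: "ideal_pow D N' k = {\<zero>\<^bsub>D\<^esub>}"
  proof -
    have I: "ideal (ideal_pow D N' k) D"
      by (induction k) (simp_all add: D.oneideal D.ideal_prod_is_ideal id')
    then have z: "\<zero>\<^bsub>D\<^esub> \<in> ideal_pow D N' k"
      by (simp add: additive_subgroup.zero_closed ideal.axioms(1))
    moreover have "x = \<zero>\<^bsub>D\<^esub>" if "x \<in> ideal_pow D N' k" for x
    proof -
      have "x \<in> T" using ideal.Icarr[OF I that] by (simp add: sel)
      moreover have "e x = \<zero>\<^bsub>C\<^esub>" using pow[of k] k(2) that by auto
      ultimately show ?thesis using inj_onD[OF inj, of x "\<zero>\<^bsub>D\<^esub>"] sel(4,5) by simp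
    qed
    ultimately show ?thesis by blast
  qed
  have cos: "N' +>\<^bsub>D\<^esub> x = N' +>\<^bsub>D\<^esub> y \<longleftrightarrow> N +>\<^bsub>C\<^esub> e x = N +>\<^bsub>C\<^esub> e y" if "x \<in> T" "y \<in> T" for x y
    using coset_eq_iff[OF algD id', of x y] coset_eq_iff[OF alg id, of "e x" "e y"] that eC
      minus[OF that] D.M.minus_closed[of x y]
    by (auto simp: sel N'_def)
  let ?Q = "quotient_algebra C N" and ?Q' = "quotient_algebra D N'"
  define u' where "u' b = N' +>\<^bsub>D\<^esub> g b" for b
  note ops = quotient_coset_ops[OF alg id] smult_coset[OF alg id]
  note ops' = quotient_coset_ops[OF algD id', unfolded sel(1)] smult_coset[OF algD id', unfolded sel(1)]
  have gT: "g b \<in> T" and gu: "N +>\<^bsub>C\<^esub> e (g b) = u b" if "b \<in> carrier B" for b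
    using g[OF that] by auto
  have "u' \<in> alg_hom A B ?Q'"
  proof (rule alg_homI)
    fix x y assume xy: "x \<in> carrier B" "y \<in> carrier B"
    show "u' x \<in> carrier ?Q'" using gT[OF xy(1)] by (simp add: u'_def quotient_coset_closed sel)
    have "N +>\<^bsub>C\<^esub> e (g (x \<otimes>\<^bsub>B\<^esub> y)) = N +>\<^bsub>C\<^esub> e (g x \<otimes>\<^bsub>D\<^esub> g y)"
      using xy alg_homD(2)[OF u xy] ops(2)[of "e (g x)" "e (g y)"] by (simp add: sel gu gT eC)
    then show "u' (x \<otimes>\<^bsub>B\<^esub> y) = u' x \<otimes>\<^bsub>?Q'\<^esub> u' y"
      using xy by (simp add: u'_def ops' gT cos sel)
    have "N +>\<^bsub>C\<^esub> e (g (x \<oplus>\<^bsub>B\<^esub> y)) = N +>\<^bsub>C\<^esub> e (g x \<oplus>\<^bsub>D\<^esub> g y)"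
      using xy alg_homD(3)[OF u xy] ops(1)[of "e (g x)" "e (g y)"] by (simp add: sel gu gT eC)
    then show "u' (x \<oplus>\<^bsub>B\<^esub> y) = u' x \<oplus>\<^bsub>?Q'\<^esub> u' y"
      using xy by (simp add: u'_def ops' gT cos sel)
  next
    have "N +>\<^bsub>C\<^esub> e (g \<one>\<^bsub>B\<^esub>) = N +>\<^bsub>C\<^esub> e \<one>\<^bsub>D\<^esub>"
      using alg_homD(4)[OF u] by (simp add: sel gu quotient_algebra_sel)
    then show "u' \<one>\<^bsub>B\<^esub> = \<one>\<^bsub>?Q'\<^esub>" by (simp add: u'_def quotient_algebra_sel cos gT sel)
  next
    fix a x assume ax: "a \<in> carrier A" "x \<in> carrier B"
    have "N +>\<^bsub>C\<^esub> e (g (a \<odot>\<^bsub>B\<^esub> x)) = N +>\<^bsub>C\<^esub> e (a \<odot>\<^bsub>D\<^esub> g x)"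
      using ax alg_homD(5)[OF u ax] ops(3)[of a "e (g x)"] by (simp add: sel gu gT eC)
    then show "u' (a \<odot>\<^bsub>B\<^esub> x) = a \<odot>\<^bsub>?Q'\<^esub> u' x"
      using ax by (simp add: u'_def ops' gT cos sel)
  qed
  then obtain v where v: "v \<in> alg_hom A B D" "\<forall>b\<in>carrier B. N' +>\<^bsub>D\<^esub> v b = u' b"
    using fs algD id' k(1) pow0 unfolding formally_smooth_wrt_def by blast
  have vT: "v b \<in> T" if "b \<in> carrier B" for b
    using alg_homD(1)[OF v(1) that] by (simp add: sel)
  show ?thesis
  proof (rule bexI[of _ "\<lambda>b. e (v b)"], intro ballI)
    fix b assume b: "b \<in> carrier B"
    then show "N +>\<^bsub>C\<^esub> e (v b) = u b"
      using v(2) cos[of "v b" "g b"] vT gT gu by (simp add: u'_def)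
  next
    show "(\<lambda>b. e (v b)) \<in> alg_hom A B C"
      by (rule alg_homI) (simp_all add: alg_homD[OF v(1)] vT sel eC)
  qed
qed

definition eval_letter :: "('a, 'c, 'l) module_scheme \<Rightarrow> ('b \<Rightarrow> 'c) \<Rightarrow> 'a + 'b \<Rightarrow> 'c"
  where "eval_letter C h x = (case x of Inl a \<Rightarrow> a \<odot>\<^bsub>C\<^esub> \<one>\<^bsub>C\<^esub> | Inr b \<Rightarrow> h b)"

definition eval_word :: "('a, 'c, 'l) module_scheme \<Rightarrow> ('b \<Rightarrow> 'c) \<Rightarrow> ('a + 'b) list \<Rightarrow> 'c"
  where "eval_word C h w = foldr (\<lambda>x c. eval_letter C h x \<otimes>\<^bsub>C\<^esub> c) w \<one>\<^bsub>C\<^esub>"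

definition eval_sum :: "('a, 'c, 'l) module_scheme \<Rightarrow> ('b \<Rightarrow> 'c) \<Rightarrow> ('a + 'b) list list \<Rightarrow> 'c"
  where "eval_sum C h p = foldr (\<lambda>w c. eval_word C h w \<oplus>\<^bsub>C\<^esub> c) p \<zero>\<^bsub>C\<^esub>"

theorem formally_smooth_imp_wrt:
  fixes A :: "('a, 'k) ring_scheme" and B :: "('a, 'b, 'l) module_scheme"
  assumes "formally_smooth A B"
  shows "formally_smooth_wrt TYPE('c) A B"
  unfolding formally_smooth_wrt_def
proof (intro conjI allI impI, goal_cases)
  case 1
  then show ?case using assms by (simp add: formally_smooth_def formally_smooth_wrt_def)
next
  case (2 C N u)
  then have alg: "algebra A C" and id: "ideal N C" and u: "u \<in> alg_hom A B (quotient_algebra C N)"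
    by auto
  obtain k where k: "k \<ge> 1" "ideal_pow C N k = {\<zero>\<^bsub>C\<^esub>}" using 2 by auto
  interpret C: algebra A C by fact
  interpret B: algebra A B using assms by (simp add: formally_smooth_def formally_smooth_wrt_def)
  have "\<exists>c. c \<in> carrier C \<and> u b = N +>\<^bsub>C\<^esub> c" if "b \<in> carrier B" for b
    using alg_homD(1)[OF u that] by (rule quotient_carrierE) blast
  then obtain h where h: "\<And>b. b \<in> carrier B \<Longrightarrow> h b \<in> carrier C \<and> u b = N +>\<^bsub>C\<^esub> h b"
    by metis
  define L where "L = carrier A <+> carrier B"
  define W where "W = lists (lists L)"
  let ?l = "eval_letter C h" and ?w = "eval_word C h" and ?e = "eval_sum C h"
  have l: "?l x \<in> carrier C" if "x \<in> L" for x
    using that h by (auto simp: L_def eval_letter_def)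
  have w: "?w w \<in> carrier C" if "w \<in> lists L" for w
    using that by induction (auto simp: eval_word_def l)
  have e: "?e p \<in> carrier C" if "p \<in> W" for p
    using that unfolding W_def by induction (auto simp: eval_sum_def w)
  have w_app: "?w (v @ w) = ?w v \<otimes>\<^bsub>C\<^esub> ?w w" if "v \<in> lists L" "w \<in> lists L" for v w
    using that(1)
  proof induction
    case Nil then show ?case using w[OF that(2)] by (simp add: eval_word_def)
  next
    case (Cons x v)
    then show ?case using w[OF that(2)] w[OF Cons(2)] l[OF Cons(1)]
      by (simp add: eval_word_def C.m_assoc)
  qed
  have e_app: "?e (p @ q) = ?e p \<oplus>\<^bsub>C\<^esub> ?e q" if "p \<in> W" "q \<in> W" for p q
    using that(1) unfolding W_def
  proof induction
    case Nil then show ?case using e[OF that(2)] by (simp add: eval_sum_def)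
  next
    case (Cons x v)
    then show ?case using e[OF that(2)] e[of v] w[OF Cons(1)]
      by (simp add: eval_sum_def C.M.a_assoc W_def)
  qed
  have e_map: "?e (map ((@) v) q) = ?w v \<otimes>\<^bsub>C\<^esub> ?e q" if v: "v \<in> lists L" and "q \<in> W" for v q
    using that(2) unfolding W_def
  proof induction
    case Nil then show ?case using w[OF v] by (simp add: eval_sum_def)
  next
    case (Cons x p)
    then show ?case using e[of p] w[OF Cons(1)] w[OF v]
      by (simp add: eval_sum_def C.r_distr W_def w_app[OF v])
  qed
  have mult: "?e p \<otimes>\<^bsub>C\<^esub> ?e q \<in> ?e ` W" if "p \<in> W" and q: "q \<in> W" for p q
    using that(1) unfolding W_def
  proof induction
    case Nil
    show ?case using e[OF q] by (intro image_eqI[of _ _ "[]"]) (auto simp: eval_sum_def)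
  next
    case (Cons x p)
    then obtain r where r: "r \<in> W" "?e p \<otimes>\<^bsub>C\<^esub> ?e q = ?e r" by (auto simp: W_def)
    have m: "map ((@) x) q \<in> W" using Cons(1) q by (fastforce simp: W_def)
    have "?e (x # p) \<otimes>\<^bsub>C\<^esub> ?e q = ?w x \<otimes>\<^bsub>C\<^esub> ?e q \<oplus>\<^bsub>C\<^esub> ?e p \<otimes>\<^bsub>C\<^esub> ?e q"
      using e[OF q] e[of p] w[OF Cons(1)] Cons(2) by (simp add: eval_sum_def C.l_distr W_def)
    also have "\<dots> = ?e (map ((@) x) q @ r)"
      using e_app[OF m r(1)] r(2) e_map[OF Cons(1) q] by simp
    finally show ?case using m r(1) by (auto simp: W_def)
  qed
  have letter: "?e [[x]] = ?l x" if "x \<in> L" for x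
    using l[OF that] by (simp add: eval_sum_def eval_word_def)
  have sc: "a \<odot>\<^bsub>C\<^esub> \<one>\<^bsub>C\<^esub> \<in> ?e ` W" if "a \<in> carrier A" for a
    using letter[of "Inl a"] that
    by (intro image_eqI[of _ _ "[[Inl a]]"]) (auto simp: W_def L_def eval_letter_def InlI)
  have smD: "a \<odot>\<^bsub>C\<^esub> c \<in> ?e ` W" if "a \<in> carrier A" "c \<in> ?e ` W" for a c
    using sc[OF that(1)] that mult e algebra_smult_eq[OF alg that(1), of c] by auto
  have sub: "subring (?e ` W) C"
  proof (rule C.subringI)
    show "?e ` W \<subseteq> carrier C" using e by auto
    show "\<one>\<^bsub>C\<^esub> \<in> ?e ` W" using sc[of "\<one>\<^bsub>A\<^esub>"] by simp
    fix c d assume c: "c \<in> ?e ` W" and d: "d \<in> ?e ` W"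
    show "c \<otimes>\<^bsub>C\<^esub> d \<in> ?e ` W" using c d mult by auto
    show "c \<oplus>\<^bsub>C\<^esub> d \<in> ?e ` W"
    proof -
      obtain p q where pq: "p \<in> W" "c = ?e p" "q \<in> W" "d = ?e q" using c d by auto
      then have "p @ q \<in> W" by (auto simp: W_def)
      then show ?thesis using pq by (auto simp flip: e_app)
    qed
    show "\<ominus>\<^bsub>C\<^esub> c \<in> ?e ` W"
    proof -
      have "c \<in> carrier C" using c e by auto
      then show ?thesis
        using smD[OF _ c, of "\<ominus>\<^bsub>A\<^esub> \<one>\<^bsub>A\<^esub>"] C.smult_l_minus[of "\<one>\<^bsub>A\<^esub>" c] by simp
    qed
  qed
  define T where "T = inv_into W ?e ` (?e ` W)"
  have "?e ` T = (\<lambda>y. ?e (inv_into W ?e y)) ` (?e ` W)" by (simp only: T_def image_image)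
  also have "\<dots> = (\<lambda>y. y) ` (?e ` W)" by (rule image_cong) (simp_all only: f_inv_into_f)
  finally have TW: "?e ` T = ?e ` W" by simp
  have inj: "inj_on ?e T"
    unfolding T_def by (rule inj_onI) (auto simp: f_inv_into_f)
  have "\<exists>t. t \<in> T \<and> u b = N +>\<^bsub>C\<^esub> ?e t" if "b \<in> carrier B" for b
  proof -
    have "?e [[Inr b]] = h b" "[[Inr b]] \<in> W"
      using letter[of "Inr b"] that by (auto simp: L_def W_def eval_letter_def InrI)
    then have "h b \<in> ?e ` T" unfolding TW by (metis imageI)
    then show ?thesis using h[OF that] by auto
  qed
  then obtain g where g: "\<And>b. b \<in> carrier B \<Longrightarrow> g b \<in> T \<and> u b = N +>\<^bsub>C\<^esub> ?e (g b)" by metis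
  have subT: "subring (?e ` T) C" using sub by (simp only: TW)
  have smT: "\<forall>a\<in>carrier A. \<forall>x\<in>T. a \<odot>\<^bsub>C\<^esub> ?e x \<in> ?e ` T"
    using smD unfolding TW[symmetric] by blast
  show ?case
    by (rule lift_via_transport[OF assms[unfolded formally_smooth_def] alg id k u inj subT smT g])
qed


section \<open>The induced map on tensor products is well defined\<close>

lemma tensor_relationsI:
  "x \<in> carrier M \<Longrightarrow> x' \<in> carrier M \<Longrightarrow> y \<in> carrier E \<Longrightarrow>
    frag_of (x \<oplus>\<^bsub>M\<^esub> x', y) - frag_of (x, y) - frag_of (x', y) \<in> tensor_relations A M E"
  "x \<in> carrier M \<Longrightarrow> y \<in> carrier E \<Longrightarrow> y' \<in> carrier E \<Longrightarrow>
    frag_of (x, y \<oplus>\<^bsub>E\<^esub> y') - frag_of (x, y) - frag_of (x, y') \<in> tensor_relations A M E"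
  "a \<in> carrier A \<Longrightarrow> x \<in> carrier M \<Longrightarrow> y \<in> carrier E \<Longrightarrow>
    frag_of (a \<odot>\<^bsub>M\<^esub> x, y) - frag_of (x, a \<odot>\<^bsub>E\<^esub> y) \<in> tensor_relations A M E"
  unfolding tensor_relations_def by blast+

lemma tensor_relationsE:
  assumes "r \<in> tensor_relations A M E"
  obtains x x' y where "x \<in> carrier M" "x' \<in> carrier M" "y \<in> carrier E"
      "r = frag_of (x \<oplus>\<^bsub>M\<^esub> x', y) - frag_of (x, y) - frag_of (x', y)"
    | x y y' where "x \<in> carrier M" "y \<in> carrier E" "y' \<in> carrier E"
      "r = frag_of (x, y \<oplus>\<^bsub>E\<^esub> y') - frag_of (x, y) - frag_of (x, y')"
    | a x y where "a \<in> carrier A" "x \<in> carrier M" "y \<in> carrier E"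
      "r = frag_of (a \<odot>\<^bsub>M\<^esub> x, y) - frag_of (x, a \<odot>\<^bsub>E\<^esub> y)"
  using assms unfolding tensor_relations_def by blast

lemma tensor_relations_carrier:
  assumes "module A M" "module A E" and c: "c \<in> tensor_relations A M E"
  shows "Poly_Mapping.keys c \<subseteq> carrier M \<times> carrier E"
proof -
  interpret M: module A M by fact
  interpret E: module A E by fact
  have sub: "Poly_Mapping.keys (p - q) \<subseteq> S"
    if "Poly_Mapping.keys p \<subseteq> S" "Poly_Mapping.keys q \<subseteq> S" for p q :: "'z \<Rightarrow>\<^sub>0 int" and S
    using that keys_diff[of p q] by blast
  show ?thesis
    using c by (elim tensor_relationsE; hypsubst) (intro sub; simp)+
qed

lemma tensor_map_coset:
  assumes M: "module A M" and N: "module A N" and E: "module A E"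
    and f: "f \<in> linear_maps A M N" and c: "Poly_Mapping.keys c \<subseteq> carrier M \<times> carrier E"
  shows "tensor_map A N E f
      (tensor_kernel A M E #>\<^bsub>free_Abelian_group (carrier M \<times> carrier E)\<^esub> c) =
    tensor_kernel A N E #>\<^bsub>free_Abelian_group (carrier N \<times> carrier E)\<^esub>
      frag_extend (\<lambda>(x, y). frag_of (f x, y)) c"
proof -
  interpret M: module A M by fact
  interpret N: module A N by fact
  interpret E: module A E by fact
  let ?FM = "free_Abelian_group (carrier M \<times> carrier E)"
  let ?FN = "free_Abelian_group (carrier N \<times> carrier E)"
  let ?h = "frag_extend (\<lambda>(x, y). frag_of (f x, y))"
  let ?K = "tensor_kernel A M E" and ?L = "tensor_kernel A N E"
  have fN: "f x \<in> carrier N" if "x \<in> carrier M" for x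
    using f that by (auto simp: linear_maps_def)
  have add: "f (x \<oplus>\<^bsub>M\<^esub> y) = f x \<oplus>\<^bsub>N\<^esub> f y" if "x \<in> carrier M" "y \<in> carrier M" for x y
    using f that by (auto simp: linear_maps_def)
  have sm: "f (a \<odot>\<^bsub>M\<^esub> x) = a \<odot>\<^bsub>N\<^esub> f x" if "a \<in> carrier A" "x \<in> carrier M" for a x
    using f that by (auto simp: linear_maps_def)
  have h_keys: "Poly_Mapping.keys (?h c) \<subseteq> carrier N \<times> carrier E"
    if "Poly_Mapping.keys c \<subseteq> carrier M \<times> carrier E" for c
    by (rule order_trans[OF keys_frag_extend]) (use that fN in \<open>auto split: prod.splits\<close>)
  have rel: "?h r \<in> tensor_relations A N E" if "r \<in> tensor_relations A M E" for r
    using that fN add sm by (elim tensor_relationsE) (simp_all add: frag_extend_diff tensor_relationsI)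
  have L: "subgroup ?L ?FN"
    unfolding tensor_kernel_def
    by (rule group.generate_is_subgroup) (auto dest: tensor_relations_carrier[OF N E])
  have K: "subgroup ?K ?FM"
    unfolding tensor_kernel_def
    by (rule group.generate_is_subgroup) (auto dest: tensor_relations_carrier[OF M E])
  have hK: "?h k \<in> ?L" if "k \<in> ?K" for k
    using that unfolding tensor_kernel_def[of A M]
  proof (induction rule: generate.induct)
    case one
    show ?case using subgroup.one_closed[OF L] by simp
  next
    case (incl r)
    then show ?case by (simp add: tensor_kernel_def rel generate.incl)
  next
    case (inv r)
    then show ?case
      using generate.inv[OF rel[OF inv], of ?FN] tensor_relations_carrier[OF M E inv]
        tensor_relations_carrier[OF N E rel[OF inv]]
      by (simp add: tensor_kernel_def frag_extend_minus)
  next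
    case (eng p q)
    then show ?case using subgroup.m_closed[OF L] by (simp add: frag_extend_add)
  qed
  have "?L #>\<^bsub>?FN\<^esub> ?h (k + c) = ?L #>\<^bsub>?FN\<^esub> ?h c" if k: "k \<in> ?K" for k
  proof -
    have "?h k + ?h c \<in> ?L #>\<^bsub>?FN\<^esub> ?h c" using hK[OF k] by (auto simp: r_coset_def)
    then show ?thesis
      using group.repr_independence[OF _ _ _ L] h_keys[OF c] by (simp add: frag_extend_add)
  qed
  moreover have "?K \<noteq> {}" using subgroup.one_closed[OF K] by auto
  ultimately show ?thesis by (auto simp: tensor_map_def r_coset_def[of ?FM])
qed

end

theory Submission
  imports Defs "HOL-Algebra.UnivPoly"
begin

text \<open>Write \<open>B = P / I\<close> with \<open>P\<close> a localization of a polynomial ring over \<open>A\<close>; then \<open>P\<close> is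
  noetherian and flat over \<open>A\<close>. Formal smoothness lifts the identity of \<open>B\<close> to algebra maps
  \<open>B \<rightarrow> P / I\<^sup>n\<close> for all \<open>n\<close>. Hence a linear relation \<open>\<Sum> a\<^sub>i b\<^sub>i = 0\<close> in \<open>B\<close> has lifts \<open>p\<^sub>i\<close>
  with \<open>\<Sum> a\<^sub>i p\<^sub>i \<in> I\<^sup>n\<close>. By Artin-Rees, for large \<open>n\<close> this sum equals \<open>\<Sum> a\<^sub>i \<epsilon>\<^sub>i\<close> with \<open>\<epsilon>\<^sub>i \<in> I\<close>, so
  that \<open>p\<^sub>i - \<epsilon>\<^sub>i\<close> is a lift of the relation to \<open>P\<close>. There it is a consequence of relations
  with coefficients in \<open>A\<close>, by flatness of \<open>P\<close>, and hence so is the original relation in \<open>B\<close>.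
  The equational criterion then gives the flatness of \<open>B\<close>.\<close>

section \<open>Noetherian rings\<close>

text \<open>The maps B \<rightarrow> P / I^n stop short of a section B \<rightarrow> P: the lifting
  property concerns nilpotent ideals, and I is in general not nilpotent. Artin-Rees pays for the
  error in I^n. It is applied to a single ideal M, the one generated in P by the coefficients of the
  relation, so that the form I^n \<inter> M \<subseteq> I M for ideals is enough. The equational
  criterion is the interface because relations can be lifted to P and pushed down to B without any
  tensor product. It speaks of one relation, whereas an element of N \<otimes> E vanishes because of
  finitely many linear relations in E taken together; the passage to finite systems bridges this
  gap. A second obstacle is typing: the elements of P must have a type that does not depend on the
  number of variables. Hence variables are adjoined one at a time, and after each step the elements
  are relabelled inside one fixed type.\<close>

lemma cring_idealI:
  fixes R (structure)
  assumes "cring R" and sub: "I \<subseteq> carrier R" and zero: "\<zero> \<in> I"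
    and add: "\<And>x y. x \<in> I \<Longrightarrow> y \<in> I \<Longrightarrow> x \<oplus> y \<in> I"
    and mult: "\<And>r x. r \<in> carrier R \<Longrightarrow> x \<in> I \<Longrightarrow> r \<otimes> x \<in> I"
  shows "ideal I R"
proof -
  interpret cring R by fact
  show ?thesis
  proof (rule idealI)
    show "ring R" by (rule ring_axioms)
    show "subgroup I (add_monoid R)"
    proof (rule group.subgroupI[OF a_group])
      fix x assume x: "x \<in> I"
      then have "\<ominus> x = (\<ominus> \<one>) \<otimes> x" using sub by (auto simp: l_minus)
      then have "\<ominus> x \<in> I" using mult[of "\<ominus> \<one>" x] x by simp
      then show "inv\<^bsub>add_monoid R\<^esub> x \<in> I" by (simp add: a_inv_def)
    qed (use sub zero add in auto)
    fix r x assume rx: "r \<in> I" "x \<in> carrier R"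
    then show "x \<otimes> r \<in> I" by (intro mult)
    then show "r \<otimes> x \<in> I" using m_comm[of x r] rx sub by auto
  qed
qed

lemma ideal_closed:
  fixes R (structure)
  assumes "ideal I R"
  shows "\<zero> \<in> I" "x \<in> I \<Longrightarrow> x \<in> carrier R" "x \<in> I \<Longrightarrow> y \<in> I \<Longrightarrow> x \<oplus> y \<in> I" "x \<in> I \<Longrightarrow> y \<in> I \<Longrightarrow> x \<ominus> y \<in> I"
    "x \<in> I \<Longrightarrow> r \<in> carrier R \<Longrightarrow> r \<otimes> x \<in> I" "x \<in> I \<Longrightarrow> r \<in> carrier R \<Longrightarrow> x \<otimes> r \<in> I"
proof -
  interpret ideal I R by fact
  show "\<zero> \<in> I" "x \<in> I \<Longrightarrow> x \<in> carrier R" "x \<in> I \<Longrightarrow> y \<in> I \<Longrightarrow> x \<oplus> y \<in> I" "x \<in> I \<Longrightarrow> y \<in> I \<Longrightarrow> x \<ominus> y \<in> I"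
    "x \<in> I \<Longrightarrow> r \<in> carrier R \<Longrightarrow> r \<otimes> x \<in> I" "x \<in> I \<Longrightarrow> r \<in> carrier R \<Longrightarrow> x \<otimes> r \<in> I"
    by (auto simp: I_l_closed I_r_closed a_minus_def)
qed

text \<open>Zorn's lemma applies because a nonempty chain of ideals contains its own union. Applied
  to the range of an ascending sequence of ideals, this yields the index at which the sequence
  stabilizes.\<close>

lemma (in noetherian_ring) exists_maximal_ideal_in:
  assumes "\<F> \<noteq> {}" and "\<And>I. I \<in> \<F> \<Longrightarrow> ideal I R"
  shows "\<exists>M\<in>\<F>. \<forall>I\<in>\<F>. M \<subseteq> I \<longrightarrow> I = M"
proof (rule subset_Zorn)
  fix C assume C: "subset.chain \<F> C"
  show "\<exists>U\<in>\<F>. \<forall>X\<in>C. X \<subseteq> U"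
  proof (cases "C = {}")
    case True
    then show ?thesis using assms(1) by auto
  next
    case False
    have "C \<subseteq> \<F>" using C by (simp add: subset.chain_def)
    moreover have "subset.chain {I. ideal I R} C"
      using C assms(2) by (auto simp: subset.chain_def)
    ultimately show ?thesis using ideal_chain_is_trivial[OF False] by blast
  qed
qed

section \<open>The noetherian property along ring homomorphisms\<close>

lemma ideal_vimage:
  assumes "cring R" "cring S" "h \<in> ring_hom R S" "ideal J S"
  shows "ideal {r \<in> carrier R. h r \<in> J} R"
proof -
  interpret ring_hom_cring R S h by (rule ring_hom_cringI[OF assms(1-3)])
  show ?thesis
    by (rule cring_idealI[OF assms(1)]) (auto simp: ideal_closed[OF assms(4)])
qed

text \<open>By \<open>le\<close>, inclusions between ideals of \<open>S\<close> can be tested on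
  their contractions to \<open>R\<close>. So the images of finitely many generators of the
  contraction of \<open>J\<close> already generate \<open>J\<close>. Surjections and localizations
  both satisfy \<open>le\<close>.\<close>

lemma noetherian_contraction:
  fixes R (structure) and S (structure)
  assumes "noetherian_ring R" "cring R" "cring S" "h \<in> ring_hom R S"
    and le: "\<And>J K. ideal J S \<Longrightarrow> ideal K S \<Longrightarrow>
      (\<And>r. r \<in> carrier R \<Longrightarrow> h r \<in> J \<Longrightarrow> h r \<in> K) \<Longrightarrow> J \<subseteq> K"
  shows "noetherian_ring S"
proof -
  interpret R: noetherian_ring R by fact
  interpret S: cring S by fact
  interpret ring_hom_cring R S h by (rule ring_hom_cringI[OF assms(2-4)])
  show ?thesis
  proof (rule S.noetherian_ringI)
    fix J assume J: "ideal J S"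
    obtain A where A: "A \<subseteq> carrier R" "finite A" "{r \<in> carrier R. h r \<in> J} = genideal R A"
      using R.finetely_gen[OF ideal_vimage[OF assms(2-4) J]] by auto
    have hA: "h ` A \<subseteq> carrier S" using A(1) by auto
    let ?K = "genideal S (h ` A)"
    have K: "ideal ?K S" using hA by (rule S.genideal_ideal)
    have "A \<subseteq> {r \<in> carrier R. h r \<in> J}" using R.genideal_self[OF A(1)] A(3) by simp
    then have 1: "?K \<subseteq> J" by (intro S.genideal_minimal[OF J]) auto
    have "A \<subseteq> {r \<in> carrier R. h r \<in> ?K}" using S.genideal_self[OF hA] A(1) by auto
    then have "genideal R A \<subseteq> {r \<in> carrier R. h r \<in> ?K}"
      by (intro R.genideal_minimal[OF ideal_vimage[OF assms(2-4) K]])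
    then have "J \<subseteq> ?K" using A(3) by (intro le[OF J K]) auto
    with 1 show "\<exists>A\<subseteq>carrier S. finite A \<and> J = genideal S A" using hA A(2) by blast
  qed
qed

lemma noetherian_surjective_image:
  assumes "noetherian_ring R" "cring R" "cring S" "h \<in> ring_hom R S" "h ` carrier R = carrier S"
  shows "noetherian_ring S"
proof (rule noetherian_contraction[OF assms(1-4)], rule subsetI)
  fix J K y
  assume "ideal J S" and K: "\<And>r. r \<in> carrier R \<Longrightarrow> h r \<in> J \<Longrightarrow> h r \<in> K" and y: "y \<in> J"
  then have "y \<in> h ` carrier R" using ideal_closed(2) assms(5) by metis
  then show "y \<in> K" using K y by auto
qed

subsection \<open>Hilbert's basis theorem\<close>

text \<open>The values at \<open>x\<close> of polynomials of degree below \<open>d\<close> with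
  coefficients from \<open>S\<close>. Splitting off the top term makes induction on \<open>d\<close>
  an induction on leading terms. Different polynomials may have the same value.\<close>

primrec poly_below where
  "poly_below S R \<phi> x 0 = {\<zero>\<^bsub>R\<^esub>}"
| "poly_below S R \<phi> x (Suc d) =
    {\<phi> s \<otimes>\<^bsub>R\<^esub> x [^]\<^bsub>R\<^esub> d \<oplus>\<^bsub>R\<^esub> g | s g. s \<in> carrier S \<and> g \<in> poly_below S R \<phi> x d}"

text \<open>Two nested ideals with the same leading coefficients in every degree are equal. The
  ideals of leading coefficients ascend with the degree, hence stabilize at some \<open>D\<close>,
  and lifts of their finitely many generators in the degrees up to \<open>D\<close> generate the
  ideal. The ring \<open>R\<close> is any ring generated by one element over the image of
  \<open>S\<close>.\<close>

theorem hilbert_basis: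
  fixes S (structure) and R (structure)
  assumes noeth: "noetherian_ring S" and S: "cring S" and R: "cring R" and \<phi>: "\<phi> \<in> ring_hom S R"
    and x: "x \<in> carrier R" and gen: "carrier R \<subseteq> (\<Union>d. poly_below S R \<phi> x d)"
  shows "noetherian_ring R"
proof -
  interpret S: noetherian_ring S by fact
  interpret R: cring R by fact
  interpret h: ring_hom_cring S R \<phi> by (rule ring_hom_cringI[OF S R \<phi>])
  let ?P = "poly_below S R \<phi> x"
  have P: "?P d \<subseteq> carrier R" for d
    using x by (induction d) auto
  have P_SucI: "f \<in> ?P (Suc d)"
    if "f = \<phi> s \<otimes>\<^bsub>R\<^esub> x [^]\<^bsub>R\<^esub> d \<oplus>\<^bsub>R\<^esub> g" "s \<in> carrier S" "g \<in> ?P d" for f s g d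
    using that by auto
  have P_zero: "\<zero>\<^bsub>R\<^esub> \<in> ?P d" for d
  proof (induction d)
    case (Suc d)
    have "\<zero>\<^bsub>R\<^esub> = \<phi> \<zero>\<^bsub>S\<^esub> \<otimes>\<^bsub>R\<^esub> x [^]\<^bsub>R\<^esub> d \<oplus>\<^bsub>R\<^esub> \<zero>\<^bsub>R\<^esub>" using x by simp
    then show ?case using Suc by (rule P_SucI[OF _ S.zero_closed])
  qed simp
  have P_add: "f \<oplus>\<^bsub>R\<^esub> g \<in> ?P d" if "f \<in> ?P d" "g \<in> ?P d" for f g d
    using that
  proof (induction d arbitrary: f g)
    case (Suc d)
    then obtain s f' t g' where s: "s \<in> carrier S" "t \<in> carrier S" and f': "f' \<in> ?P d" "g' \<in> ?P d"
      and fg: "f = \<phi> s \<otimes>\<^bsub>R\<^esub> x [^]\<^bsub>R\<^esub> d \<oplus>\<^bsub>R\<^esub> f'" "g = \<phi> t \<otimes>\<^bsub>R\<^esub> x [^]\<^bsub>R\<^esub> d \<oplus>\<^bsub>R\<^esub> g'"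
      by auto
    have "f' \<in> carrier R" "g' \<in> carrier R" using f' P by auto
    then have "f \<oplus>\<^bsub>R\<^esub> g = \<phi> (s \<oplus>\<^bsub>S\<^esub> t) \<otimes>\<^bsub>R\<^esub> x [^]\<^bsub>R\<^esub> d \<oplus>\<^bsub>R\<^esub> (f' \<oplus>\<^bsub>R\<^esub> g')"
      using s x by (simp add: fg R.l_distr R.a_ac)
    then show ?case by (rule P_SucI[OF _ S.a_closed[OF s] Suc.IH[OF f']])
  qed simp
  have P_mult: "\<phi> r \<otimes>\<^bsub>R\<^esub> f \<in> ?P d" if "r \<in> carrier S" "f \<in> ?P d" for r f d
    using that
  proof (induction d arbitrary: f)
    case (Suc d)
    then obtain s f' where s: "s \<in> carrier S" and f': "f' \<in> ?P d"
      and f: "f = \<phi> s \<otimes>\<^bsub>R\<^esub> x [^]\<^bsub>R\<^esub> d \<oplus>\<^bsub>R\<^esub> f'" by auto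
    have "f' \<in> carrier R" using f' P by auto
    then have "\<phi> r \<otimes>\<^bsub>R\<^esub> f = \<phi> (r \<otimes>\<^bsub>S\<^esub> s) \<otimes>\<^bsub>R\<^esub> x [^]\<^bsub>R\<^esub> d \<oplus>\<^bsub>R\<^esub> \<phi> r \<otimes>\<^bsub>R\<^esub> f'"
      using s x Suc.prems(1) by (simp add: f R.r_distr R.m_assoc)
    then show ?case by (rule P_SucI[OF _ S.m_closed[OF Suc.prems(1) s] Suc.IH[OF Suc.prems(1) f']])
  qed simp
  have P_shift: "x \<otimes>\<^bsub>R\<^esub> f \<in> ?P (Suc d)" if "f \<in> ?P d" for f d
    using that
  proof (induction d arbitrary: f)
    case 0
    then show ?case using x P_zero[of "Suc 0"] by simp
  next
    case (Suc d)
    then obtain s f' where s: "s \<in> carrier S" and f': "f' \<in> ?P d"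
      and f: "f = \<phi> s \<otimes>\<^bsub>R\<^esub> x [^]\<^bsub>R\<^esub> d \<oplus>\<^bsub>R\<^esub> f'" by auto
    have "f' \<in> carrier R" using f' P by auto
    then have "x \<otimes>\<^bsub>R\<^esub> f = \<phi> s \<otimes>\<^bsub>R\<^esub> x [^]\<^bsub>R\<^esub> Suc d \<oplus>\<^bsub>R\<^esub> x \<otimes>\<^bsub>R\<^esub> f'"
      using s x by (simp add: f R.r_distr R.m_ac)
    then show ?case by (rule P_SucI[OF _ s Suc.IH[OF f']])
  qed
  \<comment> \<open>The possible coefficients of \<open>x [^] d\<close> in elements of
    \<open>J\<close> of degree at most \<open>d\<close>, with 0 included. As expressions need not be
    unique, one suitable expression suffices for membership.\<close>
  define L where "L J d = {s \<in> carrier S. \<exists>g\<in>?P d. \<phi> s \<otimes>\<^bsub>R\<^esub> x [^]\<^bsub>R\<^esub> d \<oplus>\<^bsub>R\<^esub> g \<in> J}" for J d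
  have L_I: "s \<in> L J d" if "s \<in> carrier S" "g \<in> ?P d" "f \<in> J"
    "\<phi> s \<otimes>\<^bsub>R\<^esub> x [^]\<^bsub>R\<^esub> d \<oplus>\<^bsub>R\<^esub> g = f" for s g d f J
    using that by (auto simp: L_def)
  have L_ideal: "ideal (L J d) S" if J: "ideal J R" for J d
  proof (rule cring_idealI[OF S])
    show "\<zero>\<^bsub>S\<^esub> \<in> L J d" unfolding L_def using x P_zero ideal_closed(1)[OF J] by (auto intro!: bexI[of _ "\<zero>\<^bsub>R\<^esub>"])
  next
    fix s t assume "s \<in> L J d" "t \<in> L J d"
    then obtain f g where s: "s \<in> carrier S" "t \<in> carrier S" and fg: "f \<in> ?P d" "g \<in> ?P d"
      and J': "\<phi> s \<otimes>\<^bsub>R\<^esub> x [^]\<^bsub>R\<^esub> d \<oplus>\<^bsub>R\<^esub> f \<in> J" "\<phi> t \<otimes>\<^bsub>R\<^esub> x [^]\<^bsub>R\<^esub> d \<oplus>\<^bsub>R\<^esub> g \<in> J"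
      by (auto simp: L_def)
    have "f \<in> carrier R" "g \<in> carrier R" using fg P by auto
    then have "\<phi> (s \<oplus>\<^bsub>S\<^esub> t) \<otimes>\<^bsub>R\<^esub> x [^]\<^bsub>R\<^esub> d \<oplus>\<^bsub>R\<^esub> (f \<oplus>\<^bsub>R\<^esub> g)
      = (\<phi> s \<otimes>\<^bsub>R\<^esub> x [^]\<^bsub>R\<^esub> d \<oplus>\<^bsub>R\<^esub> f) \<oplus>\<^bsub>R\<^esub> (\<phi> t \<otimes>\<^bsub>R\<^esub> x [^]\<^bsub>R\<^esub> d \<oplus>\<^bsub>R\<^esub> g)"
      using s x by (simp add: R.l_distr R.a_ac)
    then show "s \<oplus>\<^bsub>S\<^esub> t \<in> L J d"
      by (rule L_I[OF S.a_closed[OF s] P_add[OF fg] ideal_closed(3)[OF J J']])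
  next
    fix r s assume r: "r \<in> carrier S" and "s \<in> L J d"
    then obtain f where s: "s \<in> carrier S" and f: "f \<in> ?P d"
      and J': "\<phi> s \<otimes>\<^bsub>R\<^esub> x [^]\<^bsub>R\<^esub> d \<oplus>\<^bsub>R\<^esub> f \<in> J"
      by (auto simp: L_def)
    have "f \<in> carrier R" using f P by auto
    then have "\<phi> (r \<otimes>\<^bsub>S\<^esub> s) \<otimes>\<^bsub>R\<^esub> x [^]\<^bsub>R\<^esub> d \<oplus>\<^bsub>R\<^esub> \<phi> r \<otimes>\<^bsub>R\<^esub> f = \<phi> r \<otimes>\<^bsub>R\<^esub> (\<phi> s \<otimes>\<^bsub>R\<^esub> x [^]\<^bsub>R\<^esub> d \<oplus>\<^bsub>R\<^esub> f)"
      using s x r by (simp add: R.r_distr R.m_assoc)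
    then show "r \<otimes>\<^bsub>S\<^esub> s \<in> L J d"
      using r by (intro L_I[OF S.m_closed[OF r s] P_mult[OF r f] ideal_closed(5)[OF J J', of "\<phi> r"]]) auto
  qed (auto simp: L_def)
  have L_Suc: "L J d \<subseteq> L J (Suc d)" if J: "ideal J R" for J d
  proof
    fix s assume "s \<in> L J d"
    then obtain f where s: "s \<in> carrier S" and f: "f \<in> ?P d"
      and J': "\<phi> s \<otimes>\<^bsub>R\<^esub> x [^]\<^bsub>R\<^esub> d \<oplus>\<^bsub>R\<^esub> f \<in> J"
      by (auto simp: L_def)
    have "f \<in> carrier R" using f P by auto
    then have "\<phi> s \<otimes>\<^bsub>R\<^esub> x [^]\<^bsub>R\<^esub> Suc d \<oplus>\<^bsub>R\<^esub> x \<otimes>\<^bsub>R\<^esub> f = x \<otimes>\<^bsub>R\<^esub> (\<phi> s \<otimes>\<^bsub>R\<^esub> x [^]\<^bsub>R\<^esub> d \<oplus>\<^bsub>R\<^esub> f)"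
      using s x by (simp add: R.r_distr R.m_ac)
    then show "s \<in> L J (Suc d)"
      by (rule L_I[OF s P_shift[OF f] ideal_closed(5)[OF J J' x]])
  qed
  have L_mono: "L J d \<subseteq> L J e" if "ideal J R" "d \<le> e" for J d e
    using that(2) by (rule lift_Suc_mono_le[of "L J", OF L_Suc[OF that(1)]])
  \<comment> \<open>Subtracting an element of \<open>K\<close> with the same leading term leaves an
    element of \<open>J\<close> of smaller degree.\<close>
  have compare: "J \<subseteq> K"
    if J: "ideal J R" and K: "ideal K R" and "K \<subseteq> J" and LL: "\<And>d. L J d \<subseteq> L K d" for J K
  proof -
    have "f \<in> K" if "f \<in> J" "f \<in> ?P d" for f d
      using that
    proof (induction d arbitrary: f)
      case 0
      then show ?case using ideal_closed(1)[OF K] by simp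
    next
      case (Suc d)
      then obtain s f' where s: "s \<in> carrier S" and f': "f' \<in> ?P d"
        and f: "f = \<phi> s \<otimes>\<^bsub>R\<^esub> x [^]\<^bsub>R\<^esub> d \<oplus>\<^bsub>R\<^esub> f'" by auto
      then have "s \<in> L J d" using Suc.prems by (auto simp: L_def)
      then obtain g where g: "g \<in> ?P d" "\<phi> s \<otimes>\<^bsub>R\<^esub> x [^]\<^bsub>R\<^esub> d \<oplus>\<^bsub>R\<^esub> g \<in> K"
        using LL by (auto simp: L_def)
      have c: "f' \<in> carrier R" "g \<in> carrier R" using f' g P by auto
      have m: "\<ominus>\<^bsub>R\<^esub> g \<in> ?P d"
        using P_mult[OF _ g(1), of "\<ominus>\<^bsub>S\<^esub> \<one>\<^bsub>S\<^esub>"] c by (simp add: R.l_minus)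
      have eq: "f \<ominus>\<^bsub>R\<^esub> (\<phi> s \<otimes>\<^bsub>R\<^esub> x [^]\<^bsub>R\<^esub> d \<oplus>\<^bsub>R\<^esub> g) = f' \<oplus>\<^bsub>R\<^esub> \<ominus>\<^bsub>R\<^esub> g"
        using c s x by (simp add: f R.minus_eq R.minus_add R.a_ac R.r_neg R.r_neg1)
      have "f \<ominus>\<^bsub>R\<^esub> (\<phi> s \<otimes>\<^bsub>R\<^esub> x [^]\<^bsub>R\<^esub> d \<oplus>\<^bsub>R\<^esub> g) \<in> K"
      proof (rule Suc.IH)
        show "f \<ominus>\<^bsub>R\<^esub> (\<phi> s \<otimes>\<^bsub>R\<^esub> x [^]\<^bsub>R\<^esub> d \<oplus>\<^bsub>R\<^esub> g) \<in> J"
          using Suc.prems(1) g(2) \<open>K \<subseteq> J\<close> by (intro ideal_closed(4)[OF J]) auto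
        show "f \<ominus>\<^bsub>R\<^esub> (\<phi> s \<otimes>\<^bsub>R\<^esub> x [^]\<^bsub>R\<^esub> d \<oplus>\<^bsub>R\<^esub> g) \<in> ?P d"
          unfolding eq by (rule P_add[OF f' m])
      qed
      from ideal_closed(3)[OF K this g(2)] show ?case
        using c s x ideal_closed(2)[OF J Suc.prems(1)]
        by (simp add: R.minus_eq R.a_assoc R.l_neg)
    qed
    then show ?thesis using gen ideal_closed(2)[OF J] by blast
  qed
  show ?thesis
  proof (rule R.noetherian_ringI)
    fix J assume J: "ideal J R"
    \<comment> \<open>A maximal member of the range of \<open>L J\<close> contains all the others,
      since the sequence is monotone.\<close>
    obtain D where D: "\<And>d. L J d \<subseteq> L J D"
    proof -
      have "\<exists>M\<in>range (L J). \<forall>I\<in>range (L J). M \<subseteq> I \<longrightarrow> I = M"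
        by (rule S.exists_maximal_ideal_in) (use L_ideal[OF J] in auto)
      then obtain D where D: "\<And>e. L J D \<subseteq> L J e \<Longrightarrow> L J e = L J D" by auto
      have "L J d \<subseteq> L J D" for d
        using D[OF L_mono[OF J, of D "max d D"]] L_mono[OF J, of d "max d D"] by auto
      then show ?thesis by (rule that)
    qed
    have "\<forall>d. \<exists>A\<subseteq>carrier S. finite A \<and> L J d = genideal S A"
      using S.finetely_gen[OF L_ideal[OF J]] by blast
    then obtain A where A: "\<And>d. A d \<subseteq> carrier S" "\<And>d. finite (A d)" "\<And>d. L J d = genideal S (A d)"
      by metis
    have "\<exists>g\<in>?P d. \<phi> a \<otimes>\<^bsub>R\<^esub> x [^]\<^bsub>R\<^esub> d \<oplus>\<^bsub>R\<^esub> g \<in> J" if "a \<in> A d" for a d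
      using that S.genideal_self[OF A(1)[of d]] A(3)[of d] by (auto simp: L_def)
    then obtain g where g: "\<And>a d. a \<in> A d \<Longrightarrow> g a d \<in> ?P d \<and> \<phi> a \<otimes>\<^bsub>R\<^esub> x [^]\<^bsub>R\<^esub> d \<oplus>\<^bsub>R\<^esub> g a d \<in> J"
      by metis
    \<comment> \<open>One lift for each generator of each leading coefficient ideal in the degrees 0
      to \<open>D\<close>.\<close>
    define F where "F = (\<lambda>(d, a). \<phi> a \<otimes>\<^bsub>R\<^esub> x [^]\<^bsub>R\<^esub> d \<oplus>\<^bsub>R\<^esub> g a d) ` (SIGMA d:{..D}. A d)"
    have F: "finite F" "F \<subseteq> J" unfolding F_def using g A(2) by auto
    have FR: "F \<subseteq> carrier R" using F(2) ideal_closed(2)[OF J] by auto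
    let ?K = "genideal R F"
    have K: "ideal ?K R" by (rule R.genideal_ideal[OF FR])
    have KJ: "?K \<subseteq> J" by (rule R.genideal_minimal[OF J F(2)])
    have le: "L J d \<subseteq> L ?K d" if "d \<le> D" for d
      unfolding A(3)
    proof (rule S.genideal_minimal[OF L_ideal[OF K]], rule)
      fix a assume a: "a \<in> A d"
      then have "\<phi> a \<otimes>\<^bsub>R\<^esub> x [^]\<^bsub>R\<^esub> d \<oplus>\<^bsub>R\<^esub> g a d \<in> F" using that by (force simp: F_def)
      then show "a \<in> L ?K d" using R.genideal_self[OF FR] g[OF a] A(1)[of d] a by (auto simp: L_def)
    qed
    \<comment> \<open>Beyond \<open>D\<close> the inclusions are \<open>L J d\<close> \<subseteq>
      \<open>L J D\<close> \<subseteq> \<open>L ?K D\<close> \<subseteq>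
      \<open>L ?K d\<close>.\<close>
    have "L J d \<subseteq> L ?K d" for d
      using le[of d] D[of d] le[of D] L_mono[OF K, of D d] by (cases "d \<le> D") auto
    then have "J = ?K" using compare[OF J K KJ] KJ by auto
    then show "\<exists>A\<subseteq>carrier R. finite A \<and> J = genideal R A" using F FR by auto
  qed
qed

section \<open>A weak form of the Artin-Rees lemma\<close>

lemma (in cring) ideal_pow_ideal: "ideal I R \<Longrightarrow> ideal (ideal_pow R I n) R"
  by (induction n) (simp_all add: oneideal ideal_prod_is_ideal)

lemma set_addI: "x \<in> I \<Longrightarrow> y \<in> J \<Longrightarrow> x \<oplus>\<^bsub>R\<^esub> y \<in> set_add R I J"
  by (auto simp: set_add_def set_mult_def)

lemma ideal_prod_mono:
  assumes "I \<subseteq> I'" "J \<subseteq> J'"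
  shows "ideal_prod R I J \<subseteq> ideal_prod R I' J'"
proof
  fix x assume "x \<in> ideal_prod R I J"
  then show "x \<in> ideal_prod R I' J'"
    by induction (use assms in \<open>auto intro: ideal_prod.intros\<close>)
qed

lemma ideal_pow_mono: "I \<subseteq> J \<Longrightarrow> ideal_pow R I n \<subseteq> ideal_pow R J n"
  by (induction n) (simp_all add: ideal_prod_mono)

lemma (in cring) ideal_pow_Suc_subset: "ideal I R \<Longrightarrow> ideal_pow R I (Suc n) \<subseteq> ideal_pow R I n"
  using ideal_prod_inter[OF _ ideal_pow_ideal] by auto

text \<open>For \<open>w\<close> = 1 this says that (I + J)^(a+b) lies in \<open>K\<close> as soon
  as I^a and J^b do. The multiplier makes the induction run: a factor i1 + i2 is split, i1 is
  absorbed into \<open>w\<close> and lowers \<open>a\<close>, while i2 is absorbed and lowers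
  \<open>b\<close>.\<close>

lemma (in cring) mult_ideal_pow_add:
  assumes K: "ideal K R" and I: "ideal I R" and J: "ideal J R"
  shows "w \<in> carrier R \<Longrightarrow> \<forall>z\<in>ideal_pow R I a. w \<otimes> z \<in> K \<Longrightarrow> \<forall>z\<in>ideal_pow R J b. w \<otimes> z \<in> K \<Longrightarrow>
    z \<in> ideal_pow R (set_add R I J) (a + b) \<Longrightarrow> w \<otimes> z \<in> K"
proof (induction "a + b" arbitrary: a b w z)
  case 0
  then show ?case by simp
next
  case (Suc n)
  have IJ: "ideal (set_add R I J) R" using I J by (rule add_ideals)
  have zc: "z \<in> carrier R" using ideal_closed(2)[OF ideal_pow_ideal[OF IJ] Suc.prems(4)] .
  show ?case
  proof (cases "a = 0 \<or> b = 0")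
    case True
    \<comment> \<open>The power with exponent 0 is the whole ring, so it contains 1.\<close>
    then have "w \<otimes> \<one> \<in> K" using Suc.prems(2,3) by auto
    then show ?thesis using ideal_closed(6)[OF K _ zc] Suc.prems(1) by simp
  next
    case False
    then obtain a' b' where ab: "a = Suc a'" "b = Suc b'" by (metis not0_implies_Suc)
    then have n: "n = a' + b" "n = a + b'" using Suc.hyps(2) by simp_all
    have "z \<in> ideal_prod R (set_add R I J) (ideal_pow R (set_add R I J) n)"
      using Suc.prems(4) Suc.hyps(2)[symmetric] by simp
    then have "z \<in> carrier R \<and> w \<otimes> z \<in> K"
    proof induction
      case (prod i j)
      then obtain i1 i2 where i: "i1 \<in> I" "i2 \<in> J" "i = i1 \<oplus> i2"
        by (auto simp: set_add_def set_mult_def)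
      have c: "i1 \<in> carrier R" "i2 \<in> carrier R" "j \<in> carrier R"
        using i ideal_closed(2)[OF I] ideal_closed(2)[OF J] prod(2)
          ideal_closed(2)[OF ideal_pow_ideal[OF IJ]] by auto
      have "(w \<otimes> i1) \<otimes> j \<in> K"
      proof (rule Suc.hyps(1)[OF n(1)])
        show "\<forall>z\<in>ideal_pow R I a'. w \<otimes> i1 \<otimes> z \<in> K"
        proof
          fix z assume z: "z \<in> ideal_pow R I a'"
          have "i1 \<otimes> z \<in> ideal_pow R I a" using z i(1) by (simp add: ab ideal_prod.prod)
          moreover have "z \<in> carrier R" using ideal_closed(2)[OF ideal_pow_ideal[OF I] z] .
          ultimately show "w \<otimes> i1 \<otimes> z \<in> K" using Suc.prems(1,2) c by (simp add: m_assoc)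
        qed
        show "\<forall>z\<in>ideal_pow R J b. w \<otimes> i1 \<otimes> z \<in> K"
        proof
          fix z assume z: "z \<in> ideal_pow R J b"
          have "z \<in> carrier R" using ideal_closed(2)[OF ideal_pow_ideal[OF J] z] .
          then have "w \<otimes> i1 \<otimes> z = i1 \<otimes> (w \<otimes> z)" using Suc.prems(1) c by (simp add: m_ac)
          then show "w \<otimes> i1 \<otimes> z \<in> K" using ideal_closed(5)[OF K _ c(1)] Suc.prems(3) z by simp
        qed
        show "j \<in> ideal_pow R (set_add R I J) (a' + b)" using prod(2) n by simp
      qed (use Suc.prems(1) c in simp)
      moreover have "(w \<otimes> i2) \<otimes> j \<in> K"
      proof (rule Suc.hyps(1)[OF n(2)])
        show "\<forall>z\<in>ideal_pow R J b'. w \<otimes> i2 \<otimes> z \<in> K"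
        proof
          fix z assume z: "z \<in> ideal_pow R J b'"
          have "i2 \<otimes> z \<in> ideal_pow R J b" using z i(2) by (simp add: ab ideal_prod.prod)
          moreover have "z \<in> carrier R" using ideal_closed(2)[OF ideal_pow_ideal[OF J] z] .
          ultimately show "w \<otimes> i2 \<otimes> z \<in> K" using Suc.prems(1,3) c by (simp add: m_assoc)
        qed
        show "\<forall>z\<in>ideal_pow R I a. w \<otimes> i2 \<otimes> z \<in> K"
        proof
          fix z assume z: "z \<in> ideal_pow R I a"
          have "z \<in> carrier R" using ideal_closed(2)[OF ideal_pow_ideal[OF I] z] .
          then have "w \<otimes> i2 \<otimes> z = i2 \<otimes> (w \<otimes> z)" using Suc.prems(1) c by (simp add: m_ac)
          then show "w \<otimes> i2 \<otimes> z \<in> K" using ideal_closed(5)[OF K _ c(2)] Suc.prems(2) z by simp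
        qed
        show "j \<in> ideal_pow R (set_add R I J) (a + b')" using prod(2) n by simp
      qed (use Suc.prems(1) c in simp)
      ultimately have "(w \<otimes> i1) \<otimes> j \<oplus> (w \<otimes> i2) \<otimes> j \<in> K" by (rule ideal_closed(3)[OF K])
      then show ?case using c Suc.prems(1) i(3) by (simp add: l_distr r_distr m_assoc)
    next
      case (sum s t)
      then show ?case using Suc.prems(1) ideal_closed(3)[OF K] by (simp add: r_distr)
    qed
    then show ?thesis ..
  qed
qed

lemma (in cring) ideal_pow_cgenideal_subset:
  assumes x: "x \<in> carrier R" and K: "ideal K R" "x [^] (m::nat) \<in> K"
  shows "ideal_pow R (PIdl x) m \<subseteq> K"
proof -
  have "ideal_pow R (PIdl x) m \<subseteq> {r \<otimes> x [^] m | r. r \<in> carrier R}"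
  proof (induction m)
    case 0
    then show ?case by force
  next
    case (Suc m)
    show ?case
    proof
      fix y assume "y \<in> ideal_pow R (PIdl x) (Suc m)"
      then have "y \<in> ideal_prod R (PIdl x) (ideal_pow R (PIdl x) m)" by simp
      then show "y \<in> {r \<otimes> x [^] Suc m | r. r \<in> carrier R}"
      proof induction
        case (prod i j)
        then obtain r s where rs: "r \<in> carrier R" "s \<in> carrier R" "i = r \<otimes> x" "j = s \<otimes> x [^] m"
          using Suc by (auto simp: cgenideal_def)
        then have "i \<otimes> j = (r \<otimes> s) \<otimes> x [^] Suc m" using x by (simp add: m_ac)
        then show ?case using rs by blast
      next
        case (sum s t)
        then obtain p q where "p \<in> carrier R" "q \<in> carrier R" "s = p \<otimes> x [^] Suc m" "t = q \<otimes> x [^] Suc m"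
          by blast
        then have "s \<oplus> t = (p \<oplus> q) \<otimes> x [^] Suc m" "p \<oplus> q \<in> carrier R" using x by (simp_all add: l_distr)
        then show ?case by blast
      qed
    qed
  qed
  then show ?thesis using ideal_closed(5)[OF K] by auto
qed

text \<open>If x^m lies in \<open>K\<close> and so does the n-th power of the ideal generated by
  \<open>X\<close>, then the exponent m + n works for the ideal generated by \<open>X\<close> and x
  together.\<close>

lemma (in cring) ideal_pow_genideal_subset:
  assumes "finite X" "X \<subseteq> carrier R" and K: "ideal K R"
    and "\<And>x. x \<in> X \<Longrightarrow> \<exists>m::nat. x [^] m \<in> K"
  shows "\<exists>n. ideal_pow R (Idl X) n \<subseteq> K"
  using assms(1,2,4)
proof (induction X)
  case empty
  have "ideal (Idl {}) R" by (rule genideal_ideal) simp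
  \<comment> \<open>Exponent 1 and not 0, because even for the zero ideal the power with exponent 0
    is the whole ring.\<close>
  then have "ideal_pow R (Idl {}) (Suc 0) \<subseteq> Idl {}"
    using ideal_prod_inter[of "Idl {}" "carrier R"] oneideal by auto
  also have "\<dots> \<subseteq> K" by (rule genideal_minimal[OF K]) simp
  finally show ?case ..
next
  case (insert x X)
  then obtain n where n: "ideal_pow R (Idl X) n \<subseteq> K" by auto
  have x: "x \<in> carrier R" and X: "X \<subseteq> carrier R" using insert.prems(1) by auto
  obtain m :: nat where m: "x [^] m \<in> K" using insert.prems(2) by auto
  have id: "ideal (PIdl x) R" "ideal (Idl X) R"
    using x X by (simp_all add: cgenideal_ideal genideal_ideal)
  have S: "ideal (set_add R (PIdl x) (Idl X)) R" by (rule add_ideals[OF id])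
  have "insert x X \<subseteq> set_add R (PIdl x) (Idl X)"
  proof -
    have "x \<in> set_add R (PIdl x) (Idl X)"
      using cgenideal_self[OF x] ideal_closed(1)[OF id(2)] x
      by (force simp: set_add_def set_mult_def)
    moreover have "y \<in> set_add R (PIdl x) (Idl X)" if "y \<in> X" for y
      using genideal_self[OF X] ideal_closed(1)[OF id(1)] that X
      by (force simp: set_add_def set_mult_def)
    ultimately show ?thesis by auto
  qed
  then have "Idl (insert x X) \<subseteq> set_add R (PIdl x) (Idl X)" by (rule genideal_minimal[OF S])
  moreover have "ideal_pow R (set_add R (PIdl x) (Idl X)) (m + n) \<subseteq> K"
  proof
    fix z assume z: "z \<in> ideal_pow R (set_add R (PIdl x) (Idl X)) (m + n)"
    have "\<one> \<otimes> z \<in> K"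
      by (rule mult_ideal_pow_add[OF K id _ _ _ z])
        (use ideal_pow_cgenideal_subset[OF x K m] n ideal_closed(2)[OF ideal_pow_ideal[OF id(1)]]
          ideal_closed(2)[OF ideal_pow_ideal[OF id(2)]] in auto)
    then show "z \<in> K" using ideal_closed(2)[OF ideal_pow_ideal[OF S] z] by simp
  qed
  ultimately show ?case using ideal_pow_mono by blast
qed

text \<open>Choose \<open>K\<close> maximal among the ideals that meet \<open>M\<close> exactly in I
  M. Maximality forces some power of each x in \<open>I\<close> into \<open>K\<close>. As
  \<open>I\<close> is finitely generated, a power of \<open>I\<close> lies in \<open>K\<close>, and
  intersecting with \<open>M\<close> gives the claim.\<close>

theorem artin_rees:
  fixes R (structure)
  assumes "noetherian_ring R" "cring R" and I: "ideal I R" and M: "ideal M R"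
  shows "\<exists>n. ideal_pow R I n \<inter> M \<subseteq> ideal_prod R I M"
proof -
  interpret noetherian_ring R by fact
  interpret cring R by fact
  let ?IM = "ideal_prod R I M"
  have IM: "ideal ?IM R" "?IM \<subseteq> M"
    using ideal_prod_is_ideal[OF I M] ideal_prod_inter[OF I M] by auto
  let ?F = "{K. ideal K R \<and> K \<inter> M = ?IM}"
  have "?IM \<in> ?F" using IM by auto
  then have "\<exists>K\<in>?F. \<forall>L\<in>?F. K \<subseteq> L \<longrightarrow> L = K"
    by (intro exists_maximal_ideal_in) auto
  then obtain K where K: "ideal K R" "K \<inter> M = ?IM"
    and max: "\<And>L. ideal L R \<Longrightarrow> L \<inter> M = ?IM \<Longrightarrow> K \<subseteq> L \<Longrightarrow> L = K"
    by auto
  have "\<exists>m::nat. x [^] m \<in> K" if x: "x \<in> I" for x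
  proof -
    have xc: "x \<in> carrier R" using ideal_closed(2)[OF I x] .
    \<comment> \<open>The colon ideals (K : x^m). They ascend with m, and at a stable index m the
      ideal (x^m) + K still meets \<open>M\<close> in I M, so it equals \<open>K\<close> by
      maximality.\<close>
    define Q where "Q m = {f \<in> carrier R. f \<otimes> x [^] m \<in> K}" for m :: nat
    have Q: "ideal (Q m) R" for m
      by (rule cring_idealI)
        (auto simp: Q_def ideal_closed[OF K(1)] l_distr m_assoc xc is_cring)
    obtain m where m: "Q (Suc m) = Q m"
    proof -
      have "\<exists>M\<in>range Q. \<forall>I\<in>range Q. M \<subseteq> I \<longrightarrow> I = M"
        by (rule exists_maximal_ideal_in) (use Q in auto)
      then obtain m where m: "\<And>n. Q m \<subseteq> Q n \<Longrightarrow> Q n = Q m" by auto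
      have "Q m \<subseteq> Q (Suc m)"
      proof
        fix f assume "f \<in> Q m"
        then have f: "f \<in> carrier R" "f \<otimes> x [^] m \<in> K" by (auto simp: Q_def)
        then show "f \<in> Q (Suc m)"
          using ideal_closed(6)[OF K(1) f(2) xc] xc by (simp add: Q_def m_assoc)
      qed
      then show ?thesis using m that by blast
    qed
    let ?L = "set_add R (PIdl (x [^] m)) K"
    have P: "ideal (PIdl (x [^] m)) R" using xc by (simp add: cgenideal_ideal)
    have L: "ideal ?L R" by (rule add_ideals[OF P K(1)])
    have KL: "K \<subseteq> ?L"
    proof
      fix k assume k: "k \<in> K"
      then show "k \<in> ?L"
        using set_addI[OF ideal_closed(1)[OF P] k, of R] ideal_closed(2)[OF K(1)] by simp
    qed
    \<comment> \<open>For y = r x^m + k in \<open>M\<close>, the product x y lies in I M, hence in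
      \<open>K\<close>. Therefore r x^(m+1) lies in \<open>K\<close>, and by stability so does r
      x^m.\<close>
    have "y \<in> ?IM" if y: "y \<in> ?L" "y \<in> M" for y
    proof -
      obtain r k where r: "r \<in> carrier R" and k: "k \<in> K" and ye: "y = r \<otimes> x [^] m \<oplus> k"
        using y(1) by (auto simp: set_add_def set_mult_def cgenideal_def)
      have kc: "k \<in> carrier R" using ideal_closed(2)[OF K(1) k] .
      have "x \<otimes> y \<in> K" using ideal_prod.prod[OF x y(2), of R] K(2) by auto
      then have "x \<otimes> y \<ominus> x \<otimes> k \<in> K" by (rule ideal_closed(4)[OF K(1) _ ideal_closed(5)[OF K(1) k xc]])
      moreover have "x \<otimes> y \<ominus> x \<otimes> k = r \<otimes> x [^] Suc m"
        using r kc xc by (simp add: ye r_distr m_ac minus_eq a_assoc r_neg)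
      ultimately have "r \<in> Q (Suc m)" using r by (simp add: Q_def)
      then have "r \<otimes> x [^] m \<in> K" unfolding m by (simp add: Q_def)
      then have "y \<in> K" unfolding ye using k by (rule ideal_closed(3)[OF K(1)])
      then show ?thesis using y(2) K(2) by auto
    qed
    then have "?L \<inter> M = ?IM" using K(2) KL by auto
    then have "?L = K" by (rule max[OF L _ KL])
    moreover have "x [^] m \<in> ?L"
    proof -
      have "x [^] m \<in> PIdl (x [^] m)" using cgenideal_self xc by simp
      from set_addI[OF this ideal_closed(1)[OF K(1)], of R] show ?thesis using xc by simp
    qed
    ultimately show ?thesis by auto
  qed
  moreover obtain X where X: "X \<subseteq> carrier R" "finite X" "I = Idl X"
    using finetely_gen[OF I] by auto
  ultimately obtain n where "ideal_pow R I n \<subseteq> K"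
    using ideal_pow_genideal_subset[OF X(2,1) K(1)] genideal_self[OF X(1)] by auto
  then show ?thesis using K(2) by blast
qed

section \<open>The equational criterion of flatness\<close>

lemma (in abelian_monoid) finsum_swap:
  assumes "finite X" "finite Y" "\<And>i j. i \<in> X \<Longrightarrow> j \<in> Y \<Longrightarrow> f i j \<in> carrier G"
  shows "(\<Oplus>i\<in>X. \<Oplus>j\<in>Y. f i j) = (\<Oplus>j\<in>Y. \<Oplus>i\<in>X. f i j)"
  using assms(1,3)
proof (induction X)
  case empty
  then show ?case by (simp add: finsum_zero)
next
  case (insert x X)
  have "(\<Oplus>i\<in>insert x X. \<Oplus>j\<in>Y. f i j) = (\<Oplus>j\<in>Y. f x j) \<oplus> (\<Oplus>j\<in>Y. \<Oplus>i\<in>X. f i j)"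
    using insert by (simp add: Pi_def)
  also have "\<dots> = (\<Oplus>j\<in>Y. f x j \<oplus> (\<Oplus>i\<in>X. f i j))"
    using insert.prems by (intro finsum_addf[symmetric]) (auto simp: Pi_def)
  also have "\<dots> = (\<Oplus>j\<in>Y. \<Oplus>i\<in>insert x X. f i j)"
    using insert by (intro finsum_cong') (auto simp: Pi_def)
  finally show ?case .
qed

lemma (in module) finsum_smult_rdistr:
  assumes "finite X" "f \<in> X \<rightarrow> carrier R" "y \<in> carrier M"
  shows "(\<Oplus>\<^bsub>R\<^esub>i\<in>X. f i) \<odot>\<^bsub>M\<^esub> y = (\<Oplus>\<^bsub>M\<^esub>i\<in>X. f i \<odot>\<^bsub>M\<^esub> y)"
  using assms
proof (induction X)
  case (insert x X)
  then show ?case by (simp add: smult_l_distr Pi_def)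
qed simp

text \<open>Generation by zero and the vectors \<open>(c i \<odot> y)\<close> says that \<open>b i = (\<Sum>j. c j i \<odot> y j)\<close> for finitely
  many solutions \<open>c j\<close> over \<open>A\<close> of the equations in \<open>Rel\<close>; inductively, no matrices are needed.\<close>

inductive trivial_relation ::
    "('a, 'k) ring_scheme \<Rightarrow> ('a, 'e, 'l) module_scheme \<Rightarrow> 'i set \<Rightarrow> ('i \<Rightarrow> 'a) set \<Rightarrow> ('i \<Rightarrow> 'e) \<Rightarrow> bool"
  for A E X Rel where
    zero: "(\<And>i. i \<in> X \<Longrightarrow> b i = \<zero>\<^bsub>E\<^esub>) \<Longrightarrow> trivial_relation A E X Rel b"
  | step: "trivial_relation A E X Rel b \<Longrightarrow> c \<in> X \<rightarrow> carrier A \<Longrightarrow> y \<in> carrier E \<Longrightarrow>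
      (\<And>a. a \<in> Rel \<Longrightarrow> (\<Oplus>\<^bsub>A\<^esub>i\<in>X. a i \<otimes>\<^bsub>A\<^esub> c i) = \<zero>\<^bsub>A\<^esub>) \<Longrightarrow>
      (\<And>i. i \<in> X \<Longrightarrow> b' i = c i \<odot>\<^bsub>E\<^esub> y \<oplus>\<^bsub>E\<^esub> b i) \<Longrightarrow> trivial_relation A E X Rel b'"

text \<open>Only single relations are tested; finite systems follow in
  \<open>equationally_flat_system\<close>. Indexing by initial segments of the natural numbers
  avoids a type parameter for index sets.\<close>

definition equationally_flat :: "('a, 'k) ring_scheme \<Rightarrow> ('a, 'e, 'l) module_scheme \<Rightarrow> bool"
  where "equationally_flat A E \<longleftrightarrow> (\<forall>(n::nat) a b.
    a \<in> {..<n} \<rightarrow> carrier A \<and> b \<in> {..<n} \<rightarrow> carrier E \<and> (\<Oplus>\<^bsub>E\<^esub>i\<in>{..<n}. a i \<odot>\<^bsub>E\<^esub> b i) = \<zero>\<^bsub>E\<^esub> \<longrightarrow>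
    trivial_relation A E {..<n} {a} b)"

section \<open>Closure properties of trivial relations\<close>

lemma trivial_relation_closed:
  assumes "module A E" "trivial_relation A E X Rel b" "i \<in> X"
  shows "b i \<in> carrier E"
proof -
  interpret module A E by fact
  show ?thesis using assms(2,3) by induction (auto simp: Pi_def)
qed

lemma trivial_relation_cong:
  assumes "module A E" "trivial_relation A E X Rel b" "\<And>i. i \<in> X \<Longrightarrow> b' i = b i"
  shows "trivial_relation A E X Rel b'"
proof -
  interpret module A E by fact
  from assms(2) show ?thesis
  proof cases
    case zero
    then show ?thesis using assms(3) by (intro trivial_relation.zero) simp
  next
    case (step b c y)
    show ?thesis
      by (rule trivial_relation.step[OF step(1-3)]) (use step(4,5) assms(3) in auto)
  qed
qed

lemma trivial_relation_add:
  assumes "module A E" "trivial_relation A E X Rel b" "trivial_relation A E X Rel b'"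
  shows "trivial_relation A E X Rel (\<lambda>i. b i \<oplus>\<^bsub>E\<^esub> b' i)"
proof -
  interpret module A E by fact
  note cl = trivial_relation_closed[OF assms(1)]
  from assms(2) show ?thesis
  proof induction
    case (zero b)
    show ?case
      by (rule trivial_relation_cong[OF assms(1,3)]) (simp add: zero cl[OF assms(3)])
  next
    case (step b c y b'')
    show ?case
    proof (rule trivial_relation.step[OF step.IH step.hyps(2-4)])
      fix i assume i: "i \<in> X"
      have "c i \<odot>\<^bsub>E\<^esub> y \<in> carrier E" using step.hyps(2,3) i by auto
      then show "b'' i \<oplus>\<^bsub>E\<^esub> b' i = c i \<odot>\<^bsub>E\<^esub> y \<oplus>\<^bsub>E\<^esub> (b i \<oplus>\<^bsub>E\<^esub> b' i)"
        using cl[OF assms(3) i] cl[OF step.hyps(1) i] by (simp add: step.hyps(5)[OF i] M.a_assoc)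
    qed
  qed
qed

lemma linear_mapsD:
  assumes "f \<in> linear_maps A M N"
  shows "x \<in> carrier M \<Longrightarrow> f x \<in> carrier N"
    and "x \<in> carrier M \<Longrightarrow> y \<in> carrier M \<Longrightarrow> f (x \<oplus>\<^bsub>M\<^esub> y) = f x \<oplus>\<^bsub>N\<^esub> f y"
    and "a \<in> carrier A \<Longrightarrow> x \<in> carrier M \<Longrightarrow> f (a \<odot>\<^bsub>M\<^esub> x) = a \<odot>\<^bsub>N\<^esub> f x"
  using assms by (auto simp: linear_maps_def)

lemma linear_maps_zero:
  assumes "module A M" "module A N" "f \<in> linear_maps A M N"
  shows "f \<zero>\<^bsub>M\<^esub> = \<zero>\<^bsub>N\<^esub>"
proof -
  interpret M: module A M by fact
  interpret N: module A N by fact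
  have "f (\<zero>\<^bsub>A\<^esub> \<odot>\<^bsub>M\<^esub> \<zero>\<^bsub>M\<^esub>) = \<zero>\<^bsub>A\<^esub> \<odot>\<^bsub>N\<^esub> f \<zero>\<^bsub>M\<^esub>"
    by (rule linear_mapsD(3)[OF assms(3)]) simp_all
  then show ?thesis using linear_mapsD(1)[OF assms(3)] by simp
qed

lemma linear_maps_finsum:
  assumes "module A M" "module A N" "f \<in> linear_maps A M N" "finite X" "b \<in> X \<rightarrow> carrier M"
  shows "f (\<Oplus>\<^bsub>M\<^esub>i\<in>X. b i) = (\<Oplus>\<^bsub>N\<^esub>i\<in>X. f (b i))"
proof -
  interpret M: module A M by fact
  interpret N: module A N by fact
  show ?thesis using assms(4,5)
    by (induction X) (auto simp: linear_maps_zero[OF assms(1-3)] linear_mapsD[OF assms(3)] Pi_def)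
qed

text \<open>The map moves only the vectors \<open>y\<close> and leaves the solutions
  \<open>c\<close> over \<open>A\<close> alone. In this way a relation trivialized in P becomes
  trivial in B.\<close>

lemma trivial_relation_linear_map:
  assumes "module A E" "module A F" "f \<in> linear_maps A E F" "trivial_relation A E X Rel b"
  shows "trivial_relation A F X Rel (\<lambda>i. f (b i))"
  using assms(4)
proof induction
  case (zero b)
  then show ?case by (intro trivial_relation.zero) (simp add: linear_maps_zero[OF assms(1-3)])
next
  case (step b c y b')
  interpret module A E by fact
  note f = linear_mapsD[OF assms(3)]
  have "f (c i \<odot>\<^bsub>E\<^esub> y \<oplus>\<^bsub>E\<^esub> b i) = c i \<odot>\<^bsub>F\<^esub> f y \<oplus>\<^bsub>F\<^esub> f (b i)" if "i \<in> X" for i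
    using that step.hyps(2,3) trivial_relation_closed[OF assms(1) step.hyps(1) that]
    by (simp add: f Pi_def)
  then show ?case
    using f(1)[OF step.hyps(3)] by (intro trivial_relation.step[OF step.IH step.hyps(2) _ step.hyps(4)]) (auto simp: step.hyps(5))
qed

text \<open>Trades the inductive form for an explicit matrix, as needed for the substitution in
  \<open>equationally_flat_system\<close>.\<close>

lemma trivial_relation_imp_sum:
  assumes "module A E" "trivial_relation A E X Rel b"
  shows "\<exists>(n::nat) c y. (\<forall>j<n. \<forall>i\<in>X. c j i \<in> carrier A) \<and> y \<in> {..<n} \<rightarrow> carrier E \<and>
    (\<forall>a\<in>Rel. \<forall>j<n. (\<Oplus>\<^bsub>A\<^esub>i\<in>X. a i \<otimes>\<^bsub>A\<^esub> c j i) = \<zero>\<^bsub>A\<^esub>) \<and>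
    (\<forall>i\<in>X. b i = (\<Oplus>\<^bsub>E\<^esub>j\<in>{..<n}. c j i \<odot>\<^bsub>E\<^esub> y j))"
    (is "\<exists>n c y. ?ok n c y b")
proof -
  interpret module A E by fact
  show ?thesis
    using assms(2)
  proof induction
    case (zero b)
    then have "?ok 0 (\<lambda>_ _. \<zero>\<^bsub>A\<^esub>) (\<lambda>_. \<zero>\<^bsub>E\<^esub>) b" by simp
    then show ?case by (intro exI)
  next
    case (step b c0 y0 b')
    from step.IH obtain n c y where *: "?ok n c y b" by (elim exE) rule
    have c: "\<And>j i. j < n \<Longrightarrow> i \<in> X \<Longrightarrow> c j i \<in> carrier A" using * by blast
    have y: "\<And>j. j < n \<Longrightarrow> y j \<in> carrier E" using * by auto
    have c0: "\<And>i. i \<in> X \<Longrightarrow> c0 i \<in> carrier A" using step.hyps(2) by auto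
    \<comment> \<open>The new solution and its vector are stored at the first free index
      \<open>n\<close>.\<close>
    let ?c = "c(n := c0)" and ?y = "y(n := y0)"
    have "b' i = (\<Oplus>\<^bsub>E\<^esub>j\<in>{..<Suc n}. ?c j i \<odot>\<^bsub>E\<^esub> ?y j)" if i: "i \<in> X" for i
    proof -
      have "(\<Oplus>\<^bsub>E\<^esub>j\<in>{..<n}. ?c j i \<odot>\<^bsub>E\<^esub> ?y j) = (\<Oplus>\<^bsub>E\<^esub>j\<in>{..<n}. c j i \<odot>\<^bsub>E\<^esub> y j)"
        using c[OF _ i] y by (intro M.finsum_cong') auto
      moreover have "b i = (\<Oplus>\<^bsub>E\<^esub>j\<in>{..<n}. c j i \<odot>\<^bsub>E\<^esub> y j)" using * i by blast
      moreover have "(\<lambda>j. ?c j i \<odot>\<^bsub>E\<^esub> ?y j) \<in> {..<n} \<rightarrow> carrier E"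
        using c[OF _ i] y by (intro Pi_I) simp
      ultimately show ?thesis
        using c0[OF i] step.hyps(3) by (simp add: lessThan_Suc step.hyps(5)[OF i])
    qed
    moreover have "\<forall>a\<in>Rel. \<forall>j<Suc n. (\<Oplus>\<^bsub>A\<^esub>i\<in>X. a i \<otimes>\<^bsub>A\<^esub> ?c j i) = \<zero>\<^bsub>A\<^esub>"
      using * step.hyps(4) by (simp add: less_Suc_eq)
    moreover have "\<forall>j<Suc n. \<forall>i\<in>X. ?c j i \<in> carrier A" using c c0 by (simp add: less_Suc_eq)
    moreover have "?y \<in> {..<Suc n} \<rightarrow> carrier E" using y step.hyps(3) by (simp add: less_Suc_eq Pi_def)
    ultimately have "?ok (Suc n) ?c ?y b'" by blast
    then show ?case by (intro exI)
  qed
qed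

text \<open>In the absence of equations the unit vectors are admissible solutions, and
  \<open>b\<close> is the sum over j of the j-th unit vector scaled into \<open>b j\<close>.\<close>

lemma trivial_relation_empty:
  assumes "module A E" "finite X" "b \<in> X \<rightarrow> carrier E"
  shows "trivial_relation A E X {} b"
proof -
  interpret module A E by fact
  have "trivial_relation A E X {} (\<lambda>i. if i \<in> Y then b i else \<zero>\<^bsub>E\<^esub>)" if "finite Y" "Y \<subseteq> X" for Y
    using that
  proof (induction Y)
    case empty
    then show ?case by (intro trivial_relation.zero) simp
  next
    case (insert j Y)
    then have IH: "trivial_relation A E X {} (\<lambda>i. if i \<in> Y then b i else \<zero>\<^bsub>E\<^esub>)" by simp
    have bj: "b j \<in> carrier E" using assms(3) insert.prems by auto
    let ?d = "\<lambda>i. if i = j then \<one>\<^bsub>A\<^esub> else \<zero>\<^bsub>A\<^esub>"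
    show ?case
    proof (rule trivial_relation.step[OF IH _ bj])
      show "?d \<in> X \<rightarrow> carrier A" by simp
      fix i assume "i \<in> X"
      then have "b i \<in> carrier E" using assms(3) by auto
      then show "(if i \<in> insert j Y then b i else \<zero>\<^bsub>E\<^esub>)
          = ?d i \<odot>\<^bsub>E\<^esub> b j \<oplus>\<^bsub>E\<^esub> (if i \<in> Y then b i else \<zero>\<^bsub>E\<^esub>)"
        using insert.hyps(2) bj by simp
    qed simp
  qed
  from this[OF assms(2) order_refl] show ?thesis
    by (rule trivial_relation_cong[OF assms(1)]) simp
qed

text \<open>One equation is solved at a time. If b i = \<Sum>j. c j i \<odot> y j solves the earlier
  equations, the next one becomes a single relation among the \<open>y j\<close>. Trivializing it
  and substituting replaces the columns of \<open>c\<close> by combinations of themselves, which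
  therefore still satisfy the earlier equations.\<close>

theorem equationally_flat_system:
  assumes "module A E" and flat: "equationally_flat A E"
    and fin: "finite X" "finite Rel" and b: "b \<in> X \<rightarrow> carrier E"
    and Rel: "\<And>a. a \<in> Rel \<Longrightarrow> a \<in> X \<rightarrow> carrier A \<and> (\<Oplus>\<^bsub>E\<^esub>i\<in>X. a i \<odot>\<^bsub>E\<^esub> b i) = \<zero>\<^bsub>E\<^esub>"
  shows "trivial_relation A E X Rel b"
proof -
  interpret module A E by fact
  show ?thesis
    using fin(2) Rel
  proof (induction Rel)
    case empty
    show ?case by (rule trivial_relation_empty[OF assms(1) fin(1) b])
  next
    case (insert a Rel)
    then have "trivial_relation A E X Rel b" by simp
    from trivial_relation_imp_sum[OF assms(1) this]
    obtain n :: nat and c y where *: "\<forall>j<n. \<forall>i\<in>X. c j i \<in> carrier A" and y: "y \<in> {..<n} \<rightarrow> carrier E"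
      and **: "\<forall>a\<in>Rel. \<forall>j<n. (\<Oplus>\<^bsub>A\<^esub>i\<in>X. a i \<otimes>\<^bsub>A\<^esub> c j i) = \<zero>\<^bsub>A\<^esub>"
      and b_eq: "\<forall>i\<in>X. b i = (\<Oplus>\<^bsub>E\<^esub>j\<in>{..<n}. c j i \<odot>\<^bsub>E\<^esub> y j)"
      by (elim exE conjE) rule
    have c: "c j i \<in> carrier A" if "j < n" "i \<in> X" for j i using * that by blast
    have ker: "(\<Oplus>\<^bsub>A\<^esub>i\<in>X. a i \<otimes>\<^bsub>A\<^esub> c j i) = \<zero>\<^bsub>A\<^esub>" if "a \<in> Rel" "j < n" for a j using ** that by blast
    have a: "a i \<in> carrier A" if "i \<in> X" for i using insert.prems[of a] that by (auto simp: Pi_def)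
    have yc: "y j \<in> carrier E" if "j < n" for j using y that by auto
    \<comment> \<open>The coefficients of the new equation after the substitution of
      \<open>b\<close> by the \<open>y j\<close>.\<close>
    define \<alpha> where "\<alpha> j = (\<Oplus>\<^bsub>A\<^esub>i\<in>X. a i \<otimes>\<^bsub>A\<^esub> c j i)" for j
    have \<alpha>: "\<alpha> \<in> {..<n} \<rightarrow> carrier A"
      using a c by (auto simp: \<alpha>_def Pi_def)
    have "(\<Oplus>\<^bsub>E\<^esub>j\<in>{..<n}. \<alpha> j \<odot>\<^bsub>E\<^esub> y j) = (\<Oplus>\<^bsub>E\<^esub>j\<in>{..<n}. \<Oplus>\<^bsub>E\<^esub>i\<in>X. a i \<odot>\<^bsub>E\<^esub> (c j i \<odot>\<^bsub>E\<^esub> y j))"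
    proof (rule M.finsum_cong')
      fix j assume "j \<in> {..<n}"
      then show "\<alpha> j \<odot>\<^bsub>E\<^esub> y j = (\<Oplus>\<^bsub>E\<^esub>i\<in>X. a i \<odot>\<^bsub>E\<^esub> (c j i \<odot>\<^bsub>E\<^esub> y j))"
        unfolding \<alpha>_def using a c yc
        by (subst finsum_smult_rdistr[OF fin(1)])
          (auto simp: smult_assoc1 Pi_def intro!: M.finsum_cong')
    qed (use a c yc in \<open>auto simp: Pi_def\<close>)
    also have "\<dots> = (\<Oplus>\<^bsub>E\<^esub>i\<in>X. \<Oplus>\<^bsub>E\<^esub>j\<in>{..<n}. a i \<odot>\<^bsub>E\<^esub> (c j i \<odot>\<^bsub>E\<^esub> y j))"
      using a c yc fin(1) by (intro M.finsum_swap) auto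
    also have "\<dots> = (\<Oplus>\<^bsub>E\<^esub>i\<in>X. a i \<odot>\<^bsub>E\<^esub> b i)"
    proof (rule M.finsum_cong')
      fix i assume "i \<in> X"
      then show "(\<Oplus>\<^bsub>E\<^esub>j\<in>{..<n}. a i \<odot>\<^bsub>E\<^esub> (c j i \<odot>\<^bsub>E\<^esub> y j)) = a i \<odot>\<^bsub>E\<^esub> b i"
        using a c yc by (simp add: b_eq finsum_smult_ldistr Pi_def)
    qed (use a b in \<open>auto simp: Pi_def\<close>)
    also have "\<dots> = \<zero>\<^bsub>E\<^esub>" using insert.prems by auto
    finally have "trivial_relation A E {..<n} {\<alpha>} y"
      using flat \<alpha> y unfolding equationally_flat_def by blast
    then have "trivial_relation A E X (insert a Rel) (\<lambda>i. \<Oplus>\<^bsub>E\<^esub>j\<in>{..<n}. c j i \<odot>\<^bsub>E\<^esub> y j)"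
    proof induction
      case (zero y)
      have "(\<Oplus>\<^bsub>E\<^esub>j\<in>{..<n}. c j i \<odot>\<^bsub>E\<^esub> y j) = \<zero>\<^bsub>E\<^esub>" if "i \<in> X" for i
      proof -
        have "(\<Oplus>\<^bsub>E\<^esub>j\<in>{..<n}. c j i \<odot>\<^bsub>E\<^esub> y j) = (\<Oplus>\<^bsub>E\<^esub>j\<in>{..<n}. \<zero>\<^bsub>E\<^esub>)"
          using zero c that by (intro M.finsum_cong') auto
        then show ?thesis by (simp add: M.finsum_zero)
      qed
      then show ?case by (rule trivial_relation.zero)
    next
      case (step y d z y')
      have d: "d j \<in> carrier A" if "j < n" for j using step.hyps(2) that by auto
      have yc: "y j \<in> carrier E" if "j < n" for j
        using trivial_relation_closed[OF assms(1) step.hyps(1)] that by auto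
      \<comment> \<open>The product of the matrix \<open>c\<close> with the solution
        \<open>d\<close> of the relation \<alpha>.\<close>
      let ?c = "\<lambda>i. \<Oplus>\<^bsub>A\<^esub>j\<in>{..<n}. c j i \<otimes>\<^bsub>A\<^esub> d j"
      show ?case
      proof (rule trivial_relation.step[OF step.IH])
        show "?c \<in> X \<rightarrow> carrier A" using c d by (auto simp: Pi_def)
        show "z \<in> carrier E" by fact
        fix i assume i: "i \<in> X"
        have "(\<Oplus>\<^bsub>E\<^esub>j\<in>{..<n}. c j i \<odot>\<^bsub>E\<^esub> y' j)
          = (\<Oplus>\<^bsub>E\<^esub>j\<in>{..<n}. (c j i \<otimes>\<^bsub>A\<^esub> d j) \<odot>\<^bsub>E\<^esub> z \<oplus>\<^bsub>E\<^esub> c j i \<odot>\<^bsub>E\<^esub> y j)"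
          using c[OF _ i] d yc step.hyps(3)
          by (intro M.finsum_cong') (auto simp: step.hyps(5) smult_r_distr smult_assoc1)
        also have "\<dots> = ?c i \<odot>\<^bsub>E\<^esub> z \<oplus>\<^bsub>E\<^esub> (\<Oplus>\<^bsub>E\<^esub>j\<in>{..<n}. c j i \<odot>\<^bsub>E\<^esub> y j)"
          using c[OF _ i] d yc step.hyps(3)
          by (subst M.finsum_addf) (auto simp: finsum_smult_rdistr Pi_def)
        finally show "(\<Oplus>\<^bsub>E\<^esub>j\<in>{..<n}. c j i \<odot>\<^bsub>E\<^esub> y' j) = \<dots>" .
      next
        fix r assume r: "r \<in> insert a Rel"
        have rc: "r i \<in> carrier A" if "i \<in> X" for i
          using insert.prems[OF r] that by auto
        \<comment> \<open>Old equations annihilate each column \<open>c j\<close>, and the new one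
          turns it into \<open>\<alpha> j\<close>, which \<open>d\<close> then annihilates.\<close>
        have s: "(\<Oplus>\<^bsub>A\<^esub>i\<in>X. r i \<otimes>\<^bsub>A\<^esub> c j i) = (if r = a then \<alpha> j else \<zero>\<^bsub>A\<^esub>)" if "j < n" for j
          using r ker[OF _ that] by (auto simp: \<alpha>_def)
        have "(\<Oplus>\<^bsub>A\<^esub>i\<in>X. r i \<otimes>\<^bsub>A\<^esub> ?c i) = (\<Oplus>\<^bsub>A\<^esub>i\<in>X. \<Oplus>\<^bsub>A\<^esub>j\<in>{..<n}. r i \<otimes>\<^bsub>A\<^esub> c j i \<otimes>\<^bsub>A\<^esub> d j)"
          using rc c d by (intro R.finsum_cong') (auto simp: R.finsum_rdistr R.m_assoc Pi_def intro!: R.finsum_cong')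
        also have "\<dots> = (\<Oplus>\<^bsub>A\<^esub>j\<in>{..<n}. \<Oplus>\<^bsub>A\<^esub>i\<in>X. r i \<otimes>\<^bsub>A\<^esub> c j i \<otimes>\<^bsub>A\<^esub> d j)"
          using rc c d fin(1) by (intro R.finsum_swap) auto
        also have "\<dots> = (\<Oplus>\<^bsub>A\<^esub>j\<in>{..<n}. (if r = a then \<alpha> j else \<zero>\<^bsub>A\<^esub>) \<otimes>\<^bsub>A\<^esub> d j)"
          using rc c d fin(1) \<alpha>
          by (intro R.finsum_cong') (auto simp: R.finsum_ldistr[symmetric] s Pi_def)
        also have "\<dots> = \<zero>\<^bsub>A\<^esub>"
        proof (cases "r = a")
          case True
          then show ?thesis using step.hyps(4)[of \<alpha>] by simp
        next
          case False
          have "(\<Oplus>\<^bsub>A\<^esub>j\<in>{..<n}. (if r = a then \<alpha> j else \<zero>\<^bsub>A\<^esub>) \<otimes>\<^bsub>A\<^esub> d j) = (\<Oplus>\<^bsub>A\<^esub>j\<in>{..<n}. \<zero>\<^bsub>A\<^esub>)"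
            using False d by (intro R.finsum_cong') auto
          then show ?thesis by (simp add: R.finsum_zero)
        qed
        finally show "(\<Oplus>\<^bsub>A\<^esub>i\<in>X. r i \<otimes>\<^bsub>A\<^esub> ?c i) = \<zero>\<^bsub>A\<^esub>" .
      qed
    qed
    then show ?case by (rule trivial_relation_cong[OF assms(1)]) (use b_eq in blast)
  qed
qed

section \<open>From the equational criterion to tensor products\<close>

lemma hom_free_Abelian_group_diff:
  assumes "abelian_group N" and h: "h \<in> hom (free_Abelian_group S) (add_monoid N)"
  shows "Poly_Mapping.keys p \<subseteq> S \<Longrightarrow> Poly_Mapping.keys q \<subseteq> S \<Longrightarrow> h (p - q) = h p \<ominus>\<^bsub>N\<^esub> h q"
    and "Poly_Mapping.keys p \<subseteq> S \<Longrightarrow> h p \<in> carrier N" and "h 0 = \<zero>\<^bsub>N\<^esub>"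
    and "Poly_Mapping.keys p \<subseteq> S \<Longrightarrow> Poly_Mapping.keys q \<subseteq> S \<Longrightarrow> h (p + q) = h p \<oplus>\<^bsub>N\<^esub> h q"
    and "Poly_Mapping.keys p \<subseteq> S \<Longrightarrow> h (- p) = \<ominus>\<^bsub>N\<^esub> h p"
proof -
  interpret abelian_group N by fact
  interpret h: group_hom "free_Abelian_group S" "add_monoid N" h
    using h a_group by (simp add: group_hom_def group_hom_axioms_def)
  show add: "h (p + q) = h p \<oplus>\<^bsub>N\<^esub> h q" if "Poly_Mapping.keys p \<subseteq> S" "Poly_Mapping.keys q \<subseteq> S" for p q
    using h.hom_mult[of p q] that by simp
  show minus: "h (- p) = \<ominus>\<^bsub>N\<^esub> h p" if "Poly_Mapping.keys p \<subseteq> S" for p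
    using h.hom_inv[of p] that by (simp add: a_inv_def)
  show "h 0 = \<zero>\<^bsub>N\<^esub>" using h.hom_one by simp
  show "h p \<in> carrier N" if "Poly_Mapping.keys p \<subseteq> S"
    using h.hom_closed[of p] that by simp
  show "h (p - q) = h p \<ominus>\<^bsub>N\<^esub> h q" if "Poly_Mapping.keys p \<subseteq> S" "Poly_Mapping.keys q \<subseteq> S"
    using add[of p "- q"] minus[of q] that by (simp add: a_minus_def)
qed

lemma tensor_kernel_subgroup:
  assumes "module A M" "module A E"
  shows "subgroup (tensor_kernel A M E) (free_Abelian_group (carrier M \<times> carrier E))"
  unfolding tensor_kernel_def
  by (rule group.generate_is_subgroup) (auto dest: tensor_relations_carrier[OF assms])

lemma tensor_kernel_keys:
  assumes "module A M" "module A E" "p \<in> tensor_kernel A M E"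
  shows "Poly_Mapping.keys p \<subseteq> carrier M \<times> carrier E"
  using subgroup.mem_carrier[OF tensor_kernel_subgroup[OF assms(1,2)] assms(3)] by simp

lemma tensor_kernel_closed:
  assumes "module A M" "module A E"
  shows "0 \<in> tensor_kernel A M E"
    and "p \<in> tensor_kernel A M E \<Longrightarrow> q \<in> tensor_kernel A M E \<Longrightarrow> p + q \<in> tensor_kernel A M E"
    and "p \<in> tensor_kernel A M E \<Longrightarrow> - p \<in> tensor_kernel A M E"
    and "p \<in> tensor_kernel A M E \<Longrightarrow> q \<in> tensor_kernel A M E \<Longrightarrow> p - q \<in> tensor_kernel A M E"
proof -
  note sub = tensor_kernel_subgroup[OF assms]
  show "0 \<in> tensor_kernel A M E" using subgroup.one_closed[OF sub] by simp
  show add: "p \<in> tensor_kernel A M E \<Longrightarrow> q \<in> tensor_kernel A M E \<Longrightarrow> p + q \<in> tensor_kernel A M E" for p q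
    using subgroup.m_closed[OF sub] by simp
  show minus: "p \<in> tensor_kernel A M E \<Longrightarrow> - p \<in> tensor_kernel A M E" for p
    using subgroup.m_inv_closed[OF sub, of p] tensor_kernel_keys[OF assms] by simp
  show "p \<in> tensor_kernel A M E \<Longrightarrow> q \<in> tensor_kernel A M E \<Longrightarrow> p - q \<in> tensor_kernel A M E"
    using add[of p "- q"] minus[of q] by simp
qed

text \<open>Only finitely many linear relations among elements of \<open>E\<close> enter the proof that an element
  of \<open>N \<otimes> E\<close> vanishes. A map \<open>\<beta> : E \<rightarrow> A\<close> that respects just these still kills the element
  under \<open>n \<otimes> y \<mapsto> \<beta> y \<odot> n\<close>.\<close>

lemma tensor_kernel_finite_witness:
  assumes N: "module A N" and E: "module A E" and d: "d \<in> tensor_kernel A N E"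
  shows "\<exists>P Q. finite P \<and> finite Q \<and> P \<subseteq> carrier E \<times> carrier E \<and> Q \<subseteq> carrier A \<times> carrier E \<and>
    (\<forall>\<beta> h. \<beta> \<in> carrier E \<rightarrow> carrier A \<longrightarrow>
      h \<in> hom (free_Abelian_group (carrier N \<times> carrier E)) (add_monoid N) \<longrightarrow>
      (\<forall>n\<in>carrier N. \<forall>y\<in>carrier E. h (frag_of (n, y)) = \<beta> y \<odot>\<^bsub>N\<^esub> n) \<longrightarrow>
      (\<forall>(y, y')\<in>P. \<beta> (y \<oplus>\<^bsub>E\<^esub> y') = \<beta> y \<oplus>\<^bsub>A\<^esub> \<beta> y') \<longrightarrow>
      (\<forall>(a, y)\<in>Q. \<beta> (a \<odot>\<^bsub>E\<^esub> y) = a \<otimes>\<^bsub>A\<^esub> \<beta> y) \<longrightarrow> h d = \<zero>\<^bsub>N\<^esub>)"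
    (is "\<exists>P Q. ?ok P Q d")
proof -
  interpret N: module A N by fact
  interpret E: module A E by fact
  let ?F = "free_Abelian_group (carrier N \<times> carrier E)"
  note hom = hom_free_Abelian_group_diff[OF N.M.abelian_group_axioms]
  have rel: "\<exists>P Q. ?ok P Q r" if r: "r \<in> tensor_relations A N E" for r
    using r
  proof (cases rule: tensor_relationsE)
    case (1 x x' y)
    have "?ok {} {} r"
    proof (intro conjI allI impI)
      fix \<beta> h assume \<beta>: "\<beta> \<in> carrier E \<rightarrow> carrier A" and h: "h \<in> hom ?F (add_monoid N)"
        and hb: "\<forall>n\<in>carrier N. \<forall>y\<in>carrier E. h (frag_of (n, y)) = \<beta> y \<odot>\<^bsub>N\<^esub> n"
      have c: "\<beta> y \<in> carrier A" using \<beta> 1 by auto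
      have k: "Poly_Mapping.keys (frag_of (x \<oplus>\<^bsub>N\<^esub> x', y) - frag_of (x, y)) \<subseteq> carrier N \<times> carrier E"
        using 1 by (intro order_trans[OF keys_diff]) auto
      show "h r = \<zero>\<^bsub>N\<^esub>"
        using 1 c k hb
        by (simp add: hom(1)[OF h] N.smult_r_distr N.M.minus_eq N.M.a_assoc N.M.a_comm[of "\<beta> y \<odot>\<^bsub>N\<^esub> x'"]
            N.M.r_neg N.M.l_neg N.M.r_neg1 N.M.r_neg2)
    qed auto
    then show ?thesis by blast
  next
    case (2 x y y')
    have "?ok {(y, y')} {} r"
    proof (intro conjI allI impI)
      fix \<beta> h assume \<beta>: "\<beta> \<in> carrier E \<rightarrow> carrier A" and h: "h \<in> hom ?F (add_monoid N)"
        and hb: "\<forall>n\<in>carrier N. \<forall>y\<in>carrier E. h (frag_of (n, y)) = \<beta> y \<odot>\<^bsub>N\<^esub> n"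
        and P: "\<forall>(y, y')\<in>{(y, y')}. \<beta> (y \<oplus>\<^bsub>E\<^esub> y') = \<beta> y \<oplus>\<^bsub>A\<^esub> \<beta> y'"
      have c: "\<beta> y \<in> carrier A" "\<beta> y' \<in> carrier A" using \<beta> 2 by auto
      have k: "Poly_Mapping.keys (frag_of (x, y \<oplus>\<^bsub>E\<^esub> y') - frag_of (x, y)) \<subseteq> carrier N \<times> carrier E"
        using 2 by (intro order_trans[OF keys_diff]) auto
      show "h r = \<zero>\<^bsub>N\<^esub>"
        using 2 c k hb P
        by (simp add: hom(1)[OF h] N.smult_l_distr N.M.minus_eq N.M.a_assoc N.M.a_comm[of "\<beta> y' \<odot>\<^bsub>N\<^esub> x"]
            N.M.r_neg N.M.l_neg N.M.r_neg1 N.M.r_neg2)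
    qed (use 2 in auto)
    then show ?thesis by blast
  next
    case (3 a x y)
    have "?ok {} {(a, y)} r"
    proof (intro conjI allI impI)
      fix \<beta> h assume \<beta>: "\<beta> \<in> carrier E \<rightarrow> carrier A" and h: "h \<in> hom ?F (add_monoid N)"
        and hb: "\<forall>n\<in>carrier N. \<forall>y\<in>carrier E. h (frag_of (n, y)) = \<beta> y \<odot>\<^bsub>N\<^esub> n"
        and Q: "\<forall>(a, y)\<in>{(a, y)}. \<beta> (a \<odot>\<^bsub>E\<^esub> y) = a \<otimes>\<^bsub>A\<^esub> \<beta> y"
      have c: "\<beta> y \<in> carrier A" using \<beta> 3 by auto
      show "h r = \<zero>\<^bsub>N\<^esub>"
        using 3 c hb Q
        by (simp add: hom(1)[OF h] N.smult_assoc1[symmetric] N.R.m_comm N.M.minus_eq N.M.r_neg)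
    qed (use 3 in auto)
    then show ?thesis by blast
  qed
  \<comment> \<open>All conditions on \<beta> and \<open>h\<close> in one predicate that becomes
    stronger as \<open>P\<close> and \<open>Q\<close> grow; hence unions of witnesses serve for
    sums.\<close>
  define compat where "compat P Q \<beta> h \<longleftrightarrow> \<beta> \<in> carrier E \<rightarrow> carrier A \<and> h \<in> hom ?F (add_monoid N) \<and>
      (\<forall>n\<in>carrier N. \<forall>y\<in>carrier E. h (frag_of (n, y)) = \<beta> y \<odot>\<^bsub>N\<^esub> n) \<and>
      (\<forall>(y, y')\<in>P. \<beta> (y \<oplus>\<^bsub>E\<^esub> y') = \<beta> y \<oplus>\<^bsub>A\<^esub> \<beta> y') \<and>
      (\<forall>(a, y)\<in>Q. \<beta> (a \<odot>\<^bsub>E\<^esub> y) = a \<otimes>\<^bsub>A\<^esub> \<beta> y)" for P Q \<beta> h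
  have ok_iff: "?ok P Q p \<longleftrightarrow> finite P \<and> finite Q \<and> P \<subseteq> carrier E \<times> carrier E \<and> Q \<subseteq> carrier A \<times> carrier E \<and>
      (\<forall>\<beta> h. compat P Q \<beta> h \<longrightarrow> h p = \<zero>\<^bsub>N\<^esub>)" for P Q p
    by (simp only: compat_def imp_conjL)
  have compat_hom: "h \<in> hom ?F (add_monoid N)" if "compat P Q \<beta> h" for P Q \<beta> h
    using that by (simp add: compat_def)
  have compat_Un: "compat P Q \<beta> h" "compat P' Q' \<beta> h" if "compat (P \<union> P') (Q \<union> Q') \<beta> h" for P Q P' Q' \<beta> h
    using that by (simp_all add: compat_def ball_Un)
  show ?thesis
    using d unfolding tensor_kernel_def
  proof (induction rule: generate.induct)
    case one
    have "?ok {} {} \<one>\<^bsub>?F\<^esub>" unfolding ok_iff using hom(3)[OF compat_hom] by simp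
    then show ?case by (intro exI)
  next
    case (incl r)
    then show ?case by (rule rel)
  next
    case (inv r)
    obtain P Q where 1: "?ok P Q r" using rel[OF inv] by (elim exE) rule
    have k: "Poly_Mapping.keys r \<subseteq> carrier N \<times> carrier E" by (rule tensor_relations_carrier[OF N E inv])
    have "h (- r) = \<zero>\<^bsub>N\<^esub>" if "compat P Q \<beta> h" for \<beta> h
    proof -
      have "h r = \<zero>\<^bsub>N\<^esub>" using 1 that unfolding ok_iff by blast
      then show ?thesis using hom(5)[OF compat_hom[OF that] k] by simp
    qed
    then have "?ok P Q (inv\<^bsub>?F\<^esub> r)" using 1 k unfolding ok_iff by simp
    then show ?case by (intro exI)
  next
    case (eng p q)
    obtain P Q where 1: "?ok P Q p" using eng.IH(1) by (elim exE) rule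
    obtain P' Q' where 2: "?ok P' Q' q" using eng.IH(2) by (elim exE) rule
    have k: "Poly_Mapping.keys p \<subseteq> carrier N \<times> carrier E" "Poly_Mapping.keys q \<subseteq> carrier N \<times> carrier E"
      using tensor_kernel_keys[OF N E] eng.hyps by (simp_all add: tensor_kernel_def)
    have "h (p + q) = \<zero>\<^bsub>N\<^esub>" if "compat (P \<union> P') (Q \<union> Q') \<beta> h" for \<beta> h
    proof -
      have "h p = \<zero>\<^bsub>N\<^esub>" "h q = \<zero>\<^bsub>N\<^esub>"
        using 1 2 compat_Un[OF that] unfolding ok_iff by blast+
      then show ?thesis using hom(4)[OF compat_hom[OF that] k] by simp
    qed
    then have "?ok (P \<union> P') (Q \<union> Q') (p \<otimes>\<^bsub>?F\<^esub> q)"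
      using 1 2 unfolding ok_iff by simp
    then show ?case by (intro exI)
  qed
qed

lemma frag_extend_in_tensor_kernel:
  assumes "module A M" "module A E" "\<And>x. x \<in> Poly_Mapping.keys c \<Longrightarrow> g x \<in> tensor_kernel A M E"
  shows "frag_extend g c \<in> tensor_kernel A M E"
  by (rule frag_induction[OF order_refl, where P = "\<lambda>c. frag_extend g c \<in> tensor_kernel A M E"])
    (simp_all add: assms(3) tensor_kernel_closed[OF assms(1,2)] frag_extend_diff)

text \<open>Additivity applied to 0 + 0 = 0 yields the negative of the desired generator.\<close>

lemma tensor_zero:
  assumes M: "module A M" and E: "module A E" and "m \<in> carrier M" "y \<in> carrier E"
  shows "frag_of (m, \<zero>\<^bsub>E\<^esub>) \<in> tensor_kernel A M E" "frag_of (\<zero>\<^bsub>M\<^esub>, y) \<in> tensor_kernel A M E"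
proof -
  interpret M: module A M by fact
  interpret E: module A E by fact
  have incl: "r \<in> tensor_kernel A M E" if "r \<in> tensor_relations A M E" for r
    using that by (simp add: tensor_kernel_def generate.incl)
  have "frag_of (m, \<zero>\<^bsub>E\<^esub> \<oplus>\<^bsub>E\<^esub> \<zero>\<^bsub>E\<^esub>) - frag_of (m, \<zero>\<^bsub>E\<^esub>) - frag_of (m, \<zero>\<^bsub>E\<^esub>) \<in> tensor_kernel A M E"
    "frag_of (\<zero>\<^bsub>M\<^esub> \<oplus>\<^bsub>M\<^esub> \<zero>\<^bsub>M\<^esub>, y) - frag_of (\<zero>\<^bsub>M\<^esub>, y) - frag_of (\<zero>\<^bsub>M\<^esub>, y) \<in> tensor_kernel A M E"
    using assms(3,4) by (intro incl tensor_relationsI; simp)+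
  then show "frag_of (m, \<zero>\<^bsub>E\<^esub>) \<in> tensor_kernel A M E" "frag_of (\<zero>\<^bsub>M\<^esub>, y) \<in> tensor_kernel A M E"
    using tensor_kernel_closed(3)[OF M E] by fastforce+
qed

text \<open>If the coefficients \<open>\<gamma>\<close> kill \<open>c\<close>, i.e. \<open>\<Sum> \<gamma> y \<odot> m = 0\<close> over the summands \<open>m \<otimes> y\<close> of \<open>c\<close>, then
  replacing each \<open>y\<close> by \<open>\<gamma> y \<odot> z\<close> turns \<open>c\<close> into \<open>0\<close>.\<close>

lemma trivial_relation_tensor:
  assumes M: "module A M" and E: "module A E"
    and c: "Poly_Mapping.keys c \<subseteq> carrier M \<times> carrier E" "snd ` Poly_Mapping.keys c \<subseteq> X"
    and kill: "\<And>\<gamma> h. \<gamma> \<in> X \<rightarrow> carrier A \<Longrightarrow> (\<And>a. a \<in> Rel \<Longrightarrow> (\<Oplus>\<^bsub>A\<^esub>i\<in>X. a i \<otimes>\<^bsub>A\<^esub> \<gamma> i) = \<zero>\<^bsub>A\<^esub>) \<Longrightarrow>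
      h \<in> hom (free_Abelian_group (carrier M \<times> X)) (add_monoid M) \<Longrightarrow>
      (\<And>m y. m \<in> carrier M \<Longrightarrow> y \<in> X \<Longrightarrow> h (frag_of (m, y)) = \<gamma> y \<odot>\<^bsub>M\<^esub> m) \<Longrightarrow> h c = \<zero>\<^bsub>M\<^esub>"
    and b: "trivial_relation A E X Rel b"
  shows "frag_extend (\<lambda>(m, y). frag_of (m, b y)) c \<in> tensor_kernel A M E"
  using b
proof induction
  case (zero b)
  have "(\<lambda>(m, y). frag_of (m, b y)) x \<in> tensor_kernel A M E" if x: "x \<in> Poly_Mapping.keys c" for x
  proof -
    have "fst x \<in> carrier M" "snd x \<in> carrier E" "snd x \<in> X" using x c by auto
    then show ?thesis using tensor_zero(1)[OF M E, of "fst x" "snd x"] zero[of "snd x"]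
      by (simp add: case_prod_beta)
  qed
  then show ?case by (rule frag_extend_in_tensor_kernel[OF M E])
next
  case (step b \<gamma> z b')
  interpret M: module A M by fact
  interpret E: module A E by fact
  note K = tensor_kernel_closed[OF M E]
  let ?K = "tensor_kernel A M E"
  have incl: "r \<in> ?K" if "r \<in> tensor_relations A M E" for r
    using that by (simp add: tensor_kernel_def generate.incl)
  have \<gamma>: "\<gamma> y \<in> carrier A" if "y \<in> X" for y using step.hyps(2) that by auto
  let ?g1 = "\<lambda>(m, y). frag_of (m, b' y)" and ?g2 = "\<lambda>(m, y). frag_of (m, b y)"
    and ?g3 = "\<lambda>(m, y). frag_of (\<gamma> y \<odot>\<^bsub>M\<^esub> m, z)"
  have keys: "Poly_Mapping.keys c \<subseteq> carrier M \<times> X" using c by fastforce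
  \<comment> \<open>Modulo the tensor relations, m \<otimes> b' y equals m \<otimes> b y + (\<gamma>
    y \<odot> m) \<otimes> z, by additivity and by moving the scalar across.\<close>
  have "frag_extend ?g1 d - frag_extend ?g2 d - frag_extend ?g3 d \<in> ?K"
    if "Poly_Mapping.keys d \<subseteq> carrier M \<times> X" for d
    using that
  proof (induction d rule: frag_induction)
    case zero
    show ?case by (simp add: K)
  next
    case (one x)
    obtain m y where x: "x = (m, y)" "m \<in> carrier M" "y \<in> X" using one by auto
    have by': "b y \<in> carrier E" using trivial_relation_closed[OF E step.hyps(1) x(3)] .
    have "frag_of (m, \<gamma> y \<odot>\<^bsub>E\<^esub> z \<oplus>\<^bsub>E\<^esub> b y) - frag_of (m, \<gamma> y \<odot>\<^bsub>E\<^esub> z) - frag_of (m, b y) \<in> ?K"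
      "frag_of (\<gamma> y \<odot>\<^bsub>M\<^esub> m, z) - frag_of (m, \<gamma> y \<odot>\<^bsub>E\<^esub> z) \<in> ?K"
      using by' \<gamma> x step.hyps(3) by (intro incl tensor_relationsI; simp)+
    from K(4)[OF this] show ?case
      using x by (simp add: step.hyps(5) algebra_simps)
  next
    case (diff p q)
    from K(4)[OF this] show ?case by (simp add: frag_extend_diff algebra_simps)
  qed
  from this[OF keys] have 1: "frag_extend ?g1 c - frag_extend ?g2 c - frag_extend ?g3 c \<in> ?K" .
  let ?F = "free_Abelian_group (carrier M \<times> X)"
  have "(\<lambda>(m, y). \<gamma> y \<odot>\<^bsub>M\<^esub> m) ` (carrier M \<times> X) \<subseteq> carrier (add_monoid M)" using \<gamma> by auto
  then obtain h where h: "h \<in> hom ?F (add_monoid M)"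
    and hb: "\<And>x. x \<in> carrier M \<times> X \<Longrightarrow> h (frag_of x) = (\<lambda>(m, y). \<gamma> y \<odot>\<^bsub>M\<^esub> m) x"
    by (rule comm_group.free_Abelian_group_universal[OF M.M.a_comm_group]) blast
  note hom = hom_free_Abelian_group_diff[OF M.M.abelian_group_axioms h]
  \<comment> \<open>All right factors are \<open>z\<close> here, so the sum collapses to the single
    tensor h d \<otimes> z; for \<open>c\<close> its left factor is 0 by
    \<open>kill\<close>.\<close>
  have "frag_extend ?g3 d - frag_of (h d, z) \<in> ?K" if "Poly_Mapping.keys d \<subseteq> carrier M \<times> X" for d
    using that
  proof (induction d rule: free_Abelian_group_induct[consumes 1, case_names 1 2 3])
    case 1
    show ?case using tensor_zero(2)[OF M E _ step.hyps(3), of "\<zero>\<^bsub>M\<^esub>"] by (simp add: hom(3) K(3))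
  next
    case (2 p q)
    let ?u = "h p" and ?v = "h q"
    have c: "?u \<in> carrier M" "?v \<in> carrier M" using hom(2) 2 by auto
    have "frag_of ((?u \<ominus>\<^bsub>M\<^esub> ?v) \<oplus>\<^bsub>M\<^esub> ?v, z) - frag_of (?u \<ominus>\<^bsub>M\<^esub> ?v, z) - frag_of (?v, z) \<in> ?K"
      using c step.hyps(3) by (intro incl tensor_relationsI) auto
    moreover have "(?u \<ominus>\<^bsub>M\<^esub> ?v) \<oplus>\<^bsub>M\<^esub> ?v = ?u" using c by (simp add: M.M.minus_eq M.M.a_assoc M.M.l_neg)
    ultimately have "frag_of (?u, z) - frag_of (?u \<ominus>\<^bsub>M\<^esub> ?v, z) - frag_of (?v, z) \<in> ?K" by simp
    from K(2)[OF K(4)[OF 2(3,4)] this] show ?case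
      by (simp add: frag_extend_diff hom(1)[OF 2(1,2)] algebra_simps)
  next
    case (3 x)
    then show ?case using hb[of x] by (auto simp: K(1))
  qed
  from this[OF keys] have "frag_extend ?g3 c - frag_of (h c, z) \<in> ?K" .
  moreover have "h c = \<zero>\<^bsub>M\<^esub>"
    using hb by (intro kill[OF step.hyps(2) step.hyps(4) h]) auto
  ultimately have "frag_extend ?g3 c - frag_of (\<zero>\<^bsub>M\<^esub>, z) \<in> ?K" by simp
  from K(2)[OF this tensor_zero(2)[OF M E M.M.zero_closed step.hyps(3)]]
  have "frag_extend ?g3 c \<in> ?K" by simp
  from K(2)[OF K(2)[OF 1 this] step.IH] show ?case by simp
qed

section \<open>Differences and delta functions in finite sums\<close>

lemma (in abelian_group) finsum_minus:
  assumes "finite X" "u \<in> X \<rightarrow> carrier G" "v \<in> X \<rightarrow> carrier G"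
  shows "(\<Oplus>i\<in>X. u i \<ominus> v i) = (\<Oplus>i\<in>X. u i) \<ominus> (\<Oplus>i\<in>X. v i)"
  using assms
proof (induction X)
  case empty
  have "\<zero> \<ominus> \<zero> = \<zero>" unfolding minus_eq by (rule r_neg) simp
  then show ?case by simp
next
  case (insert x X)
  then have "u \<in> X \<rightarrow> carrier G" "v \<in> X \<rightarrow> carrier G" "u x \<in> carrier G" "v x \<in> carrier G" by auto
  then show ?case using insert by (simp add: Pi_def minus_eq minus_add a_ac)
qed

text \<open>Writing the coefficients as differences of conditionals makes coinciding indices
  harmless. The same holds for the version with three terms, where for instance y = y' or y + y' = y
  may occur.\<close>

lemma (in abelian_group) finsum_delta_minus:
  assumes "finite X" "x \<in> X" "x' \<in> X" "u \<in> X \<rightarrow> carrier G" "v \<in> X \<rightarrow> carrier G"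
  shows "(\<Oplus>i\<in>X. (if x = i then u i else \<zero>) \<ominus> (if x' = i then v i else \<zero>)) = u x \<ominus> v x'"
  using assms by (subst finsum_minus) (auto simp: finsum_singleton Pi_def)

lemma (in abelian_group) finsum_delta_minus_minus:
  assumes "finite X" "x \<in> X" "x' \<in> X" "x'' \<in> X" "u \<in> X \<rightarrow> carrier G"
  shows "(\<Oplus>i\<in>X. ((if x = i then u i else \<zero>) \<ominus> (if x' = i then u i else \<zero>)) \<ominus> (if x'' = i then u i else \<zero>))
    = (u x \<ominus> u x') \<ominus> u x''"
  using assms by (subst finsum_minus) (auto simp: finsum_singleton finsum_delta_minus Pi_def)

lemma (in module) smult_l_diff:
  assumes "a \<in> carrier R" "b \<in> carrier R" "x \<in> carrier M"
  shows "(a \<ominus>\<^bsub>R\<^esub> b) \<odot>\<^bsub>M\<^esub> x = a \<odot>\<^bsub>M\<^esub> x \<ominus>\<^bsub>M\<^esub> b \<odot>\<^bsub>M\<^esub> x"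
  using assms by (simp add: R.minus_eq M.minus_eq smult_l_distr smult_l_minus)

lemma (in ring) l_diff_distr:
  assumes "a \<in> carrier R" "b \<in> carrier R" "x \<in> carrier R"
  shows "(a \<ominus> b) \<otimes> x = a \<otimes> x \<ominus> b \<otimes> x"
  using assms by (simp add: minus_eq l_distr l_minus)

lemma (in abelian_group) minus_eq_zero_iff:
  assumes "x \<in> carrier G" "y \<in> carrier G"
  shows "x \<ominus> y = \<zero> \<longleftrightarrow> x = y"
  using assms by (metis minus_eq r_neg minus_equality minus_minus a_inv_closed)

lemma (in abelian_group) add_minus_cancel:
  assumes "x \<in> carrier G" "y \<in> carrier G"
  shows "y \<oplus> (x \<ominus> y) = x"
proof -
  have "y \<oplus> (x \<ominus> y) = (x \<ominus> y) \<oplus> y" using assms by (simp add: a_comm)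
  also have "\<dots> = x" using assms by (simp add: minus_eq a_assoc l_neg)
  finally show ?thesis .
qed

text \<open>The vanishing of the image of \<open>c\<close> rests on finitely many linear relations
  in \<open>E\<close>. Flatness writes all elements of \<open>E\<close> that occur as y = \<Sum>j.
  \<gamma> j y \<odot> z j, where each \<gamma> j respects these relations. Evaluating the image of
  \<open>c\<close> along \<gamma> j gives 0 in \<open>N\<close>, so injectivity of \<open>f\<close>
  gives 0 in \<open>M\<close>, and substituting the expressions for y into \<open>c\<close> makes it
  vanish.\<close>

lemma equationally_flat_tensor_kernel:
  assumes M: "module A M" and N: "module A N" and E: "module A E" and flat: "equationally_flat A E"
    and f: "f \<in> linear_maps A M N" and inj: "inj_on f (carrier M)"
    and c: "Poly_Mapping.keys c \<subseteq> carrier M \<times> carrier E"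
    and fc: "frag_extend (\<lambda>(x, y). frag_of (f x, y)) c \<in> tensor_kernel A N E"
  shows "c \<in> tensor_kernel A M E"
proof -
  interpret M: module A M by fact
  interpret N: module A N by fact
  interpret E: module A E by fact
  note fD = linear_mapsD[OF f]
  let ?h = "frag_extend (\<lambda>(x, y). frag_of (f x, y))"
  let ?FN = "free_Abelian_group (carrier N \<times> carrier E)"
  obtain P Q where PQ: "finite P" "finite Q" "P \<subseteq> carrier E \<times> carrier E" "Q \<subseteq> carrier A \<times> carrier E"
    and witness: "\<And>\<beta> h. \<beta> \<in> carrier E \<rightarrow> carrier A \<Longrightarrow> h \<in> hom ?FN (add_monoid N) \<Longrightarrow>
      \<forall>n\<in>carrier N. \<forall>y\<in>carrier E. h (frag_of (n, y)) = \<beta> y \<odot>\<^bsub>N\<^esub> n \<Longrightarrow>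
      \<forall>(y, y')\<in>P. \<beta> (y \<oplus>\<^bsub>E\<^esub> y') = \<beta> y \<oplus>\<^bsub>A\<^esub> \<beta> y' \<Longrightarrow>
      \<forall>(a, y)\<in>Q. \<beta> (a \<odot>\<^bsub>E\<^esub> y) = a \<otimes>\<^bsub>A\<^esub> \<beta> y \<Longrightarrow> h (?h c) = \<zero>\<^bsub>N\<^esub>"
    using tensor_kernel_finite_witness[OF N E fc] by auto
  \<comment> \<open>All right factors in \<open>c\<close> and all elements of \<open>E\<close> that
    occur in the witnessing relations, their results included.\<close>
  define X where "X = snd ` Poly_Mapping.keys c \<union> (\<Union>(y, y')\<in>P. {y, y', y \<oplus>\<^bsub>E\<^esub> y'}) \<union>
    (\<Union>(a, y)\<in>Q. {y, a \<odot>\<^bsub>E\<^esub> y})"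
  have X: "finite X" "X \<subseteq> carrier E" "snd ` Poly_Mapping.keys c \<subseteq> X"
    using PQ c by (auto simp: X_def)
  have PX: "y \<in> X" "y' \<in> X" "y \<oplus>\<^bsub>E\<^esub> y' \<in> X" if "(y, y') \<in> P" for y y'
    using that by (auto simp: X_def)
  have QX: "y \<in> X" "a \<odot>\<^bsub>E\<^esub> y \<in> X" "a \<in> carrier A" if "(a, y) \<in> Q" for a y
    using that PQ(4) by (auto simp: X_def)
  \<comment> \<open>Coefficient vectors on \<open>X\<close> of the relation (y + y') - y - y' = 0
    and, in \<sigma>, of (a y) - a y = 0, where the bracketed element counts as an unknown of its
    own.\<close>
  define \<rho> where "\<rho> = (\<lambda>(y, y') x. ((if y \<oplus>\<^bsub>E\<^esub> y' = x then \<one>\<^bsub>A\<^esub> else \<zero>\<^bsub>A\<^esub>) \<ominus>\<^bsub>A\<^esub>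
    (if y = x then \<one>\<^bsub>A\<^esub> else \<zero>\<^bsub>A\<^esub>)) \<ominus>\<^bsub>A\<^esub> (if y' = x then \<one>\<^bsub>A\<^esub> else \<zero>\<^bsub>A\<^esub>))"
  define \<sigma> where "\<sigma> = (\<lambda>(a, y) x. (if a \<odot>\<^bsub>E\<^esub> y = x then \<one>\<^bsub>A\<^esub> else \<zero>\<^bsub>A\<^esub>) \<ominus>\<^bsub>A\<^esub>
    (if y = x then a else \<zero>\<^bsub>A\<^esub>))"
  let ?Rel = "\<rho> ` P \<union> \<sigma> ` Q"
  have \<rho>_sum: "(\<Oplus>\<^bsub>A\<^esub>i\<in>X. \<rho> (y, y') i \<otimes>\<^bsub>A\<^esub> \<gamma> i) = (\<gamma> (y \<oplus>\<^bsub>E\<^esub> y') \<ominus>\<^bsub>A\<^esub> \<gamma> y) \<ominus>\<^bsub>A\<^esub> \<gamma> y'"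
    if "(y, y') \<in> P" "\<gamma> \<in> X \<rightarrow> carrier A" for y y' \<gamma>
  proof -
    have "(\<Oplus>\<^bsub>A\<^esub>i\<in>X. \<rho> (y, y') i \<otimes>\<^bsub>A\<^esub> \<gamma> i) = (\<Oplus>\<^bsub>A\<^esub>i\<in>X. ((if y \<oplus>\<^bsub>E\<^esub> y' = i then \<gamma> i else \<zero>\<^bsub>A\<^esub>) \<ominus>\<^bsub>A\<^esub>
      (if y = i then \<gamma> i else \<zero>\<^bsub>A\<^esub>)) \<ominus>\<^bsub>A\<^esub> (if y' = i then \<gamma> i else \<zero>\<^bsub>A\<^esub>))"
    proof (rule M.R.finsum_cong'[OF refl])
      fix i assume "i \<in> X"
      then have "\<gamma> i \<in> carrier A" using that(2) by auto
      then show "\<rho> (y, y') i \<otimes>\<^bsub>A\<^esub> \<gamma> i = ((if y \<oplus>\<^bsub>E\<^esub> y' = i then \<gamma> i else \<zero>\<^bsub>A\<^esub>) \<ominus>\<^bsub>A\<^esub>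
        (if y = i then \<gamma> i else \<zero>\<^bsub>A\<^esub>)) \<ominus>\<^bsub>A\<^esub> (if y' = i then \<gamma> i else \<zero>\<^bsub>A\<^esub>)"
        by (auto simp: \<rho>_def M.R.l_diff_distr)
    qed (use that(2) in \<open>auto simp: Pi_def\<close>)
    then show ?thesis
      using M.R.finsum_delta_minus_minus[OF X(1) PX(3,1,2)[OF that(1)] that(2)] by simp
  qed
  have \<rho>_sum': "(\<Oplus>\<^bsub>E\<^esub>i\<in>X. \<rho> (y, y') i \<odot>\<^bsub>E\<^esub> i) = ((y \<oplus>\<^bsub>E\<^esub> y') \<ominus>\<^bsub>E\<^esub> y) \<ominus>\<^bsub>E\<^esub> y'"
    if "(y, y') \<in> P" for y y'
  proof -
    have "(\<Oplus>\<^bsub>E\<^esub>i\<in>X. \<rho> (y, y') i \<odot>\<^bsub>E\<^esub> i) = (\<Oplus>\<^bsub>E\<^esub>i\<in>X. ((if y \<oplus>\<^bsub>E\<^esub> y' = i then i else \<zero>\<^bsub>E\<^esub>) \<ominus>\<^bsub>E\<^esub>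
      (if y = i then i else \<zero>\<^bsub>E\<^esub>)) \<ominus>\<^bsub>E\<^esub> (if y' = i then i else \<zero>\<^bsub>E\<^esub>))"
    proof (rule E.M.finsum_cong'[OF refl])
      fix i assume "i \<in> X"
      then have "i \<in> carrier E" using X(2) by auto
      then show "\<rho> (y, y') i \<odot>\<^bsub>E\<^esub> i = ((if y \<oplus>\<^bsub>E\<^esub> y' = i then i else \<zero>\<^bsub>E\<^esub>) \<ominus>\<^bsub>E\<^esub>
        (if y = i then i else \<zero>\<^bsub>E\<^esub>)) \<ominus>\<^bsub>E\<^esub> (if y' = i then i else \<zero>\<^bsub>E\<^esub>)"
        by (auto simp: \<rho>_def E.smult_l_diff)
    qed (use X(2) in auto)
    also have "\<dots> = ((y \<oplus>\<^bsub>E\<^esub> y') \<ominus>\<^bsub>E\<^esub> y) \<ominus>\<^bsub>E\<^esub> y'"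
      using X(2) by (intro E.M.finsum_delta_minus_minus[OF X(1) PX(3,1,2)[OF that]]) auto
    finally show ?thesis .
  qed
  have \<sigma>_sum: "(\<Oplus>\<^bsub>A\<^esub>i\<in>X. \<sigma> (a, y) i \<otimes>\<^bsub>A\<^esub> \<gamma> i) = \<gamma> (a \<odot>\<^bsub>E\<^esub> y) \<ominus>\<^bsub>A\<^esub> a \<otimes>\<^bsub>A\<^esub> \<gamma> y"
    if "(a, y) \<in> Q" "\<gamma> \<in> X \<rightarrow> carrier A" for a y \<gamma>
  proof -
    note a = QX(3)[OF that(1)]
    have "(\<Oplus>\<^bsub>A\<^esub>i\<in>X. \<sigma> (a, y) i \<otimes>\<^bsub>A\<^esub> \<gamma> i) = (\<Oplus>\<^bsub>A\<^esub>i\<in>X. (if a \<odot>\<^bsub>E\<^esub> y = i then \<gamma> i else \<zero>\<^bsub>A\<^esub>) \<ominus>\<^bsub>A\<^esub>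
      (if y = i then a \<otimes>\<^bsub>A\<^esub> \<gamma> i else \<zero>\<^bsub>A\<^esub>))"
    proof (rule M.R.finsum_cong'[OF refl])
      fix i assume "i \<in> X"
      then have "\<gamma> i \<in> carrier A" using that(2) by auto
      then show "\<sigma> (a, y) i \<otimes>\<^bsub>A\<^esub> \<gamma> i = (if a \<odot>\<^bsub>E\<^esub> y = i then \<gamma> i else \<zero>\<^bsub>A\<^esub>) \<ominus>\<^bsub>A\<^esub>
        (if y = i then a \<otimes>\<^bsub>A\<^esub> \<gamma> i else \<zero>\<^bsub>A\<^esub>)"
        using a by (auto simp: \<sigma>_def M.R.l_diff_distr)
    qed (use that(2) a in \<open>auto simp: Pi_def\<close>)
    also have "\<dots> = \<gamma> (a \<odot>\<^bsub>E\<^esub> y) \<ominus>\<^bsub>A\<^esub> a \<otimes>\<^bsub>A\<^esub> \<gamma> y"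
      using that(2) a by (intro M.R.finsum_delta_minus[OF X(1) QX(2,1)[OF that(1)]]) auto
    finally show ?thesis .
  qed
  have \<sigma>_sum': "(\<Oplus>\<^bsub>E\<^esub>i\<in>X. \<sigma> (a, y) i \<odot>\<^bsub>E\<^esub> i) = a \<odot>\<^bsub>E\<^esub> y \<ominus>\<^bsub>E\<^esub> a \<odot>\<^bsub>E\<^esub> y"
    if "(a, y) \<in> Q" for a y
  proof -
    note a = QX(3)[OF that(1)]
    have "(\<Oplus>\<^bsub>E\<^esub>i\<in>X. \<sigma> (a, y) i \<odot>\<^bsub>E\<^esub> i) = (\<Oplus>\<^bsub>E\<^esub>i\<in>X. (if a \<odot>\<^bsub>E\<^esub> y = i then i else \<zero>\<^bsub>E\<^esub>) \<ominus>\<^bsub>E\<^esub>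
      (if y = i then a \<odot>\<^bsub>E\<^esub> i else \<zero>\<^bsub>E\<^esub>))"
    proof (rule E.M.finsum_cong'[OF refl])
      fix i assume "i \<in> X"
      then have "i \<in> carrier E" using X(2) by auto
      then show "\<sigma> (a, y) i \<odot>\<^bsub>E\<^esub> i = (if a \<odot>\<^bsub>E\<^esub> y = i then i else \<zero>\<^bsub>E\<^esub>) \<ominus>\<^bsub>E\<^esub>
        (if y = i then a \<odot>\<^bsub>E\<^esub> i else \<zero>\<^bsub>E\<^esub>)"
        using a by (auto simp: \<sigma>_def E.smult_l_diff)
    qed (use X(2) a in auto)
    also have "\<dots> = a \<odot>\<^bsub>E\<^esub> y \<ominus>\<^bsub>E\<^esub> a \<odot>\<^bsub>E\<^esub> y"
      using X(2) a by (intro E.M.finsum_delta_minus[OF X(1) QX(2,1)[OF that(1)]]) auto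
    finally show ?thesis .
  qed
  \<comment> \<open>The unknowns are indexed by their own values, hence the identity as the family
    of elements.\<close>
  have triv: "trivial_relation A E X ?Rel (\<lambda>y. y)"
  proof (rule equationally_flat_system[OF E flat X(1)])
    show "finite ?Rel" using PQ by simp
    show "(\<lambda>y. y) \<in> X \<rightarrow> carrier E" using X(2) by auto
    fix r assume "r \<in> ?Rel"
    then show "r \<in> X \<rightarrow> carrier A \<and> (\<Oplus>\<^bsub>E\<^esub>i\<in>X. r i \<odot>\<^bsub>E\<^esub> i) = \<zero>\<^bsub>E\<^esub>"
    proof (elim UnE imageE)
      fix p assume p: "p \<in> P" "r = \<rho> p"
      obtain y y' where [simp]: "p = (y, y')" by (cases p)
      have yc: "y \<in> carrier E" "y' \<in> carrier E" using p PQ(3) by auto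
      have "r \<in> X \<rightarrow> carrier A" by (auto simp: p(2) \<rho>_def)
      moreover have "((y \<oplus>\<^bsub>E\<^esub> y') \<ominus>\<^bsub>E\<^esub> y) \<ominus>\<^bsub>E\<^esub> y' = \<zero>\<^bsub>E\<^esub>"
        using yc by (simp add: E.M.minus_eq E.M.a_ac E.M.r_neg E.M.r_neg1)
      ultimately show ?thesis using \<rho>_sum'[of y y'] p by simp
    next
      fix q assume q: "q \<in> Q" "r = \<sigma> q"
      obtain a y where [simp]: "q = (a, y)" by (cases q)
      have c: "a \<in> carrier A" "y \<in> carrier E" using q PQ(4) by auto
      have "r \<in> X \<rightarrow> carrier A" using c by (auto simp: q(2) \<sigma>_def)
      then show ?thesis using \<sigma>_sum'[of a y] q c by (simp add: E.M.minus_eq E.M.r_neg)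
    qed
  qed
  have "frag_extend (\<lambda>(m, y). frag_of (m, y)) c \<in> tensor_kernel A M E"
  proof (rule trivial_relation_tensor[OF M E c X(3) _ triv])
    fix \<gamma> h
    assume \<gamma>: "\<gamma> \<in> X \<rightarrow> carrier A" and rel: "\<And>a. a \<in> ?Rel \<Longrightarrow> (\<Oplus>\<^bsub>A\<^esub>i\<in>X. a i \<otimes>\<^bsub>A\<^esub> \<gamma> i) = \<zero>\<^bsub>A\<^esub>"
      and h: "h \<in> hom (free_Abelian_group (carrier M \<times> X)) (add_monoid M)"
      and hb: "\<And>m y. m \<in> carrier M \<Longrightarrow> y \<in> X \<Longrightarrow> h (frag_of (m, y)) = \<gamma> y \<odot>\<^bsub>M\<^esub> m"
    note hom = hom_free_Abelian_group_diff[OF M.M.abelian_group_axioms h]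
    have keys: "Poly_Mapping.keys c \<subseteq> carrier M \<times> X" using c X(3) by fastforce
    \<comment> \<open>Extension by 0 is in general not linear on \<open>E\<close>, but the witnesses
      test \<beta> only at elements of \<open>X\<close>.\<close>
    define \<beta> where "\<beta> y = (if y \<in> X then \<gamma> y else \<zero>\<^bsub>A\<^esub>)" for y
    have \<beta>: "\<beta> y \<in> carrier A" for y using \<gamma> by (auto simp: \<beta>_def)
    have "(\<lambda>(n, y). \<beta> y \<odot>\<^bsub>N\<^esub> n) ` (carrier N \<times> carrier E) \<subseteq> carrier (add_monoid N)" using \<beta> by auto
    then obtain g where g: "g \<in> hom ?FN (add_monoid N)"
      and gb: "\<And>x. x \<in> carrier N \<times> carrier E \<Longrightarrow> g (frag_of x) = (\<lambda>(n, y). \<beta> y \<odot>\<^bsub>N\<^esub> n) x"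
      by (rule comm_group.free_Abelian_group_universal[OF N.M.a_comm_group]) blast
    note homg = hom_free_Abelian_group_diff[OF N.M.abelian_group_axioms g]
    have h_keys: "Poly_Mapping.keys (?h d) \<subseteq> carrier N \<times> carrier E"
      if "Poly_Mapping.keys d \<subseteq> carrier M \<times> X" for d
    proof -
      have "Poly_Mapping.keys d \<subseteq> carrier M \<times> carrier E" using that X(2) by blast
      then show ?thesis
        by (intro order_trans[OF keys_frag_extend]) (use fD(1) in \<open>auto split: prod.splits\<close>)
    qed
    \<comment> \<open>Evaluation along \<gamma> commutes with \<open>f\<close>; this is where
      vanishing in \<open>N\<close> is turned into vanishing in \<open>M\<close>.\<close>
    have fh: "f (h d) = g (?h d)" if "Poly_Mapping.keys d \<subseteq> carrier M \<times> X" for d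
      using that
    proof (induction d rule: free_Abelian_group_induct[consumes 1, case_names 1 2 3])
      case 1
      show ?case by (simp add: hom(3) homg(3) linear_maps_zero[OF M N f])
    next
      case (2 p q)
      have "f (h p \<ominus>\<^bsub>M\<^esub> h q) = f (h p) \<ominus>\<^bsub>N\<^esub> f (h q)"
      proof -
        have c: "h p \<in> carrier M" "h q \<in> carrier M" using hom(2) 2 by auto
        then have "f (h p) = f (h p \<ominus>\<^bsub>M\<^esub> h q) \<oplus>\<^bsub>N\<^esub> f (h q)"
          by (simp add: fD(2)[symmetric] M.M.minus_eq M.M.a_assoc M.M.l_neg)
        then show ?thesis
          using c fD(1)[of "h p \<ominus>\<^bsub>M\<^esub> h q"] fD(1)[of "h q"]
          by (simp add: N.M.minus_eq N.M.a_assoc N.M.r_neg)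
      qed
      then show ?case
        using 2 h_keys by (simp add: frag_extend_diff hom(1) homg(1))
    next
      case (3 x)
      then obtain m y where x: "x = (m, y)" "m \<in> carrier M" "y \<in> X" by auto
      have "\<gamma> y \<in> carrier A" using \<gamma> x by auto
      then show ?case using x fD(1,3) X(2) gb[of "(f m, y)"] by (auto simp: hb \<beta>_def)
    qed
    have "g (?h c) = \<zero>\<^bsub>N\<^esub>"
    proof (rule witness[OF _ g])
      show "\<beta> \<in> carrier E \<rightarrow> carrier A" using \<beta> by auto
      show "\<forall>n\<in>carrier N. \<forall>y\<in>carrier E. g (frag_of (n, y)) = \<beta> y \<odot>\<^bsub>N\<^esub> n" using gb by auto
      show "\<forall>(y, y')\<in>P. \<beta> (y \<oplus>\<^bsub>E\<^esub> y') = \<beta> y \<oplus>\<^bsub>A\<^esub> \<beta> y'"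
      proof clarify
        fix y y' assume p: "(y, y') \<in> P"
        have c: "\<gamma> y \<in> carrier A" "\<gamma> y' \<in> carrier A" "\<gamma> (y \<oplus>\<^bsub>E\<^esub> y') \<in> carrier A"
          using PX[OF p] \<gamma> by auto
        have "(\<gamma> (y \<oplus>\<^bsub>E\<^esub> y') \<ominus>\<^bsub>A\<^esub> \<gamma> y) \<ominus>\<^bsub>A\<^esub> \<gamma> y' = \<zero>\<^bsub>A\<^esub>"
          using rel[of "\<rho> (y, y')"] p \<rho>_sum[OF p \<gamma>] by simp
        then have "\<gamma> (y \<oplus>\<^bsub>E\<^esub> y') \<ominus>\<^bsub>A\<^esub> \<gamma> y = \<gamma> y'" using c by (simp add: M.R.minus_eq_zero_iff)
        moreover have "\<gamma> (y \<oplus>\<^bsub>E\<^esub> y') = \<gamma> y \<oplus>\<^bsub>A\<^esub> (\<gamma> (y \<oplus>\<^bsub>E\<^esub> y') \<ominus>\<^bsub>A\<^esub> \<gamma> y)"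
          by (rule M.R.add_minus_cancel[OF c(3,1), symmetric])
        ultimately have "\<gamma> (y \<oplus>\<^bsub>E\<^esub> y') = \<gamma> y \<oplus>\<^bsub>A\<^esub> \<gamma> y'" by simp
        then show "\<beta> (y \<oplus>\<^bsub>E\<^esub> y') = \<beta> y \<oplus>\<^bsub>A\<^esub> \<beta> y'" using PX[OF p] by (simp add: \<beta>_def)
      qed
      show "\<forall>(a, y)\<in>Q. \<beta> (a \<odot>\<^bsub>E\<^esub> y) = a \<otimes>\<^bsub>A\<^esub> \<beta> y"
      proof clarify
        fix a y assume q: "(a, y) \<in> Q"
        have c: "\<gamma> y \<in> carrier A" "\<gamma> (a \<odot>\<^bsub>E\<^esub> y) \<in> carrier A"
          using QX[OF q] \<gamma> by auto
        have "\<gamma> (a \<odot>\<^bsub>E\<^esub> y) \<ominus>\<^bsub>A\<^esub> a \<otimes>\<^bsub>A\<^esub> \<gamma> y = \<zero>\<^bsub>A\<^esub>"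
          using rel[of "\<sigma> (a, y)"] q \<sigma>_sum[OF q \<gamma>] by simp
        then show "\<beta> (a \<odot>\<^bsub>E\<^esub> y) = a \<otimes>\<^bsub>A\<^esub> \<beta> y"
          using c QX[OF q] by (simp add: M.R.minus_eq_zero_iff \<beta>_def)
      qed
    qed
    then have "f (h c) = f \<zero>\<^bsub>M\<^esub>" using fh[OF keys] by (simp add: linear_maps_zero[OF M N f])
    then show "h c = \<zero>\<^bsub>M\<^esub>" using inj_onD[OF inj] hom(2)[OF keys] by simp
  qed
  moreover have "frag_extend (\<lambda>(m, y). frag_of (m, y)) c = c"
    by (simp add: split_def flip: frag_expansion)
  ultimately show ?thesis by simp
qed

theorem equationally_flat_imp_flat_module:
  fixes A :: "('a, 'k) ring_scheme" and E :: "('a, 'e, 'l) module_scheme"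
  assumes E: "module A E" and flat: "equationally_flat A E"
  shows "flat_module TYPE('m) TYPE('n) A E"
  unfolding flat_module_def
proof (intro conjI allI impI E)
  fix M :: "('a, 'm) module" and N :: "('a, 'n) module" and f
  assume asm: "module A M \<and> module A N \<and> f \<in> linear_maps A M N \<and> inj_on f (carrier M)"
  then have M: "module A M" and N: "module A N" and f: "f \<in> linear_maps A M N"
    and inj: "inj_on f (carrier M)" by auto
  let ?FM = "free_Abelian_group (carrier M \<times> carrier E)"
  let ?FN = "free_Abelian_group (carrier N \<times> carrier E)"
  let ?K = "tensor_kernel A M E" and ?L = "tensor_kernel A N E"
  let ?h = "frag_extend (\<lambda>(x, y). frag_of (f x, y))"
  note K = tensor_kernel_subgroup[OF M E] and L = tensor_kernel_subgroup[OF N E]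
  show "inj_on (tensor_map A N E f) (carrier (tensor_product A M E))"
  proof (rule inj_onI)
    fix T U assume "T \<in> carrier (tensor_product A M E)" "U \<in> carrier (tensor_product A M E)"
      and eq: "tensor_map A N E f T = tensor_map A N E f U"
    then obtain c d where c: "Poly_Mapping.keys c \<subseteq> carrier M \<times> carrier E" "T = ?K #>\<^bsub>?FM\<^esub> c"
      and d: "Poly_Mapping.keys d \<subseteq> carrier M \<times> carrier E" "U = ?K #>\<^bsub>?FM\<^esub> d"
      by (auto simp: tensor_product_def FactGroup_def RCOSETS_def)
    have keys: "Poly_Mapping.keys (?h p) \<subseteq> carrier N \<times> carrier E"
      if "Poly_Mapping.keys p \<subseteq> carrier M \<times> carrier E" for p
      by (rule order_trans[OF keys_frag_extend])
        (use that linear_mapsD(1)[OF f] in \<open>auto split: prod.splits\<close>)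
    have "?L #>\<^bsub>?FN\<^esub> ?h c = ?L #>\<^bsub>?FN\<^esub> ?h d"
      using eq tensor_map_coset[OF M N E f] c d by simp
    moreover have "?h c \<in> ?L #>\<^bsub>?FN\<^esub> ?h c"
      using group.rcos_self[OF group_free_Abelian_group _ L, of "?h c"] keys[OF c(1)] by simp
    ultimately have "?h c \<in> ?L #>\<^bsub>?FN\<^esub> ?h d" by simp
    then obtain l where "l \<in> ?L" "?h c = l + ?h d" by (auto simp: r_coset_def)
    then have "?h (c - d) \<in> ?L" by (simp add: frag_extend_diff)
    then have "c - d \<in> ?K"
      using c(1) d(1) keys_diff[of c d]
      by (intro equationally_flat_tensor_kernel[OF M N E flat f inj]) auto
    then have "c \<in> ?K #>\<^bsub>?FM\<^esub> d"
      unfolding r_coset_def by (auto intro!: bexI[of _ "c - d"])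
    then show "T = U"
      using group.repr_independence[OF group_free_Abelian_group _ _ K, of c d] c d by simp
  qed
qed

section \<open>Presentations by flat noetherian algebras\<close>

lemma alg_hom_linear: "h \<in> alg_hom A B C \<Longrightarrow> h \<in> linear_maps A B C"
  by (auto simp: linear_maps_def alg_homD)

lemma alg_hom_ring_hom: "h \<in> alg_hom A B C \<Longrightarrow> h \<in> ring_hom B C"
  by (simp add: alg_hom_def)

lemma alg_hom_comp:
  assumes "g \<in> alg_hom A C D" "h \<in> alg_hom A B C"
  shows "(\<lambda>x. g (h x)) \<in> alg_hom A B D"
  by (rule alg_homI) (simp_all add: alg_homD[OF assms(1)] alg_homD[OF assms(2)])

lemma alg_hom_inverse:
  assumes "algebra A B" "h \<in> alg_hom A B C" "bij_betw h (carrier B) (carrier C)"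
  shows "inv_into (carrier B) h \<in> alg_hom A C B"
proof -
  interpret B: algebra A B by fact
  let ?g = "inv_into (carrier B) h"
  have img: "h ` carrier B = carrier C" and inj: "inj_on h (carrier B)"
    using assms(3) by (auto simp: bij_betw_def)
  have g: "?g x \<in> carrier B" "h (?g x) = x" if "x \<in> carrier C" for x
    using that inv_into_into[of x h "carrier B"] f_inv_into_f[of x h "carrier B"] img by auto
  have eq: "?g y = x" if "x \<in> carrier B" "h x = y" for x y
    using that inj by auto
  show ?thesis
    by (rule alg_homI) (auto intro!: eq simp: g alg_homD[OF assms(2)])
qed

text \<open>A relation is moved by \<open>g\<close> into \<open>E\<close>, trivialized there, and
  brought back by \<open>f\<close>.\<close>

lemma equationally_flat_retract:
  assumes E: "module A E" and F: "module A F" and flat: "equationally_flat A E"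
    and f: "f \<in> linear_maps A E F" and g: "g \<in> linear_maps A F E"
    and fg: "\<And>x. x \<in> carrier F \<Longrightarrow> f (g x) = x"
  shows "equationally_flat A F"
  unfolding equationally_flat_def
proof (intro allI impI, elim conjE)
  fix n :: nat and a b
  assume a: "a \<in> {..<n} \<rightarrow> carrier A" and b: "b \<in> {..<n} \<rightarrow> carrier F"
    and eq: "(\<Oplus>\<^bsub>F\<^esub>i\<in>{..<n}. a i \<odot>\<^bsub>F\<^esub> b i) = \<zero>\<^bsub>F\<^esub>"
  interpret E: module A E by fact
  interpret F: module A F by fact
  note gD = linear_mapsD[OF g]
  have gb: "(\<lambda>i. g (b i)) \<in> {..<n} \<rightarrow> carrier E" using b gD(1) by auto
  have "(\<Oplus>\<^bsub>E\<^esub>i\<in>{..<n}. a i \<odot>\<^bsub>E\<^esub> g (b i)) = (\<Oplus>\<^bsub>E\<^esub>i\<in>{..<n}. g (a i \<odot>\<^bsub>F\<^esub> b i))"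
    using a b by (intro E.M.finsum_cong') (auto simp: gD Pi_def)
  also have "\<dots> = g (\<Oplus>\<^bsub>F\<^esub>i\<in>{..<n}. a i \<odot>\<^bsub>F\<^esub> b i)"
    using a b by (intro linear_maps_finsum[OF F E g, symmetric]) (auto simp: Pi_def)
  also have "\<dots> = \<zero>\<^bsub>E\<^esub>" by (simp only: eq linear_maps_zero[OF F E g])
  finally have "trivial_relation A E {..<n} {a} (\<lambda>i. g (b i))"
    using flat a gb unfolding equationally_flat_def by simp
  from trivial_relation_linear_map[OF E F f this] show "trivial_relation A F {..<n} {a} b"
    by (rule trivial_relation_cong[OF F]) (use b fg in \<open>auto simp: Pi_def\<close>)
qed

text \<open>The invariant of the construction of P: it holds for \<open>A\<close> itself and
  survives adjoining a variable, relabelling and localization.\<close>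

definition noetherian_flat_algebra :: "('a, 'k) ring_scheme \<Rightarrow> ('a, 'b, 'l) module_scheme \<Rightarrow> bool"
  where "noetherian_flat_algebra A P \<longleftrightarrow> algebra A P \<and> noetherian_ring P \<and> equationally_flat A P"

lemma noetherian_flat_algebra_iso:
  assumes C: "noetherian_flat_algebra A C" and D: "algebra A D" and g: "g \<in> alg_hom A D C"
    and bij: "bij_betw g (carrier D) (carrier C)"
  shows "noetherian_flat_algebra A D"
proof -
  interpret C: algebra A C using C by (simp add: noetherian_flat_algebra_def)
  interpret D: algebra A D by fact
  let ?f = "inv_into (carrier D) g"
  have f: "?f \<in> alg_hom A C D" by (rule alg_hom_inverse[OF D g bij])
  have "?f ` carrier C = carrier D" using bij_betw_inv_into[OF bij] by (simp add: bij_betw_def)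
  then have "noetherian_ring D"
    using C alg_hom_ring_hom[OF f] C.M_cring D.M_cring
    by (intro noetherian_surjective_image[of C D ?f]) (simp_all add: noetherian_flat_algebra_def)
  moreover have "equationally_flat A D"
    using C bij_betw_inv_into_left[OF bij] alg_hom_linear[OF f] alg_hom_linear[OF g]
    by (intro equationally_flat_retract[OF C.module D.module, of ?f g])
      (simp_all add: noetherian_flat_algebra_def)
  ultimately show ?thesis using D by (simp add: noetherian_flat_algebra_def)
qed

text \<open>Replaces the elements of \<open>C\<close> by codes of a prescribed type. Besides the
  invariant, only the image of the map to \<open>B\<close> has to be preserved.\<close>

lemma noetherian_flat_algebra_transport:
  fixes C :: "('a, 'c) module" and e :: "'u \<Rightarrow> 'c"
  assumes C: "noetherian_flat_algebra A C" and h: "h \<in> alg_hom A C B" and e: "carrier C \<subseteq> range e"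
  shows "\<exists>(D :: ('a, 'u) module) h'. noetherian_flat_algebra A D \<and> h' \<in> alg_hom A D B \<and>
    h' ` carrier D = h ` carrier C"
proof -
  interpret C: algebra A C using C by (simp add: noetherian_flat_algebra_def)
  \<comment> \<open>One code is selected for each element, which makes \<open>e\<close> injective on
    \<open>T\<close>.\<close>
  define T where "T = inv_into UNIV e ` carrier C"
  have eT: "e ` T = carrier C"
    using e by (force simp: T_def image_image f_inv_into_f)
  have inj: "inj_on e T"
    using e by (intro inj_onI) (auto simp: T_def f_inv_into_f subset_iff)
  have sub: "subring (e ` T) C" unfolding eT by (rule C.carrier_is_subring)
  have sm: "\<forall>a\<in>carrier A. \<forall>x\<in>T. a \<odot>\<^bsub>C\<^esub> e x \<in> e ` T"
    using eT by (metis C.smult_closed imageI)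
  let ?D = "transport C T e"
  note sel = transport_sel[where A = A, OF sub sm]
  have D: "algebra A ?D" by (rule algebra_transport[OF C.algebra_axioms inj sub sm])
  have eh: "e \<in> alg_hom A ?D C"
    by (rule alg_homI) (use eT in \<open>auto simp: sel\<close>)
  have "bij_betw e (carrier ?D) (carrier C)" using inj eT by (simp add: sel bij_betw_def)
  from noetherian_flat_algebra_iso[OF C D eh this] alg_hom_comp[OF h eh]
  show ?thesis using eT by (intro exI[of _ ?D] exI[of _ "\<lambda>x. h (e x)"]) (auto simp: sel image_image[of h e, symmetric])
qed

subsection \<open>Polynomial algebras\<close>

text \<open>\<open>UP P\<close> has scalars in \<open>P\<close>; here they are restricted to
  \<open>A\<close> along a \<mapsto> a \<odot> 1.\<close>

definition poly_algebra :: "('a, 'u) module \<Rightarrow> ('a, nat \<Rightarrow> 'u) module"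
  where "poly_algebra P = module.make (carrier (UP P)) (monoid.mult (UP P)) \<one>\<^bsub>UP P\<^esub> \<zero>\<^bsub>UP P\<^esub> (add (UP P))
    (\<lambda>a. smult (UP P) (a \<odot>\<^bsub>P\<^esub> \<one>\<^bsub>P\<^esub>))"

lemma poly_algebra_sel [simp]:
  "carrier (poly_algebra P) = carrier (UP P)"
  "p \<otimes>\<^bsub>poly_algebra P\<^esub> q = p \<otimes>\<^bsub>UP P\<^esub> q"
  "p \<oplus>\<^bsub>poly_algebra P\<^esub> q = p \<oplus>\<^bsub>UP P\<^esub> q"
  "\<one>\<^bsub>poly_algebra P\<^esub> = \<one>\<^bsub>UP P\<^esub>"
  "\<zero>\<^bsub>poly_algebra P\<^esub> = \<zero>\<^bsub>UP P\<^esub>"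
  "a \<odot>\<^bsub>poly_algebra P\<^esub> p = (a \<odot>\<^bsub>P\<^esub> \<one>\<^bsub>P\<^esub>) \<odot>\<^bsub>UP P\<^esub> p"
  by (simp_all add: poly_algebra_def module.make_def)

lemma algebra_poly_algebra:
  fixes P :: "('a, 'u) module"
  assumes "algebra A P"
  shows "algebra A (poly_algebra P)"
proof -
  interpret P: algebra A P by fact
  interpret U: UP_cring P "UP P" by unfold_locales simp
  have ab: "abelian_group (poly_algebra P)"
    by (rule abelian_groupI) (auto simp: U.P.a_ac intro: U.UP_l_neg_ex)
  have cm: "comm_monoid (poly_algebra P)"
    by (rule comm_monoidI) (auto simp: U.P.m_ac)
  have cr: "cring (poly_algebra P)"
    by (rule cringI[OF ab cm]) (auto simp: U.P.l_distr)
  show ?thesis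
    by (rule algebraI[OF P.R_cring cr])
      (auto simp: P.smult_l_distr U.UP_smult_l_distr U.UP_smult_r_distr U.UP_smult_assoc2
        U.UP_smult_assoc1[symmetric] P.smult_assoc2 P.smult_assoc1)
qed

text \<open>Preservation of the lower coefficients lets an induction compare all truncations with
  one fixed polynomial, as the flatness proof does.\<close>

lemma (in UP_ring) split_leading_coeff:
  assumes f: "f \<in> carrier P" and vanish: "\<And>k. k \<ge> Suc d \<Longrightarrow> coeff P f k = \<zero>"
  shows "\<exists>g\<in>carrier P. f = monom P (coeff P f d) d \<oplus>\<^bsub>P\<^esub> g \<and> (\<forall>k\<ge>d. coeff P g k = \<zero>) \<and>
    (\<forall>k<d. coeff P g k = coeff P f k)"
proof (rule bexI)
  let ?m = "monom P (coeff P f d) d"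
  let ?g = "f \<oplus>\<^bsub>P\<^esub> \<ominus>\<^bsub>P\<^esub> ?m"
  have m: "?m \<in> carrier P" using f by simp
  show "?g \<in> carrier P" using f m by simp
  have "f = ?m \<oplus>\<^bsub>P\<^esub> ?g"
    by (rule up_eqI) (use f in \<open>auto simp: R.r_neg R.r_neg1 R.a_lcomm\<close>)
  moreover have "coeff P ?g k = \<zero>" if "k \<ge> d" for k
    using f m vanish[of k] that by (cases "k = d") (auto simp: R.r_neg)
  moreover have "coeff P ?g k = coeff P f k" if "k < d" for k
    using f m that by simp
  ultimately show "f = ?m \<oplus>\<^bsub>P\<^esub> ?g \<and> (\<forall>k\<ge>d. coeff P ?g k = \<zero>) \<and> (\<forall>k<d. coeff P ?g k = coeff P f k)"
    by blast
qed

lemma noetherian_poly_algebra: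
  fixes P :: "('a, 'u) module"
  assumes P: "algebra A P" and noeth: "noetherian_ring P"
  shows "noetherian_ring (poly_algebra P)"
proof -
  interpret P: algebra A P by fact
  interpret U: UP_cring P "UP P" by unfold_locales simp
  interpret Q: algebra A "poly_algebra P" by (rule algebra_poly_algebra[OF P])
  let ?Q = "poly_algebra P"
  let ?\<phi> = "\<lambda>s. monom (UP P) s 0" and ?x = "monom (UP P) \<one>\<^bsub>P\<^esub> 1"
  have pow: "?x [^]\<^bsub>?Q\<^esub> d = monom (UP P) \<one>\<^bsub>P\<^esub> d" for d :: nat
  proof (induction d)
    case (Suc d)
    then show ?case using U.monom_one_Suc[of d] by simp
  qed (simp add: U.monom_one)
  have "f \<in> poly_below P ?Q ?\<phi> ?x d"
    if "f \<in> carrier (UP P)" "\<And>k. k \<ge> d \<Longrightarrow> coeff (UP P) f k = \<zero>\<^bsub>P\<^esub>" for f d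
    using that
  proof (induction d arbitrary: f)
    case 0
    then have "f = \<zero>\<^bsub>UP P\<^esub>" by (intro U.up_eqI) auto
    then show ?case by simp
  next
    case (Suc d)
    let ?s = "coeff (UP P) f d"
    obtain g where g: "g \<in> carrier (UP P)" "f = monom (UP P) ?s d \<oplus>\<^bsub>UP P\<^esub> g"
      "\<forall>k\<ge>d. coeff (UP P) g k = \<zero>\<^bsub>P\<^esub>"
      using U.split_leading_coeff[OF Suc.prems] by blast
    have s: "?s \<in> carrier P" using Suc.prems(1) by (rule U.coeff_closed)
    have "monom (UP P) ?s d = ?\<phi> ?s \<otimes>\<^bsub>UP P\<^esub> monom (UP P) \<one>\<^bsub>P\<^esub> d"
      using U.monom_mult[OF s, of "\<one>\<^bsub>P\<^esub>" 0 d] s by simp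
    then have "f = ?\<phi> ?s \<otimes>\<^bsub>?Q\<^esub> monom (UP P) \<one>\<^bsub>P\<^esub> d \<oplus>\<^bsub>?Q\<^esub> g" using g(2) by simp
    then have "f = ?\<phi> ?s \<otimes>\<^bsub>?Q\<^esub> ?x [^]\<^bsub>?Q\<^esub> d \<oplus>\<^bsub>?Q\<^esub> g" unfolding pow .
    moreover have "g \<in> poly_below P ?Q ?\<phi> ?x d" using g by (intro Suc.IH) auto
    ultimately show ?case unfolding poly_below.simps using s by blast
  qed
  note below = this
  \<comment> \<open>\<open>poly_below\<close> bounds the degree strictly, hence the
    successor.\<close>
  have "f \<in> poly_below P ?Q ?\<phi> ?x (Suc (deg P f))" if "f \<in> carrier ?Q" for f
    using that by (intro below U.deg_aboveD) simp_all
  then have gen: "carrier ?Q \<subseteq> (\<Union>d. poly_below P ?Q ?\<phi> ?x d)" by blast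
  have "?\<phi> \<in> ring_hom P ?Q" using U.const_ring_hom by (simp add: ring_hom_def)
  then show ?thesis
    by (rule hilbert_basis[OF noeth P.M_cring Q.M_cring _ _ gen]) simp
qed

lemma poly_algebra_linear_maps:
  fixes P :: "('a, 'u) module"
  assumes P: "algebra A P"
  shows "(\<lambda>f. coeff (UP P) f k) \<in> linear_maps A (poly_algebra P) P"
    and "(\<lambda>p. monom (UP P) p k) \<in> linear_maps A P (poly_algebra P)"
proof -
  interpret P: algebra A P by fact
  interpret U: UP_cring P "UP P" by unfold_locales simp
  show "(\<lambda>f. coeff (UP P) f k) \<in> linear_maps A (poly_algebra P) P"
    by (auto simp: linear_maps_def P.smult_assoc2)
  have "monom (UP P) (a \<odot>\<^bsub>P\<^esub> p) k = (a \<odot>\<^bsub>P\<^esub> \<one>\<^bsub>P\<^esub>) \<odot>\<^bsub>UP P\<^esub> monom (UP P) p k"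
    if "a \<in> carrier A" "p \<in> carrier P" for a p
    using U.monom_mult_smult[of "a \<odot>\<^bsub>P\<^esub> \<one>\<^bsub>P\<^esub>" p k] that by (simp add: P.smult_assoc2)
  then show "(\<lambda>p. monom (UP P) p k) \<in> linear_maps A P (poly_algebra P)"
    by (auto simp: linear_maps_def)
qed

text \<open>Taking coefficients and forming monomials are \<open>A\<close>-linear. A relation thus
  splits into one relation for each degree, each is trivial over \<open>P\<close>, and finitely many
  of them are added up again.\<close>

lemma equationally_flat_poly_algebra:
  fixes P :: "('a, 'u) module"
  assumes P: "algebra A P" and flat: "equationally_flat A P"
  shows "equationally_flat A (poly_algebra P)"
  unfolding equationally_flat_def
proof (intro allI impI, elim conjE)
  interpret P: algebra A P by fact
  interpret U: UP_cring P "UP P" by unfold_locales simp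
  let ?Q = "poly_algebra P"
  interpret Q: algebra A ?Q by (rule algebra_poly_algebra[OF P])
  note cl = poly_algebra_linear_maps(1)[OF P] and ml = poly_algebra_linear_maps(2)[OF P]
  fix n :: nat and a b
  assume a: "a \<in> {..<n} \<rightarrow> carrier A" and b: "b \<in> {..<n} \<rightarrow> carrier ?Q"
    and eq: "(\<Oplus>\<^bsub>?Q\<^esub>i\<in>{..<n}. a i \<odot>\<^bsub>?Q\<^esub> b i) = \<zero>\<^bsub>?Q\<^esub>"
  have triv_coeff: "trivial_relation A P {..<n} {a} (\<lambda>i. coeff (UP P) (b i) k)" for k
  proof -
    have "(\<Oplus>\<^bsub>P\<^esub>i\<in>{..<n}. a i \<odot>\<^bsub>P\<^esub> coeff (UP P) (b i) k) = (\<Oplus>\<^bsub>P\<^esub>i\<in>{..<n}. coeff (UP P) (a i \<odot>\<^bsub>?Q\<^esub> b i) k)"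
    proof (rule P.M.finsum_cong'[OF refl])
      fix i assume "i \<in> {..<n}"
      then have "a i \<in> carrier A" "b i \<in> carrier ?Q" using a b by auto
      then show "a i \<odot>\<^bsub>P\<^esub> coeff (UP P) (b i) k = coeff (UP P) (a i \<odot>\<^bsub>?Q\<^esub> b i) k"
        by (rule linear_mapsD(3)[OF cl, symmetric])
    next
      show "(\<lambda>i. coeff (UP P) (a i \<odot>\<^bsub>?Q\<^esub> b i) k) \<in> {..<n} \<rightarrow> carrier P"
        using a b by (intro Pi_I linear_mapsD(1)[OF cl] Q.smult_closed) auto
    qed
    also have "\<dots> = coeff (UP P) (\<Oplus>\<^bsub>?Q\<^esub>i\<in>{..<n}. a i \<odot>\<^bsub>?Q\<^esub> b i) k"
      using a b by (intro linear_maps_finsum[OF Q.module P.module cl, symmetric] Pi_I Q.smult_closed) auto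
    also have "\<dots> = \<zero>\<^bsub>P\<^esub>" by (simp only: eq linear_maps_zero[OF Q.module P.module cl])
    finally show ?thesis
      using flat a b unfolding equationally_flat_def by (auto simp: Pi_def)
  qed
  \<comment> \<open>Here \<open>f\<close> is the truncation of the family \<open>b\<close> below
    degree \<open>d\<close>; its top coefficients are those of \<open>b\<close>, whose triviality is
    known.\<close>
  have "trivial_relation A ?Q {..<n} {a} f"
    if "\<And>i. i < n \<Longrightarrow> f i \<in> carrier (UP P)" "\<And>i k. i < n \<Longrightarrow> k \<ge> d \<Longrightarrow> coeff (UP P) (f i) k = \<zero>\<^bsub>P\<^esub>"
      "\<And>i k. i < n \<Longrightarrow> k < d \<Longrightarrow> coeff (UP P) (f i) k = coeff (UP P) (b i) k" for f d
    using that
  proof (induction d arbitrary: f)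
    case 0
    have "f i = \<zero>\<^bsub>UP P\<^esub>" if "i < n" for i
      using 0(1,2) that by (intro U.up_eqI) auto
    then show ?case by (intro trivial_relation.zero) simp
  next
    case (Suc d)
    have "\<exists>g\<in>carrier (UP P). f i = monom (UP P) (coeff (UP P) (f i) d) d \<oplus>\<^bsub>UP P\<^esub> g \<and>
      (\<forall>k\<ge>d. coeff (UP P) g k = \<zero>\<^bsub>P\<^esub>) \<and> (\<forall>k<d. coeff (UP P) g k = coeff (UP P) (f i) k)"
      if "i < n" for i
      using Suc.prems(1,2)[OF that] by (rule U.split_leading_coeff)
    then obtain g where g: "\<And>i. i < n \<Longrightarrow> g i \<in> carrier (UP P)"
      "\<And>i. i < n \<Longrightarrow> f i = monom (UP P) (coeff (UP P) (f i) d) d \<oplus>\<^bsub>UP P\<^esub> g i"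
      "\<And>i k. i < n \<Longrightarrow> k \<ge> d \<Longrightarrow> coeff (UP P) (g i) k = \<zero>\<^bsub>P\<^esub>"
      "\<And>i k. i < n \<Longrightarrow> k < d \<Longrightarrow> coeff (UP P) (g i) k = coeff (UP P) (f i) k"
      by metis
    have "trivial_relation A ?Q {..<n} {a} g"
      using g Suc.prems(3) by (intro Suc.IH) auto
    moreover have "trivial_relation A ?Q {..<n} {a} (\<lambda>i. monom (UP P) (coeff (UP P) (b i) d) d)"
      by (rule trivial_relation_linear_map[OF P.module Q.module ml triv_coeff])
    ultimately have "trivial_relation A ?Q {..<n} {a} (\<lambda>i. monom (UP P) (coeff (UP P) (b i) d) d \<oplus>\<^bsub>?Q\<^esub> g i)"
      by (intro trivial_relation_add[OF Q.module])
    then show ?case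
    proof (rule trivial_relation_cong[OF Q.module])
      fix i assume "i \<in> {..<n}"
      then have i: "i < n" by simp
      show "f i = monom (UP P) (coeff (UP P) (b i) d) d \<oplus>\<^bsub>?Q\<^esub> g i"
        using g(2)[OF i] Suc.prems(3)[OF i, of d] by simp
    qed
  qed
  note triv = this
  \<comment> \<open>A common strict degree bound, the successor of the largest degree in the
    family.\<close>
  obtain d where d: "\<And>i k. i < n \<Longrightarrow> k \<ge> d \<Longrightarrow> coeff (UP P) (b i) k = \<zero>\<^bsub>P\<^esub>"
  proof (rule that)
    fix i k assume i: "i < n" and k: "k \<ge> Suc (Max ((\<lambda>i. deg P (b i)) ` {..<n}))"
    have "deg P (b i) \<le> Max ((\<lambda>i. deg P (b i)) ` {..<n})" using i by (intro Max_ge) auto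
    then have "deg P (b i) < k" using k by linarith
    then show "coeff (UP P) (b i) k = \<zero>\<^bsub>P\<^esub>" by (rule U.deg_aboveD) (use i b in auto)
  qed
  show "trivial_relation A ?Q {..<n} {a} b"
    by (rule triv[of b d]) (use b d in auto)
qed

lemma poly_algebra_eval:
  fixes P :: "('a, 'u) module"
  assumes P: "algebra A P" and B: "algebra A B" and h: "h \<in> alg_hom A P B" and s: "s \<in> carrier B"
  shows "\<exists>h'\<in>alg_hom A (poly_algebra P) B. h ` carrier P \<union> {s} \<subseteq> h' ` carrier (poly_algebra P)"
proof -
  interpret P: algebra A P by fact
  interpret B: algebra A B by fact
  interpret H: ring_hom_cring P B h
    by (rule ring_hom_cringI[OF P.M_cring B.M_cring alg_hom_ring_hom[OF h]])
  interpret U: UP_pre_univ_prop P B h "UP P" by unfold_locales simp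
  let ?h = "eval P B h s"
  note hom = U.eval_ring_hom[OF s]
  have const: "?h (monom (UP P) p 0) = h p" if "p \<in> carrier P" for p
    by (rule U.eval_const[OF s that])
  have "?h ((a \<odot>\<^bsub>P\<^esub> \<one>\<^bsub>P\<^esub>) \<odot>\<^bsub>UP P\<^esub> f) = a \<odot>\<^bsub>B\<^esub> ?h f" if af: "a \<in> carrier A" "f \<in> carrier (UP P)" for a f
  proof -
    have f: "?h f \<in> carrier B" using ring_hom_closed[OF hom af(2)] .
    have "?h ((a \<odot>\<^bsub>P\<^esub> \<one>\<^bsub>P\<^esub>) \<odot>\<^bsub>UP P\<^esub> f) = ?h (monom (UP P) (a \<odot>\<^bsub>P\<^esub> \<one>\<^bsub>P\<^esub>) 0 \<otimes>\<^bsub>UP P\<^esub> f)"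
      using af by (simp add: U.monom_mult_is_smult)
    also have "\<dots> = h (a \<odot>\<^bsub>P\<^esub> \<one>\<^bsub>P\<^esub>) \<otimes>\<^bsub>B\<^esub> ?h f"
      using af by (simp add: ring_hom_mult[OF hom] const)
    also have "\<dots> = a \<odot>\<^bsub>B\<^esub> ?h f"
      using af f by (simp add: alg_homD[OF h] B.smult_assoc2)
    finally show ?thesis .
  qed
  then have "?h \<in> alg_hom A (poly_algebra P) B"
    by (intro alg_homI)
      (simp_all add: ring_hom_closed[OF hom] ring_hom_mult[OF hom] ring_hom_add[OF hom] ring_hom_one[OF hom])
  moreover have "h p \<in> ?h ` carrier (poly_algebra P)" if "p \<in> carrier P" for p
    using const[OF that] that by (intro image_eqI[of _ _ "monom (UP P) p 0"]) auto
  moreover have "s \<in> ?h ` carrier (poly_algebra P)"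
    using U.eval_monom1[OF s] by (intro image_eqI[of _ _ "monom (UP P) \<one>\<^bsub>P\<^esub> 1"]) auto
  ultimately show ?thesis by (intro bexI[of _ ?h]) auto
qed

text \<open>Closed under finite lists, so that the polynomials over a ring with elements of this type
  can be encoded in the type again; this makes the adjunction of variables iterable.\<close>

datatype 'a nested = Leaf 'a | Node "'a nested list"

text \<open>Polynomials over \<open>P\<close> are functions and have a larger type, but each is
  determined by a finite list of coefficients, which is again an element of the type
  \<open>nested\<close>.\<close>

lemma adjoin_variable:
  fixes P :: "('a, 'a nested) module"
  assumes P: "noetherian_flat_algebra A P" and B: "algebra A B"
    and h: "h \<in> alg_hom A P B" and s: "s \<in> carrier B"
  shows "\<exists>(P' :: ('a, 'a nested) module) h'. noetherian_flat_algebra A P' \<and> h' \<in> alg_hom A P' B \<and>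
    h ` carrier P \<union> {s} \<subseteq> h' ` carrier P'"
proof -
  have P': "algebra A P" "noetherian_ring P" "equationally_flat A P"
    using P by (auto simp: noetherian_flat_algebra_def)
  let ?Q = "poly_algebra P"
  have Q: "noetherian_flat_algebra A ?Q"
    using P' by (simp add: noetherian_flat_algebra_def algebra_poly_algebra noetherian_poly_algebra
        equationally_flat_poly_algebra)
  obtain g where g: "g \<in> alg_hom A ?Q B" "h ` carrier P \<union> {s} \<subseteq> g ` carrier ?Q"
    using poly_algebra_eval[OF P'(1) B h s] by auto
  \<comment> \<open>Decodes a \<open>Node\<close> as the list of coefficients padded with zeros; the
    value on a \<open>Leaf\<close> is an arbitrary default.\<close>
  define e where "e = (\<lambda>Leaf _ \<Rightarrow> \<lambda>_. \<zero>\<^bsub>P\<^esub> | Node l \<Rightarrow> \<lambda>i. if i < length l then l ! i else \<zero>\<^bsub>P\<^esub>)"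
  have "f \<in> range e" if f: "f \<in> carrier ?Q" for f
  proof -
    obtain n where n: "bound \<zero>\<^bsub>P\<^esub> n f" using f by (auto simp: UP_def up_def)
    \<comment> \<open>The coefficients vanish strictly above \<open>n\<close>, so the list runs over
      0 to \<open>n\<close>.\<close>
    have "f i = e (Node (map f [0..<Suc n])) i" for i
      using bound.bound[OF n, of i] by (auto simp: e_def simp del: upt_Suc)
    then show ?thesis by blast
  qed
  then have "carrier ?Q \<subseteq> range e" by blast
  from noetherian_flat_algebra_transport[OF Q g(1) this] show ?thesis using g(2) by metis
qed

text \<open>The polynomial ring in no variables, that is \<open>A\<close> over itself, with its
  elements coded as leaves.\<close>

lemma base_algebra:
  assumes A: "cring A" "noetherian_ring A" and B: "algebra A B"
  shows "\<exists>(P :: ('a, 'a nested) module) h. noetherian_flat_algebra A P \<and> h \<in> alg_hom A P B \<and>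
    (\<lambda>a. a \<odot>\<^bsub>B\<^esub> \<one>\<^bsub>B\<^esub>) ` carrier A \<subseteq> h ` carrier P"
proof -
  interpret A: cring A by fact
  interpret B: algebra A B by fact
  define C :: "('a, 'a) module" where "C = module.make (carrier A) (monoid.mult A) \<one>\<^bsub>A\<^esub> \<zero>\<^bsub>A\<^esub> (add A) (monoid.mult A)"
  have sel: "carrier C = carrier A" "monoid.mult C = monoid.mult A" "\<one>\<^bsub>C\<^esub> = \<one>\<^bsub>A\<^esub>" "\<zero>\<^bsub>C\<^esub> = \<zero>\<^bsub>A\<^esub>" "add C = add A" "smult C = monoid.mult A"
    by (simp_all add: C_def module.make_def)
  have cr: "cring C"
    by (intro cringI abelian_groupI comm_monoidI)
      (auto simp: sel A.a_ac A.m_ac A.l_distr A.r_distr intro: A.l_neg bexI[of _ "\<ominus>\<^bsub>A\<^esub> _"])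
  have C: "algebra A C"
    by (rule algebraI[OF A(1) cr]) (auto simp: sel A.m_ac A.l_distr A.r_distr)
  interpret C: algebra A C by fact
  have finsum_C: "(\<Oplus>\<^bsub>C\<^esub>i\<in>X. f i) = (\<Oplus>\<^bsub>A\<^esub>i\<in>X. f i)" if "finite X" "f \<in> X \<rightarrow> carrier A" for X and f :: "nat \<Rightarrow> 'a"
    using that by (induction X) (simp_all add: sel Pi_def)
  have "noetherian_ring C"
    by (rule noetherian_surjective_image[OF A(2,1) cr, of id]) (auto simp: ring_hom_def sel)
  moreover have "equationally_flat A C"
    unfolding equationally_flat_def
  proof (intro allI impI, elim conjE)
    fix n :: nat and a b
    assume a: "a \<in> {..<n} \<rightarrow> carrier A" and b: "b \<in> {..<n} \<rightarrow> carrier C"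
      and eq: "(\<Oplus>\<^bsub>C\<^esub>i\<in>{..<n}. a i \<odot>\<^bsub>C\<^esub> b i) = \<zero>\<^bsub>C\<^esub>"
    \<comment> \<open>Over \<open>A\<close> a relation is trivialized by one vector:
      \<open>b\<close> is itself a solution and is multiplied by 1.\<close>
    have "trivial_relation A C {..<n} {a} (\<lambda>i. \<zero>\<^bsub>C\<^esub>)" by (rule trivial_relation.zero) simp
    then show "trivial_relation A C {..<n} {a} b"
    proof (rule trivial_relation.step[of _ _ _ _ _ b "\<one>\<^bsub>C\<^esub>"])
      show "(\<Oplus>\<^bsub>A\<^esub>i\<in>{..<n}. r i \<otimes>\<^bsub>A\<^esub> b i) = \<zero>\<^bsub>A\<^esub>" if "r \<in> {a}" for r
        using that eq a b by (subst finsum_C[symmetric]) (auto simp: sel)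
    qed (use b in \<open>auto simp: sel Pi_def\<close>)
  qed
  ultimately have flat_C: "noetherian_flat_algebra A C" using C by (simp add: noetherian_flat_algebra_def)
  have hom_C: "(\<lambda>a. a \<odot>\<^bsub>B\<^esub> \<one>\<^bsub>B\<^esub>) \<in> alg_hom A C B"
    by (rule alg_homI) (auto simp: sel B.smult_l_distr B.smult_assoc1 B.smult_assoc2)
  have range_C: "carrier C \<subseteq> range (\<lambda>Leaf a \<Rightarrow> a | Node _ \<Rightarrow> undefined)"
  proof
    fix a :: 'a
    show "a \<in> range (\<lambda>Leaf a \<Rightarrow> a | Node _ \<Rightarrow> undefined)"
      by (rule image_eqI[of _ _ "Leaf a"]) simp_all
  qed
  show ?thesis
    using noetherian_flat_algebra_transport[OF flat_C hom_C range_C]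
    by (elim exE conjE) (intro exI conjI, assumption+, simp add: sel)
qed

text \<open>Each generator costs one variable. The image of the resulting map is a subring that
  contains the scalars and all generators.\<close>

lemma finitely_generated_presentation:
  assumes A: "cring A" "noetherian_ring A" and B: "finitely_generated_algebra A B"
  shows "\<exists>(P :: ('a, 'a nested) module) h. noetherian_flat_algebra A P \<and> h \<in> alg_hom A P B \<and>
    h ` carrier P = carrier B"
proof -
  interpret B: algebra A B using B by (simp add: finitely_generated_algebra_def)
  obtain G where G: "finite G" "G \<subseteq> carrier B"
    and gen: "generate_ring B ((\<lambda>a. a \<odot>\<^bsub>B\<^esub> \<one>\<^bsub>B\<^esub>) ` carrier A \<union> G) = carrier B"
    using B by (auto simp: finitely_generated_algebra_def)
  let ?A = "(\<lambda>a. a \<odot>\<^bsub>B\<^esub> \<one>\<^bsub>B\<^esub>) ` carrier A"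
  have "\<exists>(P :: ('a, 'a nested) module) h. noetherian_flat_algebra A P \<and> h \<in> alg_hom A P B \<and>
    ?A \<union> G \<subseteq> h ` carrier P"
    using G
  proof (induction G)
    case empty
    show ?case using base_algebra[OF A B.algebra_axioms] by simp
  next
    case (insert s G)
    then obtain P :: "('a, 'a nested) module" and h where P: "noetherian_flat_algebra A P"
      "h \<in> alg_hom A P B" "?A \<union> G \<subseteq> h ` carrier P" by auto
    have "s \<in> carrier B" using insert.prems by simp
    from adjoin_variable[OF P(1) B.algebra_axioms P(2) this]
    obtain P' :: "('a, 'a nested) module" and h' where "noetherian_flat_algebra A P'"
      "h' \<in> alg_hom A P' B" "h ` carrier P \<union> {s} \<subseteq> h' ` carrier P'" by blast
    moreover have "?A \<union> insert s G \<subseteq> h' ` carrier P'" using P(3) calculation(3) by blast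
    ultimately show ?case by (intro exI conjI)
  qed
  then obtain P :: "('a, 'a nested) module" and h where P: "noetherian_flat_algebra A P"
    and h: "h \<in> alg_hom A P B" and sub: "?A \<union> G \<subseteq> h ` carrier P" by blast
  interpret P: algebra A P using P by (simp add: noetherian_flat_algebra_def)
  interpret H: ring_hom_cring P B h
    by (rule ring_hom_cringI[OF P.M_cring B.M_cring alg_hom_ring_hom[OF h]])
  have "subring (h ` carrier P) B"
  proof (rule B.subringI)
    show "\<one>\<^bsub>B\<^esub> \<in> h ` carrier P" by (rule image_eqI[of _ _ "\<one>\<^bsub>P\<^esub>"]) simp_all
    fix x y assume "x \<in> h ` carrier P" "y \<in> h ` carrier P"
    then obtain p q where "p \<in> carrier P" "q \<in> carrier P" "x = h p" "y = h q" by auto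
    then show "\<ominus>\<^bsub>B\<^esub> x \<in> h ` carrier P" "x \<otimes>\<^bsub>B\<^esub> y \<in> h ` carrier P" "x \<oplus>\<^bsub>B\<^esub> y \<in> h ` carrier P"
      using image_eqI[of _ h "\<ominus>\<^bsub>P\<^esub> p" "carrier P"] image_eqI[of _ h "p \<otimes>\<^bsub>P\<^esub> q" "carrier P"]
        image_eqI[of _ h "p \<oplus>\<^bsub>P\<^esub> q" "carrier P"] by simp_all
  qed auto
  then have "carrier B \<subseteq> h ` carrier P"
    using B.generate_ring_min_subring1[OF _ _ sub] G(2) unfolding gen by auto
  then show ?thesis using P h by (intro exI[of _ P] exI[of _ h]) auto
qed

subsection \<open>Localizations\<close>

lemma localization_one_zero:
  "\<one>\<^bsub>localization B S\<^esub> = fraction B S \<one>\<^bsub>B\<^esub> \<one>\<^bsub>B\<^esub>" "\<zero>\<^bsub>localization B S\<^esub> = fraction B S \<zero>\<^bsub>B\<^esub> \<one>\<^bsub>B\<^esub>"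
  by (simp_all add: localization_def module.make_def)

lemma fraction_cancel:
  assumes "cring R" "submonoid S R" "r \<in> carrier R" "s \<in> S" "u \<in> S"
  shows "fraction R S (u \<otimes>\<^bsub>R\<^esub> r) (u \<otimes>\<^bsub>R\<^esub> s) = fraction R S r s"
    and "fraction R S (r \<otimes>\<^bsub>R\<^esub> u) (s \<otimes>\<^bsub>R\<^esub> u) = fraction R S r s"
proof -
  interpret cring R by fact
  interpret S: submonoid S R by fact
  have c: "s \<in> carrier R" "u \<in> carrier R" using assms S.subset by auto
  show "fraction R S (u \<otimes>\<^bsub>R\<^esub> r) (u \<otimes>\<^bsub>R\<^esub> s) = fraction R S r s"
    and "fraction R S (r \<otimes>\<^bsub>R\<^esub> u) (s \<otimes>\<^bsub>R\<^esub> u) = fraction R S r s"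
    using assms c by (auto simp: fraction_eq_iff m_ac intro!: bexI[of _ "\<one>\<^bsub>R\<^esub>"])
qed

text \<open>An ideal of the localization is determined by the fractions p / 1 in it, because p / t
  and p / 1 differ by the unit t / 1.\<close>

lemma noetherian_localization:
  assumes P: "algebra A P" and noeth: "noetherian_ring P" and T: "submonoid T P"
  shows "noetherian_ring (localization P T)"
proof -
  interpret P: algebra A P by fact
  interpret T: submonoid T P by fact
  let ?L = "localization P T" and ?f = "fraction P T"
  interpret L: algebra A ?L by (rule algebra_localization[OF P T])
  note ops = localization_ops[OF P T]
  note cancel = fraction_cancel[OF P.M_cring T]
  have Tc: "t \<in> carrier P" if "t \<in> T" for t using that T.subset by auto
  have "(\<lambda>p. ?f p \<one>\<^bsub>P\<^esub>) \<in> ring_hom P ?L"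
    by (rule ring_hom_memI) (simp_all add: fraction_carrier ops localization_one_zero)
  then show ?thesis
  proof (rule noetherian_contraction[OF noeth P.M_cring L.M_cring], intro subsetI)
    fix J K x assume J: "ideal J ?L" and K: "ideal K ?L" and x: "x \<in> J"
      and le: "\<And>r. r \<in> carrier P \<Longrightarrow> ?f r \<one>\<^bsub>P\<^esub> \<in> J \<Longrightarrow> ?f r \<one>\<^bsub>P\<^esub> \<in> K"
    obtain p t where p: "p \<in> carrier P" and t: "t \<in> T" and xe: "x = ?f p t"
      using localization_carrierE[OF ideal_closed(2)[OF J x]] by blast
    have "?f t \<one>\<^bsub>P\<^esub> \<otimes>\<^bsub>?L\<^esub> x = ?f p \<one>\<^bsub>P\<^esub>"
      using p t Tc[OF t] cancel(1)[OF p T.one_closed t] by (simp add: xe ops)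
    then have "?f p \<one>\<^bsub>P\<^esub> \<in> J"
      using ideal_closed(5)[OF J x, of "?f t \<one>\<^bsub>P\<^esub>"] Tc[OF t] by (simp add: fraction_carrier)
    then have "?f p \<one>\<^bsub>P\<^esub> \<in> K" by (rule le[OF p])
    then have "?f \<one>\<^bsub>P\<^esub> t \<otimes>\<^bsub>?L\<^esub> ?f p \<one>\<^bsub>P\<^esub> \<in> K"
      using t by (intro ideal_closed(5)[OF K]) (auto simp: fraction_carrier)
    then show "x \<in> K" using p t Tc[OF t] by (simp add: xe ops)
  qed
qed

lemma fraction_linear:
  assumes P: "algebra A P" and T: "submonoid T P" and t: "t \<in> T"
  shows "(\<lambda>p. fraction P T p t) \<in> linear_maps A P (localization P T)"
proof -
  interpret P: algebra A P by fact
  interpret T: submonoid T P by fact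
  have tc: "t \<in> carrier P" using t T.subset by auto
  have "fraction P T (p \<oplus>\<^bsub>P\<^esub> q) t = fraction P T (p \<otimes>\<^bsub>P\<^esub> t \<oplus>\<^bsub>P\<^esub> q \<otimes>\<^bsub>P\<^esub> t) (t \<otimes>\<^bsub>P\<^esub> t)"
    if "p \<in> carrier P" "q \<in> carrier P" for p q
    using fraction_cancel(2)[OF P.M_cring T P.M.a_closed[OF that] t t] that tc by (simp add: P.l_distr)
  then show ?thesis
    using t by (auto simp: linear_maps_def fraction_carrier localization_ops[OF P T])
qed

text \<open>In the inductive step the old numerators are multiplied by the new denominator
  \<open>s\<close>, and the new one by the old denominator \<open>t\<close>.\<close>

lemma common_denominator:
  assumes P: "algebra A P" and T: "submonoid T P" and b: "b \<in> {..<n::nat} \<rightarrow> carrier (localization P T)"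
  shows "\<exists>t\<in>T. \<exists>q\<in>{..<n} \<rightarrow> carrier P. \<forall>i<n. b i = fraction P T (q i) t"
  using b
proof (induction n)
  case 0
  interpret T: submonoid T P by fact
  show ?case by (auto intro: T.one_closed)
next
  case (Suc n)
  interpret P: algebra A P by fact
  interpret T: submonoid T P by fact
  have Tc: "t \<in> carrier P" if "t \<in> T" for t using that T.subset by auto
  note cancel = fraction_cancel[OF P.M_cring T]
  obtain t q where t: "t \<in> T" and q: "q \<in> {..<n} \<rightarrow> carrier P" and bq: "\<forall>i<n. b i = fraction P T (q i) t"
    using Suc.IH Suc.prems by (auto simp: Pi_def)
  have "b n \<in> carrier (localization P T)" using Suc.prems by auto
  then obtain p s where p: "p \<in> carrier P" and s: "s \<in> T" and bn: "b n = fraction P T p s"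
    by (rule localization_carrierE)
  let ?q = "\<lambda>i. if i < n then q i \<otimes>\<^bsub>P\<^esub> s else t \<otimes>\<^bsub>P\<^esub> p"
  have "b i = fraction P T (?q i) (t \<otimes>\<^bsub>P\<^esub> s)" if "i < Suc n" for i
  proof (cases "i < n")
    case True
    then have "q i \<in> carrier P" using q by auto
    then show ?thesis using cancel(2)[of "q i" t s] True bq t s by simp
  next
    case False
    then have "i = n" using that by simp
    then show ?thesis using cancel(1)[OF p s t] bn by simp
  qed
  moreover have "?q \<in> {..<Suc n} \<rightarrow> carrier P" using q p Tc[OF t] Tc[OF s] by (auto simp: Pi_def)
  ultimately show ?case using t s by (intro bexI[of _ "t \<otimes>\<^bsub>P\<^esub> s"] bexI[of _ ?q]) auto
qed

lemma smult_mult_right: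
  assumes "algebra A P" "a \<in> carrier A" "p \<in> carrier P" "q \<in> carrier P"
  shows "p \<otimes>\<^bsub>P\<^esub> (a \<odot>\<^bsub>P\<^esub> q) = a \<odot>\<^bsub>P\<^esub> (p \<otimes>\<^bsub>P\<^esub> q)"
proof -
  interpret P: algebra A P by fact
  show ?thesis using assms by (metis P.m_comm P.smult_assoc2 P.smult_closed)
qed

lemma mult_linear:
  assumes "algebra A P" "r \<in> carrier P"
  shows "(\<lambda>p. r \<otimes>\<^bsub>P\<^esub> p) \<in> linear_maps A P P"
proof -
  interpret P: algebra A P by fact
  show ?thesis
    using assms(2) by (auto simp: linear_maps_def P.r_distr smult_mult_right[OF assms(1)])
qed

lemma linear_maps_relation:
  assumes M: "module A M" and N: "module A N" and f: "f \<in> linear_maps A M N"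
    and "finite X" "a \<in> X \<rightarrow> carrier A" "b \<in> X \<rightarrow> carrier M"
  shows "f (\<Oplus>\<^bsub>M\<^esub>i\<in>X. a i \<odot>\<^bsub>M\<^esub> b i) = (\<Oplus>\<^bsub>N\<^esub>i\<in>X. a i \<odot>\<^bsub>N\<^esub> f (b i))"
proof -
  interpret M: module A M by fact
  interpret N: module A N by fact
  have "f (\<Oplus>\<^bsub>M\<^esub>i\<in>X. a i \<odot>\<^bsub>M\<^esub> b i) = (\<Oplus>\<^bsub>N\<^esub>i\<in>X. f (a i \<odot>\<^bsub>M\<^esub> b i))"
    using assms(5,6) by (intro linear_maps_finsum[OF M N f assms(4)]) auto
  also have "\<dots> = (\<Oplus>\<^bsub>N\<^esub>i\<in>X. a i \<odot>\<^bsub>N\<^esub> f (b i))"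
    using assms(5,6) linear_mapsD[OF f] by (intro N.M.finsum_cong') (auto simp: Pi_def)
  finally show ?thesis .
qed

text \<open>Over a common denominator the sum of the numerators is annihilated only after
  multiplication by some \<open>u\<close> in \<open>T\<close>. The relation among the numerators
  times \<open>u\<close> is trivial in \<open>P\<close>.\<close>

lemma equationally_flat_localization:
  assumes P: "algebra A P" and flat: "equationally_flat A P" and T: "submonoid T P"
  shows "equationally_flat A (localization P T)"
  unfolding equationally_flat_def
proof (intro allI impI, elim conjE)
  interpret P: algebra A P by fact
  interpret T: submonoid T P by fact
  let ?L = "localization P T" and ?f = "fraction P T"
  interpret L: algebra A ?L by (rule algebra_localization[OF P T])
  have Tc: "t \<in> carrier P" if "t \<in> T" for t using that T.subset by auto
  note lin = fraction_linear[OF P T]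
  fix n :: nat and a b
  assume a: "a \<in> {..<n} \<rightarrow> carrier A" and b: "b \<in> {..<n} \<rightarrow> carrier ?L"
    and eq: "(\<Oplus>\<^bsub>?L\<^esub>i\<in>{..<n}. a i \<odot>\<^bsub>?L\<^esub> b i) = \<zero>\<^bsub>?L\<^esub>"
  obtain t q where t: "t \<in> T" and q: "q \<in> {..<n} \<rightarrow> carrier P" and bq: "\<forall>i<n. b i = ?f (q i) t"
    using common_denominator[OF P T b] by blast
  let ?s = "\<Oplus>\<^bsub>P\<^esub>i\<in>{..<n}. a i \<odot>\<^bsub>P\<^esub> q i"
  have s: "?s \<in> carrier P" using a q by (intro P.M.finsum_closed) auto
  have "?f ?s t = (\<Oplus>\<^bsub>?L\<^esub>i\<in>{..<n}. a i \<odot>\<^bsub>?L\<^esub> ?f (q i) t)"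
    by (rule linear_maps_relation[OF P.module L.module lin[OF t] _ a q]) simp
  also have "\<dots> = (\<Oplus>\<^bsub>?L\<^esub>i\<in>{..<n}. a i \<odot>\<^bsub>?L\<^esub> b i)"
    using a b bq by (intro L.M.finsum_cong') auto
  finally have "?f ?s t = ?f \<zero>\<^bsub>P\<^esub> \<one>\<^bsub>P\<^esub>" by (simp add: eq localization_one_zero)
  then obtain u where u: "u \<in> T" "u \<otimes>\<^bsub>P\<^esub> ?s = \<zero>\<^bsub>P\<^esub>"
    using s t Tc by (auto simp: fraction_eq_iff[OF P.M_cring T])
  have "(\<Oplus>\<^bsub>P\<^esub>i\<in>{..<n}. a i \<odot>\<^bsub>P\<^esub> (u \<otimes>\<^bsub>P\<^esub> q i)) = \<zero>\<^bsub>P\<^esub>"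
    using linear_maps_relation[OF P.module P.module mult_linear[OF P Tc[OF u(1)]] _ a q] u(2) by simp
  moreover have "(\<lambda>i. u \<otimes>\<^bsub>P\<^esub> q i) \<in> {..<n} \<rightarrow> carrier P" using q Tc[OF u(1)] by auto
  ultimately have "trivial_relation A P {..<n} {a} (\<lambda>i. u \<otimes>\<^bsub>P\<^esub> q i)"
    using flat a unfolding equationally_flat_def by blast
  \<comment> \<open>Division by \<open>u t\<close> returns from the numerators multiplied by
    \<open>u\<close> to the given fractions.\<close>
  from trivial_relation_linear_map[OF P.module L.module lin[OF T.m_closed[OF u(1) t]] this]
  show "trivial_relation A ?L {..<n} {a} b"
  proof (rule trivial_relation_cong[OF L.module])
    fix i assume "i \<in> {..<n}"
    then have "q i \<in> carrier P" "b i = ?f (q i) t" using q bq by auto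
    then show "b i = ?f (u \<otimes>\<^bsub>P\<^esub> q i) (u \<otimes>\<^bsub>P\<^esub> t)"
      using fraction_cancel(1)[OF P.M_cring T _ t u(1)] by simp
  qed
qed

lemma localization_map:
  assumes P: "algebra A P" and B: "algebra A B" and h: "h \<in> alg_hom A P B"
    and T: "submonoid T P" and S: "submonoid S B" and hT: "\<And>t. t \<in> T \<Longrightarrow> h t \<in> S"
  shows "\<exists>g\<in>alg_hom A (localization P T) (localization B S).
    \<forall>p\<in>carrier P. \<forall>t\<in>T. g (fraction P T p t) = fraction B S (h p) (h t)"
proof -
  interpret P: algebra A P by fact
  interpret B: algebra A B by fact
  interpret T: submonoid T P by fact
  interpret S: submonoid S B by fact
  have Tc: "t \<in> carrier P" if "t \<in> T" for t using that T.subset by auto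
  note hD = alg_homD[OF h]
  have wd: "fraction B S (h p) (h t) = fraction B S (h p') (h t')"
    if eq: "fraction P T p t = fraction P T p' t'" and p: "p \<in> carrier P" "p' \<in> carrier P"
      and t: "t \<in> T" "t' \<in> T" for p t p' t'
  proof -
    obtain u where u: "u \<in> T" "u \<otimes>\<^bsub>P\<^esub> (p \<otimes>\<^bsub>P\<^esub> t') = u \<otimes>\<^bsub>P\<^esub> (p' \<otimes>\<^bsub>P\<^esub> t)"
      using fraction_eq_iff[OF P.M_cring T p(1) t(1) p(2) t(2)] eq by auto
    have "h (u \<otimes>\<^bsub>P\<^esub> (p \<otimes>\<^bsub>P\<^esub> t')) = h (u \<otimes>\<^bsub>P\<^esub> (p' \<otimes>\<^bsub>P\<^esub> t))" by (simp only: u(2))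
    then have "h u \<otimes>\<^bsub>B\<^esub> (h p \<otimes>\<^bsub>B\<^esub> h t') = h u \<otimes>\<^bsub>B\<^esub> (h p' \<otimes>\<^bsub>B\<^esub> h t)"
      using p t u(1) Tc by (simp add: hD)
    then show ?thesis
      using fraction_eq_iff[OF B.M_cring S hD(1)[OF p(1)] hT[OF t(1)] hD(1)[OF p(2)] hT[OF t(2)]] hT[OF u(1)]
      by blast
  qed
  \<comment> \<open>A chosen representative pair; \<open>wd\<close> shows that the choice does not
    affect \<open>g\<close>.\<close>
  define c where "c K = (SOME x. x \<in> carrier P \<times> T \<and> K = fraction P T (fst x) (snd x))" for K
  define g where "g K = fraction B S (h (fst (c K))) (h (snd (c K)))" for K
  have g: "g (fraction P T p t) = fraction B S (h p) (h t)" if "p \<in> carrier P" "t \<in> T" for p t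
  proof -
    let ?K = "fraction P T p t"
    have "c ?K \<in> carrier P \<times> T \<and> ?K = fraction P T (fst (c ?K)) (snd (c ?K))"
      unfolding c_def by (rule someI[of _ "(p, t)"]) (use that in simp)
    then show ?thesis
      unfolding g_def using that by (intro wd) auto
  qed
  note opsP = localization_ops[OF P T] and opsB = localization_ops[OF B S]
  have "g \<in> alg_hom A (localization P T) (localization B S)"
  proof (rule alg_homI)
    show "g \<one>\<^bsub>localization P T\<^esub> = \<one>\<^bsub>localization B S\<^esub>"
      by (simp add: localization_one_zero g hD)
  next
    fix x assume "x \<in> carrier (localization P T)"
    then obtain p t where x: "p \<in> carrier P" "t \<in> T" "x = fraction P T p t" by (rule localization_carrierE)
    then show "g x \<in> carrier (localization B S)" by (simp add: g hD hT fraction_carrier)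
    fix a assume "a \<in> carrier A"
    then show "g (a \<odot>\<^bsub>localization P T\<^esub> x) = a \<odot>\<^bsub>localization B S\<^esub> g x"
      using x by (simp add: g hD hT opsP opsB)
  next
    fix x y assume "x \<in> carrier (localization P T)" "y \<in> carrier (localization P T)"
    then obtain p t q u where x: "p \<in> carrier P" "t \<in> T" "x = fraction P T p t"
      and y: "q \<in> carrier P" "u \<in> T" "y = fraction P T q u" by (elim localization_carrierE)
    then show "g (x \<otimes>\<^bsub>localization P T\<^esub> y) = g x \<otimes>\<^bsub>localization B S\<^esub> g y"
      and "g (x \<oplus>\<^bsub>localization P T\<^esub> y) = g x \<oplus>\<^bsub>localization B S\<^esub> g y"
      using Tc by (simp_all add: g hD hT opsP opsB)
  qed
  then show ?thesis using g by blast
qed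

text \<open>Localization is applied to a flat noetherian algebra that maps onto the finitely
  generated one. The element type of P is built from \<open>'a\<close> alone, whatever the type of
  the elements of that algebra.\<close>

theorem essentially_of_finite_type_presentation:
  fixes A :: "('a, 'k) ring_scheme" and B :: "('a, 'b, 'l) module_scheme"
  assumes A: "cring A" "noetherian_ring A" and B: "essentially_of_finite_type TYPE('c) A B"
  shows "\<exists>(P :: ('a, ('a nested \<times> 'a nested) set) module) h.
    noetherian_flat_algebra A P \<and> h \<in> alg_hom A P B \<and> h ` carrier P = carrier B"
proof -
  obtain B0 :: "('a, 'c) module" and S f where fg: "finitely_generated_algebra A B0"
    and S: "submonoid S B0" and f: "f \<in> alg_iso A (localization B0 S) B"
    using B by (auto simp: essentially_of_finite_type_def)
  obtain P0 :: "('a, 'a nested) module" and h where P0: "noetherian_flat_algebra A P0"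
    and h: "h \<in> alg_hom A P0 B0" and surj: "h ` carrier P0 = carrier B0"
    using finitely_generated_presentation[OF A fg] by blast
  have algB0: "algebra A B0" using fg by (simp add: finitely_generated_algebra_def)
  have algP0: "algebra A P0" using P0 by (simp add: noetherian_flat_algebra_def)
  interpret P0: algebra A P0 by (rule algP0)
  interpret B0: algebra A B0 by (rule algB0)
  interpret S: submonoid S B0 by (rule S)
  \<comment> \<open>The full preimage of \<open>S\<close>: its elements map to allowed denominators,
    and every denominator in \<open>S\<close> is hit, so the induced map of localizations is defined
    and surjective.\<close>
  define T where "T = {t \<in> carrier P0. h t \<in> S}"
  have T: "submonoid T P0"
    by (rule submonoid.intro) (auto simp: T_def alg_homD[OF h])
  have algL: "algebra A (localization P0 T)" by (rule algebra_localization[OF algP0 T])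
  have L: "noetherian_flat_algebra A (localization P0 T)"
    using P0 algL noetherian_localization[OF algP0 _ T] equationally_flat_localization[OF algP0 _ T]
    by (simp add: noetherian_flat_algebra_def)
  obtain g where g: "g \<in> alg_hom A (localization P0 T) (localization B0 S)"
    and gf: "\<And>p t. p \<in> carrier P0 \<Longrightarrow> t \<in> T \<Longrightarrow> g (fraction P0 T p t) = fraction B0 S (h p) (h t)"
    using localization_map[OF algP0 algB0 h T S] by (auto simp: T_def)
  have fh: "f \<in> alg_hom A (localization B0 S) B" and fs: "f ` carrier (localization B0 S) = carrier B"
    using f by (auto simp: alg_iso_def bij_betw_def)
  have "carrier (localization B0 S) \<subseteq> g ` carrier (localization P0 T)"
  proof
    fix x assume "x \<in> carrier (localization B0 S)"
    then obtain r s where r: "r \<in> carrier B0" and s: "s \<in> S" and x: "x = fraction B0 S r s"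
      by (rule localization_carrierE)
    have "s \<in> carrier B0" using s S.subset by auto
    then obtain p t where p: "p \<in> carrier P0" "r = h p" and t: "t \<in> carrier P0" "s = h t"
      using r surj by blast
    then have "t \<in> T" using s by (simp add: T_def)
    then show "x \<in> g ` carrier (localization P0 T)"
      using gf[OF p(1)] p t x by (intro image_eqI[of _ _ "fraction P0 T p t"]) (auto simp: fraction_carrier)
  qed
  then have "g ` carrier (localization P0 T) = carrier (localization B0 S)"
    using alg_homD(1)[OF g] by blast
  then have "(\<lambda>x. f (g x)) ` carrier (localization P0 T) = carrier B"
    using fs by (simp add: image_image[symmetric])
  then show ?thesis using L alg_hom_comp[OF fh g] by blast
qed


section \<open>Formal smoothness and flatness\<close>

lemma quotient_projection:
  assumes "algebra A C" "ideal N C"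
  shows "(\<lambda>x. N +>\<^bsub>C\<^esub> x) \<in> alg_hom A C (quotient_algebra C N)"
  by (rule alg_homI)
    (simp_all add: quotient_coset_closed quotient_coset_ops[OF assms] smult_coset[OF assms] quotient_algebra_sel(4))

lemma alg_hom_factor:
  assumes P: "algebra A P" and h: "h \<in> alg_hom A P B" and surj: "h ` carrier P = carrier B"
    and q: "q \<in> alg_hom A P D"
    and le: "\<And>x y. x \<in> carrier P \<Longrightarrow> y \<in> carrier P \<Longrightarrow> h x = h y \<Longrightarrow> q x = q y"
  shows "\<exists>u\<in>alg_hom A B D. \<forall>p\<in>carrier P. u (h p) = q p"
proof -
  interpret P: algebra A P by fact
  let ?g = "inv_into (carrier P) h"
  have g: "?g b \<in> carrier P" "h (?g b) = b" if "b \<in> carrier B" for b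
    using that surj inv_into_into[of b h "carrier P"] f_inv_into_f[of b h "carrier P"] by auto
  have u: "q (?g (h p)) = q p" if "p \<in> carrier P" for p
    using that by (intro le g alg_homD(1)[OF h])
  have B: thesis if "b \<in> carrier B" "\<And>p. p \<in> carrier P \<Longrightarrow> b = h p \<Longrightarrow> thesis" for b thesis
    using that surj by blast
  have "(\<lambda>b. q (?g b)) \<in> alg_hom A B D"
  proof (rule alg_homI)
    show "q (?g \<one>\<^bsub>B\<^esub>) = \<one>\<^bsub>D\<^esub>" using u[of "\<one>\<^bsub>P\<^esub>"] by (simp add: alg_homD(4)[OF h] alg_homD(4)[OF q])
  next
    fix x assume "x \<in> carrier B"
    then obtain p where p: "p \<in> carrier P" "x = h p" by (rule B)
    then show "q (?g x) \<in> carrier D" by (simp add: u alg_homD(1)[OF q])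
    fix a assume "a \<in> carrier A"
    then show "q (?g (a \<odot>\<^bsub>B\<^esub> x)) = a \<odot>\<^bsub>D\<^esub> q (?g x)"
      using p u[of "a \<odot>\<^bsub>P\<^esub> p"] by (simp add: u alg_homD(5)[OF h] alg_homD(5)[OF q])
  next
    fix x y assume "x \<in> carrier B" "y \<in> carrier B"
    then obtain p r where p: "p \<in> carrier P" "x = h p" and r: "r \<in> carrier P" "y = h r"
      by (elim B)
    then show "q (?g (x \<otimes>\<^bsub>B\<^esub> y)) = q (?g x) \<otimes>\<^bsub>D\<^esub> q (?g y)" "q (?g (x \<oplus>\<^bsub>B\<^esub> y)) = q (?g x) \<oplus>\<^bsub>D\<^esub> q (?g y)"
      using u[of "p \<otimes>\<^bsub>P\<^esub> r"] u[of "p \<oplus>\<^bsub>P\<^esub> r"]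
      by (simp_all add: u alg_homD(2,3)[OF h] alg_homD(2,3)[OF q])
  qed
  then show ?thesis using u by (intro bexI[of _ "\<lambda>b. q (?g b)"] ballI)
qed

text \<open>The test algebra is C = P / I^(n+1) with the nilpotent ideal N = I / I^(n+1), and C / N
  is B. A lift of this identification is a section of C \<rightarrow> B, stated here through
  representatives: whatever represents \<open>v b\<close> in \<open>P\<close> maps to
  \<open>b\<close>.\<close>

lemma formally_smooth_lift:
  fixes P :: "('a, 'p) module"
  assumes P: "algebra A P" and B: "algebra A B" and h: "h \<in> alg_hom A P B"
    and surj: "h ` carrier P = carrier B" and smooth: "formally_smooth A B"
    and I_def: "I = {p \<in> carrier P. h p = \<zero>\<^bsub>B\<^esub>}"
  shows "\<exists>v\<in>alg_hom A B (quotient_algebra P (ideal_pow P I (Suc n))).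
    \<forall>p\<in>carrier P. \<forall>b\<in>carrier B. v b = ideal_pow P I (Suc n) +>\<^bsub>P\<^esub> p \<longrightarrow> h p = b"
proof -
  interpret P: algebra A P by fact
  interpret B: algebra A B by fact
  interpret H: ring_hom_cring P B h
    by (rule ring_hom_cringI[OF P.M_cring B.M_cring alg_hom_ring_hom[OF h]])
  have I: "ideal I P"
    using ideal_vimage[OF P.M_cring B.M_cring alg_hom_ring_hom[OF h] B.zeroideal] by (simp add: I_def)
  \<comment> \<open>A positive exponent is required as the bound for nilpotency, and it ensures that
    \<open>J\<close> is contained in \<open>I\<close>.\<close>
  define J where J_eq: "J = ideal_pow P I (Suc n)"
  have J: "ideal J P" unfolding J_eq by (rule P.ideal_pow_ideal[OF I])
  have JI: "J \<subseteq> I" using P.ideal_prod_inter[OF I P.ideal_pow_ideal[OF I]] by (auto simp: J_eq)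
  let ?C = "quotient_algebra P J"
  have C: "algebra A ?C" by (rule algebra_quotient[OF P J])
  interpret C: algebra A ?C by (rule C)
  define \<pi> where "\<pi> p = J +>\<^bsub>P\<^esub> p" for p
  have \<pi>: "\<pi> \<in> alg_hom A P ?C"
    unfolding \<pi>_def by (rule quotient_projection[OF P J])
  interpret pi: ring_hom_cring P ?C \<pi>
    by (rule ring_hom_cringI[OF P.M_cring C.M_cring alg_hom_ring_hom[OF \<pi>]])
  have \<pi>_eq: "\<pi> x = \<pi> y \<longleftrightarrow> x \<ominus>\<^bsub>P\<^esub> y \<in> J" if "x \<in> carrier P" "y \<in> carrier P" for x y
    unfolding \<pi>_def by (rule coset_eq_iff[OF P J that])
  have \<pi>_surj: thesis if "K \<in> carrier ?C" "\<And>p. p \<in> carrier P \<Longrightarrow> K = \<pi> p \<Longrightarrow> thesis" for K thesis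
    using quotient_carrierE[OF that(1)] that(2) unfolding \<pi>_def by blast
  have Ic: "x \<in> carrier P" if "x \<in> I" for x using that by (simp add: I_def)
  define N where "N = \<pi> ` I"
  have N: "ideal N ?C"
  proof (rule cring_idealI[OF C.M_cring])
    show "N \<subseteq> carrier ?C" using Ic by (auto simp: N_def)
    show "\<zero>\<^bsub>?C\<^esub> \<in> N"
      unfolding N_def by (rule image_eqI[of _ _ "\<zero>\<^bsub>P\<^esub>"]) (simp_all add: ideal_closed(1)[OF I])
    fix x y assume "x \<in> N" "y \<in> N"
    then obtain p q where "p \<in> I" "q \<in> I" "x = \<pi> p" "y = \<pi> q" by (auto simp: N_def)
    then show "x \<oplus>\<^bsub>?C\<^esub> y \<in> N"
      using ideal_closed(3)[OF I, of p q] Ic image_eqI[of _ \<pi> "p \<oplus>\<^bsub>P\<^esub> q" I] by (simp add: N_def)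
  next
    fix r x assume "r \<in> carrier ?C" "x \<in> N"
    then obtain s p where "s \<in> carrier P" "p \<in> I" "r = \<pi> s" "x = \<pi> p" by (auto simp: N_def elim: \<pi>_surj)
    then show "r \<otimes>\<^bsub>?C\<^esub> x \<in> N"
      using ideal_closed(5)[OF I, of p s] Ic image_eqI[of _ \<pi> "s \<otimes>\<^bsub>P\<^esub> p" I] by (simp add: N_def)
  qed
  let ?q = "\<lambda>p. N +>\<^bsub>?C\<^esub> \<pi> p"
  have q: "?q \<in> alg_hom A P (quotient_algebra ?C N)"
    by (rule alg_hom_comp[OF quotient_projection[OF C N] \<pi>])
  \<comment> \<open>The composite of the two projections has kernel \<open>I\<close>, as
    \<open>h\<close> does; hence it factors through \<open>B\<close>, and the factor is
    injective.\<close>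
  have q_eq: "?q x = ?q y \<longleftrightarrow> h x = h y" if xy: "x \<in> carrier P" "y \<in> carrier P" for x y
  proof -
    have "?q x = ?q y \<longleftrightarrow> \<pi> x \<ominus>\<^bsub>?C\<^esub> \<pi> y \<in> N"
      using xy by (intro coset_eq_iff[OF C N]) simp_all
    also have "\<pi> x \<ominus>\<^bsub>?C\<^esub> \<pi> y = \<pi> (x \<ominus>\<^bsub>P\<^esub> y)" using xy by (simp add: a_minus_def)
    also have "\<pi> (x \<ominus>\<^bsub>P\<^esub> y) \<in> N \<longleftrightarrow> x \<ominus>\<^bsub>P\<^esub> y \<in> I"
    proof
      assume "\<pi> (x \<ominus>\<^bsub>P\<^esub> y) \<in> N"
      then obtain r where r: "r \<in> I" "\<pi> (x \<ominus>\<^bsub>P\<^esub> y) = \<pi> r" by (auto simp: N_def)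
      then have "(x \<ominus>\<^bsub>P\<^esub> y) \<ominus>\<^bsub>P\<^esub> r \<in> I" using \<pi>_eq[of "x \<ominus>\<^bsub>P\<^esub> y" r] xy Ic JI by auto
      from ideal_closed(3)[OF I r(1) this] show "x \<ominus>\<^bsub>P\<^esub> y \<in> I"
        using P.M.add_minus_cancel[of "x \<ominus>\<^bsub>P\<^esub> y" r] xy Ic[OF r(1)] by simp
    qed (simp add: N_def)
    also have "x \<ominus>\<^bsub>P\<^esub> y \<in> I \<longleftrightarrow> h x \<ominus>\<^bsub>B\<^esub> h y = \<zero>\<^bsub>B\<^esub>" using xy by (simp add: I_def a_minus_def)
    also have "\<dots> \<longleftrightarrow> h x = h y" using xy by (intro B.M.minus_eq_zero_iff) simp_all
    finally show ?thesis .
  qed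
  obtain u where u: "u \<in> alg_hom A B (quotient_algebra ?C N)"
    and uq: "\<And>p. p \<in> carrier P \<Longrightarrow> u (h p) = ?q p"
    using alg_hom_factor[OF P h surj q] q_eq by auto
  have pow: "ideal_pow ?C N k \<subseteq> \<pi> ` ideal_pow P I k" for k
  proof (induction k)
    case 0
    show ?case by (auto elim: \<pi>_surj)
  next
    case (Suc k)
    have c: "x \<in> carrier P" if "x \<in> ideal_pow P I k" for k x
      using ideal_closed(2)[OF P.ideal_pow_ideal[OF I] that] .
    show ?case
    proof
      fix x assume "x \<in> ideal_pow ?C N (Suc k)"
      then have "x \<in> ideal_prod ?C N (ideal_pow ?C N k)" by simp
      then show "x \<in> \<pi> ` ideal_pow P I (Suc k)"
      proof induction
        case (prod i j)
        then obtain p q where pq: "p \<in> I" "q \<in> ideal_pow P I k" "i = \<pi> p" "j = \<pi> q"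
          using Suc by (auto simp: N_def)
        then have "i \<otimes>\<^bsub>?C\<^esub> j = \<pi> (p \<otimes>\<^bsub>P\<^esub> q)" using Ic c[OF pq(2)] by simp
        then show ?case using ideal_prod.prod[OF pq(1,2), of P] by auto
      next
        case (sum s t)
        then obtain p q where pq: "p \<in> ideal_pow P I (Suc k)" "q \<in> ideal_pow P I (Suc k)" "s = \<pi> p" "t = \<pi> q"
          by blast
        then have "s \<oplus>\<^bsub>?C\<^esub> t = \<pi> (p \<oplus>\<^bsub>P\<^esub> q)" using c[OF pq(1)] c[OF pq(2)] by simp
        then show ?case using ideal_closed(3)[OF P.ideal_pow_ideal[OF I] pq(1,2)] by blast
      qed
    qed
  qed
  have "ideal_pow ?C N (Suc n) = {\<zero>\<^bsub>?C\<^esub>}"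
  proof
    have "\<pi> x = \<zero>\<^bsub>?C\<^esub>" if "x \<in> J" for x
      using \<pi>_eq[of x "\<zero>\<^bsub>P\<^esub>"] that ideal_closed(2)[OF J that] by (simp add: P.minus_eq)
    then show "ideal_pow ?C N (Suc n) \<subseteq> {\<zero>\<^bsub>?C\<^esub>}" using pow[of "Suc n", folded J_eq] by blast
    show "{\<zero>\<^bsub>?C\<^esub>} \<subseteq> ideal_pow ?C N (Suc n)"
      using ideal_closed(1)[OF C.ideal_pow_ideal[OF N]] by blast
  qed
  \<comment> \<open>The elements of the test algebra are cosets of type \<open>'p set\<close>, a
    type reached by \<open>formally_smooth_imp_wrt\<close>.\<close>
  then obtain v where v: "v \<in> alg_hom A B ?C" and vu: "\<And>b. b \<in> carrier B \<Longrightarrow> N +>\<^bsub>?C\<^esub> v b = u b"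
    using formally_smooth_imp_wrt[OF smooth, where 'c = "'p set"] C N u
    unfolding formally_smooth_wrt_def by (metis One_nat_def Suc_le_mono zero_le)
  have "h p = b" if p: "p \<in> carrier P" and b: "b \<in> carrier B" and "v b = \<pi> p" for p b
  proof -
    obtain r where r: "r \<in> carrier P" "b = h r" using b surj by blast
    have "?q p = ?q r" using vu[OF b] uq[OF r(1)] \<open>v b = \<pi> p\<close> r(2) by simp
    then show ?thesis using q_eq[OF p r(1)] r(2) by simp
  qed
  then show ?thesis unfolding J_eq[symmetric] by (intro bexI[OF _ v] ballI impI) (simp add: \<pi>_def)
qed

theorem equationally_flat_formally_smooth_quotient:
  fixes P :: "('a, 'p) module"
  assumes P: "noetherian_flat_algebra A P" and B: "algebra A B" and h: "h \<in> alg_hom A P B"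
    and surj: "h ` carrier P = carrier B" and smooth: "formally_smooth A B"
  shows "equationally_flat A B"
  unfolding equationally_flat_def
proof (intro allI impI, elim conjE)
  have algP: "algebra A P" and noeth: "noetherian_ring P" and flat: "equationally_flat A P"
    using P by (auto simp: noetherian_flat_algebra_def)
  interpret P: algebra A P by (rule algP)
  interpret B: algebra A B by fact
  interpret H: ring_hom_cring P B h
    by (rule ring_hom_cringI[OF P.M_cring B.M_cring alg_hom_ring_hom[OF h]])
  fix n :: nat and a b
  assume a: "a \<in> {..<n} \<rightarrow> carrier A" and b: "b \<in> {..<n} \<rightarrow> carrier B"
    and eq: "(\<Oplus>\<^bsub>B\<^esub>i\<in>{..<n}. a i \<odot>\<^bsub>B\<^esub> b i) = \<zero>\<^bsub>B\<^esub>"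
  define I where "I = {p \<in> carrier P. h p = \<zero>\<^bsub>B\<^esub>}"
  have I: "ideal I P"
    using ideal_vimage[OF P.M_cring B.M_cring alg_hom_ring_hom[OF h] B.zeroideal] by (simp add: I_def)
  have ac: "a i \<in> carrier A" if "i < n" for i using a that by auto
  define \<sigma> where "\<sigma> p = (\<Oplus>\<^bsub>P\<^esub>i\<in>{..<n}. a i \<odot>\<^bsub>P\<^esub> p i)" for p
  have \<sigma>_closed: "\<sigma> p \<in> carrier P" if "p \<in> {..<n} \<rightarrow> carrier P" for p
    unfolding \<sigma>_def using a that by (intro P.M.finsum_closed) auto
  have \<sigma>_add: "\<sigma> p \<oplus>\<^bsub>P\<^esub> \<sigma> q = \<sigma> (\<lambda>i. p i \<oplus>\<^bsub>P\<^esub> q i)"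
    if "p \<in> {..<n} \<rightarrow> carrier P" "q \<in> {..<n} \<rightarrow> carrier P" for p q
  proof -
    have "\<sigma> p \<oplus>\<^bsub>P\<^esub> \<sigma> q = (\<Oplus>\<^bsub>P\<^esub>i\<in>{..<n}. a i \<odot>\<^bsub>P\<^esub> p i \<oplus>\<^bsub>P\<^esub> a i \<odot>\<^bsub>P\<^esub> q i)"
      unfolding \<sigma>_def using a that by (intro P.M.finsum_addf[symmetric]) auto
    also have "\<dots> = \<sigma> (\<lambda>i. p i \<oplus>\<^bsub>P\<^esub> q i)"
      unfolding \<sigma>_def using a that by (intro P.M.finsum_cong') (auto simp: P.smult_r_distr Pi_def)
    finally show ?thesis .
  qed
  have \<sigma>_mult: "r \<otimes>\<^bsub>P\<^esub> \<sigma> p = \<sigma> (\<lambda>i. r \<otimes>\<^bsub>P\<^esub> p i)"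
    if "r \<in> carrier P" "p \<in> {..<n} \<rightarrow> carrier P" for r p
    unfolding \<sigma>_def
    by (rule linear_maps_relation[OF P.module P.module mult_linear[OF algP that(1)] _ a that(2)]) simp
  \<comment> \<open>The ideal that the coefficients \<open>a i\<close> generate in \<open>P\<close>,
    as the set of values of \<sigma>.\<close>
  define M where "M = \<sigma> ` ({..<n} \<rightarrow> carrier P)"
  have M: "ideal M P"
  proof (rule cring_idealI[OF P.M_cring])
    show "M \<subseteq> carrier P" using \<sigma>_closed by (auto simp: M_def)
    have "\<sigma> (\<lambda>_. \<zero>\<^bsub>P\<^esub>) = \<zero>\<^bsub>P\<^esub>"
      using \<sigma>_mult[of "\<zero>\<^bsub>P\<^esub>" "\<lambda>_. \<zero>\<^bsub>P\<^esub>"] \<sigma>_closed[of "\<lambda>_. \<zero>\<^bsub>P\<^esub>"] by simp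
    then show "\<zero>\<^bsub>P\<^esub> \<in> M" unfolding M_def by (intro image_eqI[of _ _ "\<lambda>_. \<zero>\<^bsub>P\<^esub>"]) auto
    fix x y assume "x \<in> M" "y \<in> M"
    then obtain p q where pq: "p \<in> {..<n} \<rightarrow> carrier P" "q \<in> {..<n} \<rightarrow> carrier P" "x = \<sigma> p" "y = \<sigma> q"
      by (auto simp: M_def)
    then show "x \<oplus>\<^bsub>P\<^esub> y \<in> M" unfolding M_def
      by (intro image_eqI[of _ _ "\<lambda>i. p i \<oplus>\<^bsub>P\<^esub> q i"]) (auto simp: \<sigma>_add)
  next
    fix r x assume r: "r \<in> carrier P" and "x \<in> M"
    then obtain p where "p \<in> {..<n} \<rightarrow> carrier P" "x = \<sigma> p" by (auto simp: M_def)
    then show "r \<otimes>\<^bsub>P\<^esub> x \<in> M" unfolding M_def using r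
      by (intro image_eqI[of _ _ "\<lambda>i. r \<otimes>\<^bsub>P\<^esub> p i"]) (auto simp: \<sigma>_mult)
  qed
  \<comment> \<open>The exponent depends on the coefficients of the relation, so the lift
    \<open>v\<close> is chosen only afterwards.\<close>
  obtain k where k: "ideal_pow P I k \<inter> M \<subseteq> ideal_prod P I M"
    using artin_rees[OF noeth P.M_cring I M] by blast
  \<comment> \<open>\<open>formally_smooth_lift\<close> supplies successor exponents; this is
    harmless as I^(k+1) lies in I^k.\<close>
  define J where J_eq: "J = ideal_pow P I (Suc k)"
  have J: "ideal J P" unfolding J_eq by (rule P.ideal_pow_ideal[OF I])
  let ?C = "quotient_algebra P J"
  interpret C: algebra A ?C by (rule algebra_quotient[OF algP J])
  obtain v where v: "v \<in> alg_hom A B ?C"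
    and vh: "\<And>p b. p \<in> carrier P \<Longrightarrow> b \<in> carrier B \<Longrightarrow> v b = J +>\<^bsub>P\<^esub> p \<Longrightarrow> h p = b"
    using formally_smooth_lift[OF algP B h surj smooth I_def, of k, folded J_eq] by blast
  have "\<exists>p\<in>carrier P. v (b i) = J +>\<^bsub>P\<^esub> p" if "i < n" for i
    using quotient_carrierE[OF alg_homD(1)[OF v, of "b i"]] b that by blast
  then obtain p where p: "\<And>i. i < n \<Longrightarrow> p i \<in> carrier P" "\<And>i. i < n \<Longrightarrow> v (b i) = J +>\<^bsub>P\<^esub> p i"
    by metis
  have pP: "p \<in> {..<n} \<rightarrow> carrier P" using p(1) by auto
  have hp: "h (p i) = b i" if "i < n" for i
    using vh[OF p(1)[OF that] _ p(2)[OF that]] b that by auto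
  have "J +>\<^bsub>P\<^esub> \<sigma> p = (\<Oplus>\<^bsub>?C\<^esub>i\<in>{..<n}. a i \<odot>\<^bsub>?C\<^esub> (J +>\<^bsub>P\<^esub> p i))"
    unfolding \<sigma>_def
    by (rule linear_maps_relation[OF P.module C.module alg_hom_linear[OF quotient_projection[OF algP J]] _ a pP]) simp
  also have "\<dots> = (\<Oplus>\<^bsub>?C\<^esub>i\<in>{..<n}. a i \<odot>\<^bsub>?C\<^esub> v (b i))"
  proof (rule C.M.finsum_cong'[OF refl])
    show "(\<lambda>i. a i \<odot>\<^bsub>?C\<^esub> v (b i)) \<in> {..<n} \<rightarrow> carrier ?C"
      using a b by (intro Pi_I C.smult_closed alg_homD(1)[OF v]) auto
  qed (simp add: p(2))
  also have "\<dots> = v (\<Oplus>\<^bsub>B\<^esub>i\<in>{..<n}. a i \<odot>\<^bsub>B\<^esub> b i)"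
    by (rule linear_maps_relation[OF B.module C.module alg_hom_linear[OF v] _ a b, symmetric]) simp
  also have "\<dots> = \<zero>\<^bsub>?C\<^esub>"
    unfolding eq by (rule linear_maps_zero[OF B.module C.module alg_hom_linear[OF v]])
  also have "\<dots> = J +>\<^bsub>P\<^esub> \<zero>\<^bsub>P\<^esub>"
    by (rule linear_maps_zero[OF P.module C.module alg_hom_linear[OF quotient_projection[OF algP J]], symmetric])
  finally have "\<sigma> p \<ominus>\<^bsub>P\<^esub> \<zero>\<^bsub>P\<^esub> \<in> J"
    using coset_eq_iff[OF algP J \<sigma>_closed[OF pP] P.M.zero_closed] by simp
  then have "\<sigma> p \<in> ideal_pow P I k"
    using P.ideal_pow_Suc_subset[OF I, of k, folded J_eq] \<sigma>_closed[OF pP] by (auto simp: P.minus_eq)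
  then have "\<sigma> p \<in> ideal_prod P I M" using k pP by (auto simp: M_def)
  \<comment> \<open>An element of I M is a value of \<sigma> with arguments in \<open>I\<close>: a
    factor from \<open>I\<close> can be moved inside \<sigma>.\<close>
  moreover have "\<exists>\<epsilon>\<in>{..<n} \<rightarrow> I. x = \<sigma> \<epsilon>" if "x \<in> ideal_prod P I M" for x
    using that
  proof induction
    case (prod i j)
    then obtain q where q: "q \<in> {..<n} \<rightarrow> carrier P" "j = \<sigma> q" by (auto simp: M_def)
    have "i \<in> carrier P" using prod(1) by (simp add: I_def)
    then have "i \<otimes>\<^bsub>P\<^esub> j = \<sigma> (\<lambda>m. i \<otimes>\<^bsub>P\<^esub> q m)" using q by (simp add: \<sigma>_mult)
    moreover have "(\<lambda>m. i \<otimes>\<^bsub>P\<^esub> q m) \<in> {..<n} \<rightarrow> I" using q ideal_closed(6)[OF I prod(1)] by auto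
    ultimately show ?case by blast
  next
    case (sum x y)
    then obtain \<delta> \<epsilon> where *: "\<delta> \<in> {..<n} \<rightarrow> I" "\<epsilon> \<in> {..<n} \<rightarrow> I" "x = \<sigma> \<delta>" "y = \<sigma> \<epsilon>" by blast
    then have "x \<oplus>\<^bsub>P\<^esub> y = \<sigma> (\<lambda>m. \<delta> m \<oplus>\<^bsub>P\<^esub> \<epsilon> m)"
      using ideal_closed(2)[OF I] by (simp add: \<sigma>_add Pi_def)
    moreover have "(\<lambda>m. \<delta> m \<oplus>\<^bsub>P\<^esub> \<epsilon> m) \<in> {..<n} \<rightarrow> I" using * ideal_closed(3)[OF I] by auto
    ultimately show ?case by blast
  qed
  ultimately obtain \<epsilon> where \<epsilon>: "\<epsilon> \<in> {..<n} \<rightarrow> I" "\<sigma> p = \<sigma> \<epsilon>" by blast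
  have \<epsilon>P: "\<epsilon> i \<in> carrier P" "h (\<epsilon> i) = \<zero>\<^bsub>B\<^esub>" if "i < n" for i using \<epsilon>(1) that by (auto simp: I_def)
  \<comment> \<open>Correction by elements of \<open>I\<close> does not change the image in
    \<open>B\<close>, and now the relation holds exactly in \<open>P\<close>.\<close>
  let ?\<gamma> = "\<lambda>i. p i \<ominus>\<^bsub>P\<^esub> \<epsilon> i"
  have \<gamma>: "?\<gamma> \<in> {..<n} \<rightarrow> carrier P" using p(1) \<epsilon>P(1) by auto
  have "\<sigma> \<epsilon> \<oplus>\<^bsub>P\<^esub> \<sigma> ?\<gamma> = \<sigma> (\<lambda>i. \<epsilon> i \<oplus>\<^bsub>P\<^esub> (p i \<ominus>\<^bsub>P\<^esub> \<epsilon> i))"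
    using \<gamma> \<epsilon>P(1) by (intro \<sigma>_add) auto
  also have "\<dots> = \<sigma> p"
    unfolding \<sigma>_def using a p(1) \<epsilon>P(1)
    by (intro P.M.finsum_cong') (auto simp: P.M.add_minus_cancel Pi_def)
  finally have "\<sigma> ?\<gamma> = \<zero>\<^bsub>P\<^esub>"
    using \<epsilon>(2) \<sigma>_closed[OF \<gamma>] \<sigma>_closed[OF pP] P.M.add.r_cancel_one by simp
  then have "trivial_relation A P {..<n} {a} ?\<gamma>"
    using flat a \<gamma> unfolding equationally_flat_def \<sigma>_def by blast
  from trivial_relation_linear_map[OF P.module B.module alg_hom_linear[OF h] this]
  show "trivial_relation A B {..<n} {a} b"
  proof (rule trivial_relation_cong[OF B.module])
    fix i assume "i \<in> {..<n}"
    then have i: "i < n" by simp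
    have "b i \<in> carrier B" using b i by auto
    then show "b i = h (?\<gamma> i)"
      using p(1)[OF i] \<epsilon>P[OF i] hp[OF i] by (simp add: P.minus_eq)
  qed
qed

theorem mainTheorem1:
  fixes A :: "('a, 'k) ring_scheme" and B :: "('a, 'b, 'l) module_scheme"
  assumes "cring A" and "noetherian_ring A"
    and "smooth_algebra TYPE('c) A B"
  shows "flat_module TYPE('m) TYPE('n) A B"
proof -
  have eft: "essentially_of_finite_type TYPE('c) A B" and smooth: "formally_smooth A B"
    using assms(3) by (simp_all add: smooth_algebra_def)
  have B: "algebra A B" using eft by (simp add: essentially_of_finite_type_def)
  obtain P :: "('a, ('a nested \<times> 'a nested) set) module" and h where "noetherian_flat_algebra A P"
    "h \<in> alg_hom A P B" "h ` carrier P = carrier B"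
    using essentially_of_finite_type_presentation[OF assms(1,2) eft] by blast
  then have "equationally_flat A B"
    using B smooth by (intro equationally_flat_formally_smooth_quotient)
  then show ?thesis by (rule equationally_flat_imp_flat_module[OF algebra.module[OF B]])
qed

end
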